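(* Let $B=(B_t)_{t\in\mathbb{R}}$ be fractional Brownian motion with Hurst index $H\in(0,1)$ and let $\ell$ be its local time measure at level $0$. Then there is a constant $c_B\in(0,\infty)$ such that \[ \lim_{T\to\infty}T^{1-H}\,\mathbb{P}\big(\ell(0,T]\le1\big)=c_B . \]
   Context: Fractional Brownian motion of Hurst index $H\in(0,1)$ is the unique (up to multiplication by a nonzero constant) Gaussian process that is $H$-self-similar with stationary increments, i.e. the centered Gaussian process with continuous paths and covariance $\mathbb{E}[B_sB_t]=\frac{\sigma^2}{2}(|s|^{2H}+|t|^{2H}-|t-s|^{2H})$ for some $\sigma>0$. Its local time at $0$ is the random measure on $\mathbb{R}$ given on bounded intervals $A$ by $\ell(A)=\lim_{\epsilon\downarrow0}\frac1{2\epsilon}\int_A\mathbf{1}\{B_t\in(-\epsilon,\epsilon)\}\,dt$ (almost surely); equivalently, $\ell=\ell^0$, where $(\ell^y)_{y}$ is the disintegration $\int_A\mathbf{1}\{B_r\in D\}\,dr=\int_D\ell^y(A)\,dy$ of the occupation measure ($A,D\subset\mathbb{R}$ Borel). We write $\ell(0,T]$ for $\ell((0,T])$. *)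

theory Defs
  imports "HOL-Probability.Probability"
begin

text \<open>Gaussian laws may be degenerate: standard deviation 0 means a point mass.  This is needed
  since linear combinations of the \<open>B\<^sub>t\<close> can vanish (for instance \<open>B\<^sub>0 = 0\<close>).\<close>

definition gaussian_law :: "real \<Rightarrow> real \<Rightarrow> real measure" where
  "gaussian_law \<mu> \<sigma> =
     (if \<sigma> = 0 then return borel \<mu> else density lborel (\<lambda>x. ennreal (normal_density \<mu> \<sigma> x)))"

definition gaussian_variable :: "'a measure \<Rightarrow> ('a \<Rightarrow> real) \<Rightarrow> bool" where
  "gaussian_variable M X \<longleftrightarrow>
     X \<in> borel_measurable M \<and> (\<exists>\<mu> \<sigma>. \<sigma> \<ge> 0 \<and> distr M borel X = gaussian_law \<mu> \<sigma>)"

definition gaussian_process :: "'a measure \<Rightarrow> ('i \<Rightarrow> 'a \<Rightarrow> real) \<Rightarrow> bool" where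
  "gaussian_process M X \<longleftrightarrow>
     (\<forall>J a. finite J \<longrightarrow> gaussian_variable M (\<lambda>\<omega>. \<Sum>j\<in>J. a j * X j \<omega>))"

definition fractional_brownian_motion ::
    "'a measure \<Rightarrow> real \<Rightarrow> (real \<Rightarrow> 'a \<Rightarrow> real) \<Rightarrow> bool" where
  "fractional_brownian_motion M H B \<longleftrightarrow>
     gaussian_process M B \<and>
     (\<forall>t. integral\<^sup>L M (B t) = 0) \<and>
     (\<forall>\<omega>\<in>space M. continuous_on UNIV (\<lambda>t. B t \<omega>)) \<and>
     (\<exists>\<sigma>>0. \<forall>s t. integral\<^sup>L M (\<lambda>\<omega>. B s \<omega> * B t \<omega>) =
        \<sigma>\<^sup>2 / 2 * (\<bar>s\<bar> powr (2 * H) + \<bar>t\<bar> powr (2 * H) - \<bar>t - s\<bar> powr (2 * H)))"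

definition random_measure :: "'a measure \<Rightarrow> ('a \<Rightarrow> real measure) \<Rightarrow> bool" where
  "random_measure M L \<longleftrightarrow>
     (\<forall>\<omega>\<in>space M. sets (L \<omega>) = sets borel) \<and>
     (\<forall>A\<in>sets borel. (\<lambda>\<omega>. emeasure (L \<omega>) A) \<in> borel_measurable M)"

text \<open>The exceptional null set may depend on \<open>A\<close>.  The limit is taken in the extended nonnegative
  reals, so convergence to \<open>emeasure (L \<omega>) A\<close> carries no hidden finiteness convention.\<close>

definition local_time_at_zero ::
    "'a measure \<Rightarrow> (real \<Rightarrow> 'a \<Rightarrow> real) \<Rightarrow> ('a \<Rightarrow> real measure) \<Rightarrow> bool" where
  "local_time_at_zero M B L \<longleftrightarrow>
     random_measure M L \<and>
     (\<forall>A. is_interval A \<and> bounded A \<longrightarrow>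
        (AE \<omega> in M.
          ((\<lambda>\<epsilon>. ennreal (1 / (2 * \<epsilon>)) * (\<integral>\<^sup>+t\<in>A. indicator {-\<epsilon><..<\<epsilon>} (B t \<omega>) \<partial>lborel))
            \<longlongrightarrow> emeasure (L \<omega>) A) (at_right 0)))"

end

theory Submission imports Defs begin

text \<open>
  Write \<open>\<alpha> = 1 - H\<close>, let \<open>\<ell>\<^sup>x\<close> be the local time at level \<open>x\<close> and \<open>h(u) = P(\<ell>\<^sup>0(0,u] \<le> 1)\<close>. For a path
  whose occupation measure has a density, splitting the mass \<open>\<ell>\<^sup>x(0,1]\<close> according to whether the
  mass still to come is at most \<open>s\<close> gives, by the occupation formula,
  \<open>|{t \<le> 1. \<ell>\<^sup>z(t,1] \<le> s at z = B\<^sub>t}| = \<integral> min(s, \<ell>\<^sup>x(0,1]) dx\<close>. Taking expectations, stationarity of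
  the increments turns the left-hand side into \<open>\<integral>\<^sub>0\<^sup>1 P(\<ell>\<^sup>0(0,u] \<le> s) du\<close>, and self-similarity turns this,
  for \<open>s = R\<close> to the power \<open>-\<alpha>\<close>, into \<open>(1/R) \<integral>\<^sub>0\<^sup>R h\<close>. Divided by \<open>s\<close>, the right-hand side increases as
  \<open>s\<close> decreases and is bounded by the expected range of \<open>B\<close> on \<open>[0,1]\<close>, which is finite by chaining.
  Hence \<open>\<integral>\<^sub>0\<^sup>R h\<close> is asymptotic to a constant times \<open>R\<close> to the power \<open>H\<close>; since \<open>h\<close> is decreasing, the
  monotone density theorem gives the asymptotics of \<open>h\<close>.

  The occupation measure has a density because, by stationarity, the finiteness of the local time
  at level 0 makes its symmetric density finite at \<open>B\<^sub>t\<close> for almost every \<open>t\<close>.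
\<close>

section \<open>Uniqueness of the law of a process\<close>

text \<open>So time is cut into N pieces, which costs a shift by 1/N in each of two inequalities.
  Markov's inequality and a mean local time of order d^(1-H) on (-d,d] exchange the shift for a gap
  between two truncation levels s < s', and the final limit argument tolerates such a gap.
  Stationarity and self-similarity of the local time are drawn from equality of covariances, through
  uniqueness of the law of a Gaussian process. The constant is c_B = H K, where K is the limit of E
  \<integral> min(1, q \<ell>^x(0,1]) dx as q tends to infinity, that is, the expected measure of
  the set of levels with positive local time on (0,1]. It is positive because h(v) is positive for
  small v.\<close>

definition weighted_law :: "'a measure \<Rightarrow> ('a \<Rightarrow> real) \<Rightarrow> ('a \<Rightarrow> real) \<Rightarrow> real \<Rightarrow> real measure" where
  "weighted_law M f X m = distr (density M (\<lambda>\<omega>. ennreal (f \<omega> / m))) borel X"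

lemma weighted_law_properties:
  fixes f X :: "'a \<Rightarrow> real"
  assumes [measurable]: "X \<in> borel_measurable M" "f \<in> borel_measurable M" "A \<in> sets borel"
    and m0: "m > 0" and f: "\<And>\<omega>. 0 \<le> f \<omega>" "integrable M f" "(LINT \<omega>|M. f \<omega>) = m"
  shows "real_distribution (weighted_law M f X m)"
    "measure (weighted_law M f X m) A = (LINT \<omega>|M. f \<omega> * indicator A (X \<omega>)) / m"
    "char (weighted_law M f X m) = (\<lambda>t. (CLINT \<omega>|M. f \<omega> * iexp (t * X \<omega>)) / m)"
proof -
  have "(\<integral>\<^sup>+ \<omega>. ennreal (f \<omega> / m) \<partial>M) = ennreal (LINT \<omega>|M. f \<omega> / m)"
    using f m0 by (intro nn_integral_eq_integral) auto
  also have "\<dots> = 1" using f m0 by simp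
  finally interpret D: prob_space "density M (\<lambda>\<omega>. ennreal (f \<omega> / m))"
    by (intro prob_spaceI) (simp add: emeasure_density cong: nn_integral_cong)
  show 1: "real_distribution (weighted_law M f X m)"
    unfolding weighted_law_def by (intro D.real_distribution_distr) simp
  have "measure (weighted_law M f X m) A = (LINT x|weighted_law M f X m. indicator A x)"
    by (simp add: weighted_law_def)
  also have "\<dots> = (LINT \<omega>|density M (\<lambda>\<omega>. ennreal (f \<omega> / m)). indicator A (X \<omega>))"
    unfolding weighted_law_def by (subst integral_distr) auto
  also have "\<dots> = (LINT \<omega>|M. (f \<omega> / m) *\<^sub>R indicator A (X \<omega>))"
    using f m0 by (subst integral_density) auto
  finally show "measure (weighted_law M f X m) A = (LINT \<omega>|M. f \<omega> * indicator A (X \<omega>)) / m"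
    by simp
  show "char (weighted_law M f X m) = (\<lambda>t. (CLINT \<omega>|M. f \<omega> * iexp (t * X \<omega>)) / m)"
  proof
    fix t
    have "char (weighted_law M f X m) t = (CLINT \<omega>|density M (\<lambda>\<omega>. ennreal (f \<omega> / m)). iexp (t * X \<omega>))"
      unfolding char_def weighted_law_def by (subst integral_distr) auto
    also have "\<dots> = (CLINT \<omega>|M. (f \<omega> / m) *\<^sub>R iexp (t * X \<omega>))"
      using f m0 by (subst integral_density) auto
    also have "\<dots> = (CLINT \<omega>|M. (f \<omega> * iexp (t * X \<omega>)) / m)"
      by (simp add: scaleR_conv_of_real)
    finally show "char (weighted_law M f X m) t = (CLINT \<omega>|M. f \<omega> * iexp (t * X \<omega>)) / m" by simp
  qed
qed

text \<open>At \<open>t = 0\<close> the hypothesis says that both weights have the same mass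
  \<open>m\<close>. Division by \<open>m\<close> produces probability laws, to which Levy's
  uniqueness theorem for characteristic functions applies; mass 0 cannot be normalised, but then
  both weights vanish almost everywhere.\<close>

lemma weighted_law_unique:
  fixes X f :: "'a \<Rightarrow> real" and Y g :: "'b \<Rightarrow> real"
  assumes "prob_space M" "prob_space N"
    and [measurable]: "X \<in> borel_measurable M" "Y \<in> borel_measurable N"
      "f \<in> borel_measurable M" "g \<in> borel_measurable N" "A \<in> sets borel"
    and f: "\<And>\<omega>. 0 \<le> f \<omega>" "\<And>\<omega>. f \<omega> \<le> (c::real)" and g: "\<And>\<omega>. 0 \<le> g \<omega>" "\<And>\<omega>. g \<omega> \<le> c"
    and eq: "\<And>t. (CLINT \<omega>|M. f \<omega> * iexp (t * X \<omega>)) = (CLINT \<omega>|N. g \<omega> * iexp (t * Y \<omega>))"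
  shows "(LINT \<omega>|M. f \<omega> * indicator A (X \<omega>)) = (LINT \<omega>|N. g \<omega> * indicator A (Y \<omega>))"
proof -
  have int: "integrable M f" if "prob_space M" "f \<in> borel_measurable M"
    "\<And>\<omega>. 0 \<le> f \<omega>" "\<And>\<omega>. f \<omega> \<le> c" for M :: "'c measure" and f :: "'c \<Rightarrow> real"
  proof -
    interpret prob_space M by fact
    show ?thesis using that by (intro integrable_const_bound[of _ c]) auto
  qed
  have fi: "integrable M f" and gi: "integrable N g" using assms by (auto intro!: int)
  define m where "m = (LINT \<omega>|M. f \<omega>)"
  have m2: "m = (LINT \<omega>|N. g \<omega>)"
    using eq[of 0] by (simp add: m_def)
  show ?thesis
  proof (cases "m = 0")
    case True
    have "AE \<omega> in M. f \<omega> = 0" using True fi f by (simp add: m_def integral_nonneg_eq_0_iff_AE)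
    then have 1: "(LINT \<omega>|M. f \<omega> * indicator A (X \<omega>)) = (LINT \<omega>|M. 0)"
      by (intro integral_cong_AE) auto
    have "AE \<omega> in N. g \<omega> = 0" using True gi g by (simp add: m2 integral_nonneg_eq_0_iff_AE)
    then have 2: "(LINT \<omega>|N. g \<omega> * indicator A (Y \<omega>)) = (LINT \<omega>|N. 0)"
      by (intro integral_cong_AE) auto
    show ?thesis using 1 2 by simp
  next
    case False
    have m0: "m > 0" using False f by (simp add: m_def less_le)
    note P = weighted_law_properties[OF _ _ _ m0]
    have "weighted_law M f X m = weighted_law N g Y m"
      proof (intro Levy_uniqueness P(1))
      show "char (weighted_law M f X m) = char (weighted_law N g Y m)"
        using fi gi f g m2 m_def by (subst (1 2) P(3)[of _ _ _ UNIV]) (simp_all only: eq, auto)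
    qed (use fi gi f g m2 m_def in auto)
    then show ?thesis
      using P(2)[where X=X and M=M and f=f and A=A] P(2)[where X=Y and M=N and f=g and A=A]
        fi gi f g m2 m_def m0 by simp
  qed
qed

context prob_space
begin

context
  fixes f \<theta> X :: "'a \<Rightarrow> real" and A :: "real set"
  assumes f: "f \<in> borel_measurable M" "\<And>\<omega>. 0 \<le> f \<omega>" "\<And>\<omega>. f \<omega> \<le> 1"
    and \<theta>: "\<theta> \<in> borel_measurable M" and X: "X \<in> borel_measurable M" and A: "A \<in> sets borel"
begin

private lemma int_iexp: "h \<in> borel_measurable M \<Longrightarrow> integrable M (\<lambda>\<omega>. f \<omega> * iexp (h \<omega>))"
  using f by (intro integrable_const_bound[of _ 1]) (auto simp: norm_mult)

private lemma int_ind: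
  "h \<in> borel_measurable M \<Longrightarrow> (\<And>\<omega>. \<bar>h \<omega>\<bar> \<le> 1) \<Longrightarrow> integrable M (\<lambda>\<omega>. f \<omega> * indicator A (X \<omega>) * h \<omega>)"
  using f X A by (intro integrable_const_bound[of _ 1]) (auto simp: indicator_def abs_mult mult_le_one)

text \<open>Only nonnegative weights can be normalised to a law, so the complex factor
  \<open>iexp (\<theta> \<omega>)\<close> has to enter through \<open>1 + cos\<close> and
  \<open>1 + sin\<close>. Both have the form of \<open>h\<close>, and the resulting Fourier
  transforms are combinations of the joint transforms of \<open>\<theta>\<close> and
  \<open>X\<close> under \<open>f\<close>.\<close>

private lemma expand_weight:
  assumes h: "\<And>\<omega>. of_real (h \<omega>) = 1 + a * iexp (\<theta> \<omega>) + b * iexp (- \<theta> \<omega>)"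
  shows "(CLINT \<omega>|M. of_real (f \<omega> * h \<omega>) * iexp (t * X \<omega>)) =
    (CLINT \<omega>|M. f \<omega> * iexp (0 * \<theta> \<omega> + t * X \<omega>)) + a * (CLINT \<omega>|M. f \<omega> * iexp (1 * \<theta> \<omega> + t * X \<omega>))
      + b * (CLINT \<omega>|M. f \<omega> * iexp ((-1) * \<theta> \<omega> + t * X \<omega>))"
proof -
  have i: "integrable M (\<lambda>\<omega>. f \<omega> * iexp (r * \<theta> \<omega> + t * X \<omega>))" for r
    using \<theta> X by (intro int_iexp) auto
  have "of_real (f \<omega> * h \<omega>) * iexp (t * X \<omega>) = f \<omega> * iexp (0 * \<theta> \<omega> + t * X \<omega>)
     + a * (f \<omega> * iexp (1 * \<theta> \<omega> + t * X \<omega>)) + b * (f \<omega> * iexp ((-1) * \<theta> \<omega> + t * X \<omega>))" for \<omega>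
    unfolding of_real_mult h by (simp add: algebra_simps exp_add[symmetric] exp_diff exp_minus divide_inverse)
  then show ?thesis
    by (simp only: Bochner_Integration.integral_add integral_mult_right_zero i
      integrable_mult_right Bochner_Integration.integrable_add)
qed

lemma weighted_expectation_cos:
  "(CLINT \<omega>|M. of_real (f \<omega> * (1 + cos (\<theta> \<omega>))) * iexp (t * X \<omega>)) =
    (CLINT \<omega>|M. f \<omega> * iexp (0 * \<theta> \<omega> + t * X \<omega>)) + 1/2 * (CLINT \<omega>|M. f \<omega> * iexp (1 * \<theta> \<omega> + t * X \<omega>))
      + 1/2 * (CLINT \<omega>|M. f \<omega> * iexp ((-1) * \<theta> \<omega> + t * X \<omega>))"
  by (rule expand_weight) (simp add: exp_Euler cos_of_real sin_of_real exp_minus complex_eq_iff cis_conv_exp[symmetric] flip: cis_inverse)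

lemma weighted_expectation_sin:
  "(CLINT \<omega>|M. of_real (f \<omega> * (1 + sin (\<theta> \<omega>))) * iexp (t * X \<omega>)) =
    (CLINT \<omega>|M. f \<omega> * iexp (0 * \<theta> \<omega> + t * X \<omega>)) + (-\<i>/2) * (CLINT \<omega>|M. f \<omega> * iexp (1 * \<theta> \<omega> + t * X \<omega>))
      + \<i>/2 * (CLINT \<omega>|M. f \<omega> * iexp ((-1) * \<theta> \<omega> + t * X \<omega>))"
  by (rule expand_weight) (simp add: exp_Euler cos_of_real sin_of_real exp_minus complex_eq_iff cis_conv_exp[symmetric] flip: cis_inverse)

text \<open>The real part is the expectation under the weight \<open>f * (1 + cos \<theta>)\<close>
  minus the one under \<open>f\<close>; the imaginary part arises likewise from the sine.\<close>

lemma weighted_expectation_Complex: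
  "(CLINT \<omega>|M. of_real (f \<omega> * indicator A (X \<omega>)) * iexp (\<theta> \<omega>)) =
    Complex ((LINT \<omega>|M. f \<omega> * (1 + cos (\<theta> \<omega>)) * indicator A (X \<omega>)) - (LINT \<omega>|M. f \<omega> * indicator A (X \<omega>)))
      ((LINT \<omega>|M. f \<omega> * (1 + sin (\<theta> \<omega>)) * indicator A (X \<omega>)) - (LINT \<omega>|M. f \<omega> * indicator A (X \<omega>)))"
proof -
  have d: "(LINT \<omega>|M. f \<omega> * (1 + h \<omega>) * indicator A (X \<omega>)) =
      (LINT \<omega>|M. f \<omega> * indicator A (X \<omega>)) + (LINT \<omega>|M. f \<omega> * indicator A (X \<omega>) * h \<omega>)"
    if "h \<in> borel_measurable M" "\<And>\<omega>. \<bar>h \<omega>\<bar> \<le> 1" for h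
    using int_ind[of "\<lambda>_. 1"] int_ind[OF that]
    by (subst Bochner_Integration.integral_add[symmetric]) (auto simp: algebra_simps)
  have c: "integrable M (\<lambda>\<omega>. f \<omega> * indicator A (X \<omega>) * cos (\<theta> \<omega>))"
    "integrable M (\<lambda>\<omega>. f \<omega> * indicator A (X \<omega>) * sin (\<theta> \<omega>))"
    using \<theta> by (auto intro!: int_ind)
  have "of_real (f \<omega> * indicator A (X \<omega>)) * iexp (\<theta> \<omega>) = of_real (f \<omega> * indicator A (X \<omega>) * cos (\<theta> \<omega>))
      + \<i> * of_real (f \<omega> * indicator A (X \<omega>) * sin (\<theta> \<omega>))" for \<omega>
    by (simp add: exp_Euler cos_of_real sin_of_real algebra_simps of_real_indicator)
  then have "(CLINT \<omega>|M. of_real (f \<omega> * indicator A (X \<omega>)) * iexp (\<theta> \<omega>)) =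
      of_real (LINT \<omega>|M. f \<omega> * indicator A (X \<omega>) * cos (\<theta> \<omega>))
      + \<i> * of_real (LINT \<omega>|M. f \<omega> * indicator A (X \<omega>) * sin (\<theta> \<omega>))"
    using c by (simp only: Bochner_Integration.integral_add integral_mult_right_zero
      integrable_mult_right integrable_of_real integral_complex_of_real)
  then show ?thesis using \<theta> by (simp add: d complex_eq_iff)
qed

end

end

text \<open>The weights \<open>f\<close>, \<open>f * (1 + cos \<theta>)\<close> and
  \<open>f * (1 + sin \<theta>)\<close> determine the complex integral, and
  \<open>weighted_law_unique\<close> applies to each. One exponential is thus traded for an
  indicator while another exponential survives, which is what an induction over coordinates
  consumes.\<close>

lemma complex_weighted_law_unique:
  fixes X f \<theta> :: "'a \<Rightarrow> real" and Y g \<eta> :: "'b \<Rightarrow> real"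
  assumes M: "prob_space M" and N: "prob_space N"
    and X[measurable]: "X \<in> borel_measurable M" and Y[measurable]: "Y \<in> borel_measurable N"
    and fm[measurable]: "f \<in> borel_measurable M" and gm[measurable]: "g \<in> borel_measurable N" 
    and \<theta>[measurable]: "\<theta> \<in> borel_measurable M" and \<eta>[measurable]: "\<eta> \<in> borel_measurable N"
    and A[measurable]: "A \<in> sets borel"
    and f: "\<And>\<omega>. 0 \<le> f \<omega>" "\<And>\<omega>. f \<omega> \<le> (1::real)" and g: "\<And>\<omega>. 0 \<le> g \<omega>" "\<And>\<omega>. g \<omega> \<le> 1"
    and eq: "\<And>r t. (CLINT \<omega>|M. f \<omega> * iexp (r * \<theta> \<omega> + t * X \<omega>)) = (CLINT \<omega>|N. g \<omega> * iexp (r * \<eta> \<omega> + t * Y \<omega>))"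
  shows "(CLINT \<omega>|M. of_real (f \<omega> * indicator A (X \<omega>)) * iexp (\<theta> \<omega>)) = (CLINT \<omega>|N. of_real (g \<omega> * indicator A (Y \<omega>)) * iexp (\<eta> \<omega>))"
proof -
  have b: "0 \<le> x * (1 + cos z)" "x * (1 + cos z) \<le> 2" "0 \<le> x * (1 + sin z)" "x * (1 + sin z) \<le> 2"
    if "0 \<le> x" "x \<le> 1" for x z :: real
  proof -
    have *: "0 \<le> 1 + cos z" "1 + cos z \<le> 2" "0 \<le> 1 + sin z" "1 + sin z \<le> 2"
      using cos_ge_minus_one[of z] cos_le_one[of z] sin_ge_minus_one[of z] sin_le_one[of z] by linarith+
    then show "0 \<le> x * (1 + cos z)" "x * (1 + cos z) \<le> 2" "0 \<le> x * (1 + sin z)" "x * (1 + sin z) \<le> 2"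
      using that mult_mono[of x 1 "1 + cos z" 2] mult_mono[of x 1 "1 + sin z" 2] by auto
  qed
  have 0: "(LINT \<omega>|M. f \<omega> * indicator A (X \<omega>)) = (LINT \<omega>|N. g \<omega> * indicator A (Y \<omega>))"
    using eq[of 0] f g by (intro weighted_law_unique[OF M N, where c=1]) auto
  have 1: "(LINT \<omega>|M. f \<omega> * (1 + cos (\<theta> \<omega>)) * indicator A (X \<omega>)) = (LINT \<omega>|N. g \<omega> * (1 + cos (\<eta> \<omega>)) * indicator A (Y \<omega>))"
  proof (intro weighted_law_unique[OF M N, where c=2] b f g)
    show "(CLINT \<omega>|M. of_real (f \<omega> * (1 + cos (\<theta> \<omega>))) * iexp (t * X \<omega>)) =
        (CLINT \<omega>|N. of_real (g \<omega> * (1 + cos (\<eta> \<omega>))) * iexp (t * Y \<omega>))" for t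
      unfolding prob_space.weighted_expectation_cos[OF M fm f \<theta> X A]
        prob_space.weighted_expectation_cos[OF N gm g \<eta> Y A] eq ..
  qed measurable
  have 2: "(LINT \<omega>|M. f \<omega> * (1 + sin (\<theta> \<omega>)) * indicator A (X \<omega>)) = (LINT \<omega>|N. g \<omega> * (1 + sin (\<eta> \<omega>)) * indicator A (Y \<omega>))"
  proof (intro weighted_law_unique[OF M N, where c=2] b f g)
    show "(CLINT \<omega>|M. of_real (f \<omega> * (1 + sin (\<theta> \<omega>))) * iexp (t * X \<omega>)) =
        (CLINT \<omega>|N. of_real (g \<omega> * (1 + sin (\<eta> \<omega>))) * iexp (t * Y \<omega>))" for t
      unfolding prob_space.weighted_expectation_sin[OF M fm f \<theta> X A]
        prob_space.weighted_expectation_sin[OF N gm g \<eta> Y A] eq ..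
  qed measurable
  show ?thesis
    unfolding prob_space.weighted_expectation_Complex[OF M fm f \<theta> X A]
      prob_space.weighted_expectation_Complex[OF N gm g \<eta> Y A] 0 1 2 ..
qed

text \<open>The indicators replace the exponentials one coordinate at a time, so that only the
  one-dimensional uniqueness theorem is needed.\<close>

lemma finite_dim_law_unique:
  fixes X :: "'i \<Rightarrow> 'a \<Rightarrow> real" and Y :: "'i \<Rightarrow> 'b \<Rightarrow> real"
  assumes M: "prob_space M" and N: "prob_space N"
    and X[measurable]: "\<And>i. X i \<in> borel_measurable M" and Y[measurable]: "\<And>i. Y i \<in> borel_measurable N"
    and law: "\<And>J a. finite J \<Longrightarrow>
      distr M borel (\<lambda>\<omega>. \<Sum>j\<in>J. a j * X j \<omega>) = distr N borel (\<lambda>\<omega>. \<Sum>j\<in>J. a j * Y j \<omega>)"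
    and "finite K" and A: "\<And>k. k \<in> K \<Longrightarrow> A k \<in> sets borel" and "finite J"
  shows "(CLINT \<omega>|M. of_real (\<Prod>k\<in>K. indicator (A k) (X k \<omega>)) * iexp (\<Sum>j\<in>J. a j * X j \<omega>)) =
    (CLINT \<omega>|N. of_real (\<Prod>k\<in>K. indicator (A k) (Y k \<omega>)) * iexp (\<Sum>j\<in>J. a j * Y j \<omega>))"
  using \<open>finite K\<close> A \<open>finite J\<close>
proof (induction arbitrary: J a)
  case empty
  have "(CLINT x|distr M borel (\<lambda>\<omega>. \<Sum>j\<in>J. a j * X j \<omega>). iexp x) =
     (CLINT x|distr N borel (\<lambda>\<omega>. \<Sum>j\<in>J. a j * Y j \<omega>). iexp x)"
    using law[OF empty(2)] by simp
  then show ?case by (subst (asm) (1 2) integral_distr) auto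
next
  case (insert k K)
  have [measurable]: "A i \<in> sets borel" if "i \<in> insert k K" for i using insert that by auto
  \<comment> \<open>The new index \<open>k\<close> may already occur in \<open>J\<close>; the two
    conditional coefficients then add up.\<close>
  have lin: "(\<Sum>j\<in>insert k J. ((if j \<in> J then r * a j else 0) + (if j = k then t else 0)) * Z j \<omega>) =
      r * (\<Sum>j\<in>J. a j * Z j \<omega>) + t * Z k \<omega>" for r t :: real and Z :: "'i \<Rightarrow> 'c \<Rightarrow> real" and \<omega>
  proof -
    have "(\<Sum>j\<in>insert k J. ((if j \<in> J then r * a j else 0) + (if j = k then t else 0)) * Z j \<omega>) =
      (\<Sum>j\<in>insert k J. (if j \<in> J then r * a j * Z j \<omega> else 0)) + (\<Sum>j\<in>insert k J. (if j = k then t * Z j \<omega> else 0))"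
      by (subst sum.distrib[symmetric]) (intro sum.cong, auto simp: algebra_simps)
    also have "(\<Sum>j\<in>insert k J. (if j \<in> J then r * a j * Z j \<omega> else 0)) = (\<Sum>j\<in>J. r * a j * Z j \<omega>)"
      using insert(5) by (subst sum.inter_restrict[symmetric]) (auto intro!: sum.cong)
    finally show ?thesis using insert(5) by (simp add: sum_distrib_left mult.assoc)
  qed
  have P: "(0::real) \<le> (\<Prod>k\<in>K. indicator (A k) (Z k))" "(\<Prod>k\<in>K. indicator (A k) (Z k)) \<le> (1::real)" for Z
    by (auto intro!: prod_nonneg prod_le_1)
  have m: "(\<lambda>\<omega>. \<Prod>k\<in>K. indicator (A k) (X k \<omega>) :: real) \<in> borel_measurable M"
      "(\<lambda>\<omega>. \<Prod>k\<in>K. indicator (A k) (Y k \<omega>) :: real) \<in> borel_measurable N"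
    by (auto intro!: borel_measurable_prod)
  have "(CLINT \<omega>|M. of_real ((\<Prod>k\<in>K. indicator (A k) (X k \<omega>)) * indicator (A k) (X k \<omega>)) * iexp (\<Sum>j\<in>J. a j * X j \<omega>)) =
    (CLINT \<omega>|N. of_real ((\<Prod>k\<in>K. indicator (A k) (Y k \<omega>)) * indicator (A k) (Y k \<omega>)) * iexp (\<Sum>j\<in>J. a j * Y j \<omega>))"
  proof (intro complex_weighted_law_unique[OF M N,
      where f="\<lambda>\<omega>. \<Prod>k\<in>K. indicator (A k) (X k \<omega>)" and g="\<lambda>\<omega>. \<Prod>k\<in>K. indicator (A k) (Y k \<omega>)"
        and \<theta>="\<lambda>\<omega>. \<Sum>j\<in>J. a j * X j \<omega>" and \<eta>="\<lambda>\<omega>. \<Sum>j\<in>J. a j * Y j \<omega>"] P m)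
    fix r t
    show "(CLINT \<omega>|M. of_real (\<Prod>k\<in>K. indicator (A k) (X k \<omega>)) * iexp (r * (\<Sum>j\<in>J. a j * X j \<omega>) + t * X k \<omega>)) =
      (CLINT \<omega>|N. of_real (\<Prod>k\<in>K. indicator (A k) (Y k \<omega>)) * iexp (r * (\<Sum>j\<in>J. a j * Y j \<omega>) + t * Y k \<omega>))"
      using insert.IH[of "insert k J" "\<lambda>j. (if j \<in> J then r * a j else 0) + (if j = k then t else 0)"] insert
      by (simp only: lin) auto
  qed auto
  then show ?case using insert by (simp add: mult_ac of_real_indicator)
qed

text \<open>This is the Cramer-Wold device: the laws of linear combinations fix the probabilities of
  all cylinder sets, by \<open>finite_dim_law_unique\<close> with an empty exponential sum, and the
  cylinder sets generate the product sigma-algebra.\<close>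

theorem process_law_unique:
  fixes X :: "'i \<Rightarrow> 'a \<Rightarrow> real" and Y :: "'i \<Rightarrow> 'b \<Rightarrow> real"
  assumes M: "prob_space M" and N: "prob_space N"
    and X[measurable]: "\<And>i. X i \<in> borel_measurable M" and Y[measurable]: "\<And>i. Y i \<in> borel_measurable N"
    and law: "\<And>J a. finite J \<Longrightarrow>
      distr M borel (\<lambda>\<omega>. \<Sum>j\<in>J. a j * X j \<omega>) = distr N borel (\<lambda>\<omega>. \<Sum>j\<in>J. a j * Y j \<omega>)"
  shows "distr M (PiM UNIV (\<lambda>_. borel)) (\<lambda>\<omega> i. X i \<omega>) = distr N (PiM UNIV (\<lambda>_. borel)) (\<lambda>\<omega> i. Y i \<omega>)"
proof (rule measure_eqI_PiM_infinite)
  interpret M: prob_space M by fact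
  interpret N: prob_space N by fact
  have mX: "(\<lambda>\<omega> i. X i \<omega>) \<in> measurable M (PiM UNIV (\<lambda>_. borel))"
    and mY: "(\<lambda>\<omega> i. Y i \<omega>) \<in> measurable N (PiM UNIV (\<lambda>_. borel))"
    by (auto intro!: measurable_PiM_single' simp: X Y)
  show "finite_measure (distr M (PiM UNIV (\<lambda>_. borel)) (\<lambda>\<omega> i. X i \<omega>))"
    using mX by (intro M.finite_measure_distr)
  fix A :: "'i \<Rightarrow> real set" and J :: "'i set"
  assume J: "finite J" "J \<subseteq> UNIV" and A: "\<And>i. i \<in> J \<Longrightarrow> A i \<in> sets borel"
  have S: "prob_emb UNIV (\<lambda>_. borel) J (Pi\<^sub>E J A) \<in> sets (PiM UNIV (\<lambda>_. borel))" if "prob_emb = prod_emb" for prob_emb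
    unfolding that using J A by (intro sets_PiM_I) auto
  have eq: "emeasure (distr M (PiM UNIV (\<lambda>_. borel)) (\<lambda>\<omega> i. Z i \<omega>)) (prod_emb UNIV (\<lambda>_. borel) J (Pi\<^sub>E J A))
     = ennreal (Re (CLINT \<omega>|M. of_real (\<Prod>k\<in>J. indicator (A k) (Z k \<omega>)) * iexp (\<Sum>j\<in>{}. 0 * Z j \<omega>)))"
    if "prob_space M" and Z[measurable]: "\<And>i. Z i \<in> borel_measurable M" for M :: "'c measure" and Z
  proof -
    interpret prob_space M by fact
    have [measurable]: "i \<in> J \<Longrightarrow> A i \<in> sets borel" for i by fact
    have mZ: "(\<lambda>\<omega> i. Z i \<omega>) \<in> measurable M (PiM UNIV (\<lambda>_. borel))"
      by (auto intro!: measurable_PiM_single' simp: Z)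
    have ms: "{\<omega>\<in>space M. \<forall>k\<in>J. Z k \<omega> \<in> A k} \<in> sets M"
      using J by measurable
    have "(\<Prod>k\<in>J. indicator (A k) (Z k \<omega>)) = (indicator {\<omega>\<in>space M. \<forall>k\<in>J. Z k \<omega> \<in> A k} \<omega> :: real)"
      if "\<omega> \<in> space M" for \<omega>
      using that J by (auto simp: indicator_def intro!: prod.neutral)
    then have "(LINT \<omega>|M. (\<Prod>k\<in>J. indicator (A k) (Z k \<omega>))) = prob {\<omega>\<in>space M. \<forall>k\<in>J. Z k \<omega> \<in> A k}"
      using ms by (simp cong: Bochner_Integration.integral_cong)
    moreover have "emeasure (distr M (PiM UNIV (\<lambda>_. borel)) (\<lambda>\<omega> i. Z i \<omega>)) (prod_emb UNIV (\<lambda>_. borel) J (Pi\<^sub>E J A)) =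
      emeasure M ((\<lambda>\<omega> i. Z i \<omega>) -` (prod_emb UNIV (\<lambda>_. borel) J (Pi\<^sub>E J A)) \<inter> space M)"
      using mZ S by (subst emeasure_distr) auto
    moreover have "(\<lambda>\<omega> i. Z i \<omega>) -` (prod_emb UNIV (\<lambda>_. borel) J (Pi\<^sub>E J A)) \<inter> space M = {\<omega>\<in>space M. \<forall>k\<in>J. Z k \<omega> \<in> A k}"
      by (auto simp: prod_emb_def PiE_iff)
    ultimately show ?thesis by (simp add: emeasure_eq_measure del: of_real_prod)
  qed
  show "emeasure (distr M (PiM UNIV (\<lambda>_. borel)) (\<lambda>\<omega> i. X i \<omega>)) (prod_emb UNIV (\<lambda>_. borel) J (Pi\<^sub>E J A)) =
      emeasure (distr N (PiM UNIV (\<lambda>_. borel)) (\<lambda>\<omega> i. Y i \<omega>)) (prod_emb UNIV (\<lambda>_. borel) J (Pi\<^sub>E J A))"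
    using finite_dim_law_unique[OF M N X Y law J(1) A, where J="{}" and a="\<lambda>_. 0"]
    by (subst eq[OF M X], subst eq[OF N Y]) simp
qed auto

section \<open>Symmetric densities of measures on the line\<close>

text \<open>Centred windows match the definition of the local time at level 0. An upper limit exists
  at every point, and along a sequence of radii it stays measurable.\<close>

definition sym_upper_density :: "real measure \<Rightarrow> real \<Rightarrow> ennreal" where
  "sym_upper_density N x = limsup (\<lambda>n. ennreal (real (Suc n) / 2) * emeasure N {x - 1 / real (Suc n)<..<x + 1 / real (Suc n)})"

text \<open>By Tonelli, each point \<open>x\<close> of \<open>C\<close> is counted for exactly the
  centres \<open>y\<close> with \<open>\<bar>x - y\<bar> < d\<close>, a set of length
  \<open>2 * d\<close>.\<close>

lemma nn_integral_emeasure_window: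
  assumes "finite_measure N" and [measurable_cong, simp]: "sets N = sets borel" and [measurable]: "C \<in> sets borel" and d: "d \<ge> 0"
  shows "(\<integral>\<^sup>+ y. emeasure N (C \<inter> {y - d<..<y + d}) \<partial>lborel) = ennreal (2 * d) * emeasure N C"
proof -
  interpret N: finite_measure N by fact
  interpret P: pair_sigma_finite lborel N
    by (simp add: N.sigma_finite_measure_axioms lborel.sigma_finite_measure_axioms pair_sigma_finite.intro)
  have "(\<integral>\<^sup>+ y. emeasure N (C \<inter> {y - d<..<y + d}) \<partial>lborel) =
      (\<integral>\<^sup>+ y. \<integral>\<^sup>+ x. indicator C x * indicator {p. \<bar>fst p - snd p\<bar> < d} (x, y) \<partial>N \<partial>lborel)"
  proof (rule nn_integral_cong)
    fix y
    have "emeasure N (C \<inter> {y - d<..<y + d}) = (\<integral>\<^sup>+ x. indicator (C \<inter> {y - d<..<y + d}) x \<partial>N)"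
      by (rule nn_integral_indicator[symmetric]) simp
    also have "\<dots> = (\<integral>\<^sup>+ x. indicator C x * indicator {p. \<bar>fst p - snd p\<bar> < d} (x, y) \<partial>N)"
      by (auto intro!: nn_integral_cong simp: indicator_def abs_real_def)
    finally show "emeasure N (C \<inter> {y - d<..<y + d}) = (\<integral>\<^sup>+ x. indicator C x * indicator {p. \<bar>fst p - snd p\<bar> < d} (x, y) \<partial>N)" .
  qed
  also have "\<dots> = (\<integral>\<^sup>+ x. \<integral>\<^sup>+ y. indicator C x * indicator {p. \<bar>fst p - snd p\<bar> < d} (x, y) \<partial>lborel \<partial>N)"
    by (rule P.Fubini'[symmetric]) measurable
  also have "\<dots> = (\<integral>\<^sup>+ x. indicator C x * ennreal (2 * d) \<partial>N)"
  proof (rule nn_integral_cong)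
    fix x
    have "(\<integral>\<^sup>+ y. indicator {p. \<bar>fst p - snd p\<bar> < d} (x, y) \<partial>lborel) = (\<integral>\<^sup>+ y. indicator {x - d<..<x + d} y \<partial>lborel)"
      by (auto intro!: nn_integral_cong simp: indicator_def abs_real_def)
    also have "\<dots> = ennreal (2 * d)" using d by simp
    finally show "(\<integral>\<^sup>+ y. indicator C x * indicator {p. \<bar>fst p - snd p\<bar> < d} (x, y) \<partial>lborel) = indicator C x * ennreal (2 * d)"
      by (subst nn_integral_cmult) auto
  qed
  also have "\<dots> = ennreal (2 * d) * emeasure N C"
    by (subst nn_integral_multc) (auto simp: mult.commute)
  finally show ?thesis .
qed

lemma emeasure_window_measurable:
  fixes d :: real
  assumes "finite_measure N" and [measurable_cong, simp]: "sets N = sets borel"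
  shows "(\<lambda>x. emeasure N {x - d<..<x + d}) \<in> borel_measurable borel"
proof -
  interpret N: finite_measure N by fact
  have "(\<lambda>x. \<integral>\<^sup>+ y. indicator {p. \<bar>fst p - snd p\<bar> < d} (x, y) \<partial>N) \<in> borel_measurable borel"
    by measurable
  also have "(\<lambda>x. \<integral>\<^sup>+ y. indicator {p. \<bar>fst p - snd p\<bar> < d} (x, y) \<partial>N) = (\<lambda>x. \<integral>\<^sup>+ y. indicator {x - d<..<x + d} y \<partial>N)"
    by (auto intro!: nn_integral_cong simp: indicator_def fun_eq_iff)
  finally show ?thesis by simp
qed

lemma sym_upper_density_measurable:
  assumes "finite_measure N" and "sets N = sets borel"
  shows "sym_upper_density N \<in> borel_measurable borel"
  unfolding sym_upper_density_def[abs_def] using emeasure_window_measurable[OF assms] by measurable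

text \<open>Average the mass of a window over its centre.\<close>

lemma bounded_density_mass_le:
  fixes k :: real and U :: "real set"
  assumes N: "finite_measure N" and [measurable_cong, simp]: "sets N = sets borel"
    and [measurable]: "C \<in> sets borel" and U: "U \<in> sets borel" and d: "d > 0" and k: "k \<ge> 0"
    and dens: "\<And>x. x \<in> C \<Longrightarrow> emeasure N {x - 2 * d<..<x + 2 * d} \<le> ennreal (2 * d * k)"
    and in_U: "\<And>x y. x \<in> C \<Longrightarrow> \<bar>y - x\<bar> < d \<Longrightarrow> y \<in> U"
  shows "emeasure N C \<le> ennreal k * emeasure lborel U"
proof -
  have "ennreal (2 * d) * emeasure N C = (\<integral>\<^sup>+ y. emeasure N (C \<inter> {y - d<..<y + d}) \<partial>lborel)"
    using d by (subst nn_integral_emeasure_window[OF N]) auto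
  also have "\<dots> \<le> (\<integral>\<^sup>+ y. ennreal (2 * d * k) * indicator U y \<partial>lborel)"
  proof (rule nn_integral_mono)
    fix y
    show "emeasure N (C \<inter> {y - d<..<y + d}) \<le> ennreal (2 * d * k) * indicator U y"
    proof (cases "C \<inter> {y - d<..<y + d} = {}")
      case False
      then obtain x where "x \<in> C" "x \<in> {y - d<..<y + d}" by blast
      then have x: "x \<in> C" "\<bar>y - x\<bar> < d" by auto
      \<comment> \<open>The centre \<open>y\<close> may lie outside \<open>C\<close>; passing to a
        point \<open>x\<close> of \<open>C\<close> in its window doubles the radius.\<close>
      have "emeasure N (C \<inter> {y - d<..<y + d}) \<le> emeasure N {x - 2 * d<..<x + 2 * d}"
        using x(2) by (intro emeasure_mono) (auto simp: abs_real_def split: if_splits)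
      then show ?thesis using dens[OF x(1)] in_U[OF x] by simp
    qed simp
  qed
  also have "\<dots> = ennreal (2 * d) * (ennreal k * emeasure lborel U)"
  proof -
    have "(\<integral>\<^sup>+ y. ennreal (2 * d * k) * indicator U y \<partial>lborel) = ennreal (2 * d * k) * emeasure lborel U"
      using U by (intro nn_integral_cmult_indicator) simp
    also have "\<dots> = ennreal (2 * d) * (ennreal k * emeasure lborel U)"
      using d k by (subst ennreal_mult'') (auto simp only: mult.assoc)
    finally show ?thesis .
  qed
  finally show ?thesis
    using d by (simp add: ennreal_mult_le_mult_iff)
qed

lemma ennreal_zero_of_le_eps:
  fixes x :: ennreal
  assumes "\<And>e::real. e > 0 \<Longrightarrow> x \<le> ennreal e" shows "x = 0"
  using ennreal_le_epsilon[of 0 x] assms by simp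

text \<open>The part of a null set \<open>Z\<close> on which window masses are, from some index on,
  at most a constant times the window length is enclosed in an open set \<open>U\<close> of small
  measure. Averaging windows over their centres bounds the mass of that part by the constant times
  the measure of \<open>U\<close>; this takes the place of a covering theorem.\<close>

lemma absolutely_continuous_of_sym_upper_density:
  assumes N: "finite_measure N" and sN[measurable_cong, simp]: "sets N = sets borel"
    and fin: "AE x in N. sym_upper_density N x < \<infinity>"
  shows "absolutely_continuous lborel N"
  unfolding absolutely_continuous_def
proof
  fix Z :: "real set" assume Z: "Z \<in> null_sets lborel"
  then have [measurable]: "Z \<in> sets borel" by auto
  note [measurable] = emeasure_window_measurable[OF N sN]
  \<comment> \<open>The bound is \<open>k / 2\<close> times the length of the window. One index
    \<open>k\<close> serves both as density bound and as the threshold from which the bound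
    holds.\<close>
  define C where "C k = Z \<inter> {x. \<forall>n\<ge>k. emeasure N {x - 1 / real (Suc n)<..<x + 1 / real (Suc n)} \<le> ennreal (real k / real (Suc n))}" for k :: nat
  have C[measurable]: "C k \<in> sets borel" for k unfolding C_def by measurable
  have "emeasure N (C k) = 0" for k
  proof (rule ennreal_zero_of_le_eps)
    fix e :: real assume e: "e > 0"
    obtain U where U: "open U" "Z \<subseteq> U" "emeasure lborel (U - Z) < ennreal (e / (real k + 1))"
      using outer_regular_lborel[of Z "e / (real k + 1)"] e by auto
    have lU: "emeasure lborel U \<le> ennreal (e / (real k + 1))"
    proof -
      have "emeasure lborel U \<le> emeasure lborel (U - Z) + emeasure lborel Z"
        using U by (intro order_trans[OF _ emeasure_subadditive] emeasure_mono) auto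
      then show ?thesis using U(3) Z by auto
    qed
    \<comment> \<open>Points at distance at least \<open>1 / Suc m\<close> from the complement of
      \<open>U\<close>: on them a single radius keeps all averaging windows inside \<open>U\<close>,
      as \<open>bounded_density_mass_le\<close> requires.\<close>
    define V where "V m = {x. \<forall>y. \<bar>y - x\<bar> < 1 / real (Suc m) \<longrightarrow> y \<in> U}" for m
    have "closed (V m)" for m
    proof -
      have "V m = - (\<Union>y\<in>-U. ball y (1 / real (Suc m)))"
        by (auto simp: V_def dist_real_def abs_minus_commute)
      then show ?thesis by (auto intro!: open_UN simp: closed_def)
    qed
    then have [measurable]: "V m \<in> sets borel" for m by auto
    have "emeasure N (C k \<inter> V m) \<le> ennreal e" for m
    proof -
      \<comment> \<open>\<open>n \<ge> k\<close> makes the density bound available at radius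
        \<open>1 / Suc n\<close>, and \<open>n \<ge> m\<close> keeps half that radius within the
        margin of \<open>V m\<close>.\<close>
      define n where "n = max k m"
      have nm: "1 / real (2 * Suc n) \<le> 1 / real (Suc m)"
        by (intro divide_left_mono) (auto simp: n_def)
      have "emeasure N (C k \<inter> V m) \<le> ennreal (real k) * emeasure lborel U"
      proof (rule bounded_density_mass_le[OF N sN, where d="1 / real (2 * Suc n)"])
        fix x assume x: "x \<in> C k \<inter> V m"
        have *: "2 * (1 / real (2 * Suc n)) = 1 / real (Suc n)" by (simp add: field_simps)
        show "emeasure N {x - 2 * (1 / real (2 * Suc n))<..<x + 2 * (1 / real (2 * Suc n))}
            \<le> ennreal (2 * (1 / real (2 * Suc n)) * real k)"
          unfolding * using x by (auto simp: C_def n_def simp del: of_nat_Suc)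
        fix y assume "\<bar>y - x\<bar> < 1 / real (2 * Suc n)"
        with nm x show "y \<in> U" by (auto simp: V_def)
      qed (use U in auto)
      also have "\<dots> \<le> ennreal (real k) * ennreal (e / (real k + 1))"
        by (intro mult_left_mono lU) auto
      also have "\<dots> \<le> ennreal e"
        using e by (subst ennreal_mult[symmetric]) (auto intro!: ennreal_leI simp: field_simps)
      finally show ?thesis .
    qed
    moreover have "emeasure N (\<Union>m. C k \<inter> V m) = (SUP m. emeasure N (C k \<inter> V m))"
    proof (rule SUP_emeasure_incseq[symmetric])
      show "incseq (\<lambda>m. C k \<inter> V m)"
      proof (rule incseq_SucI)
        fix m
        have "1 / real (Suc (Suc m)) \<le> 1 / real (Suc m)" by (intro divide_left_mono) auto
        then show "C k \<inter> V m \<subseteq> C k \<inter> V (Suc m)"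
          unfolding V_def by (auto dest: less_le_trans)
      qed
    qed auto
    moreover have "(\<Union>m. C k \<inter> V m) = C k"
    proof -
      have "\<exists>m. x \<in> V m" if "x \<in> C k" for x
      proof -
        have "x \<in> U" using that U by (auto simp: C_def)
        then obtain r where r: "r > 0" "ball x r \<subseteq> U" using U(1) openE by blast
        then obtain m where "1 / real (Suc m) < r" using reals_Archimedean[of r] by (auto simp: inverse_eq_divide)
        with r show ?thesis by (auto intro!: exI[of _ m] simp: V_def dist_real_def abs_minus_commute subset_eq)
      qed
      then show ?thesis by auto
    qed
    ultimately show "emeasure N (C k) \<le> ennreal e" by (simp add: SUP_le_iff)
  qed
  then have "AE x in N. x \<notin> C k" for k
    by (intro AE_not_in) (auto simp: null_sets_def)
  then have "AE x in N. \<forall>k. x \<notin> C k" by (simp add: AE_all_countable)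
  with fin have "AE x in N. x \<notin> Z"
  proof eventually_elim
    case (elim x)
    show ?case
    proof
      assume "x \<in> Z"
      obtain M where M: "sym_upper_density N x < ennreal M" "M \<ge> 0"
      proof -
        obtain r where "r \<ge> 0" "sym_upper_density N x = ennreal r"
          using elim(1) by (cases "sym_upper_density N x") auto
        then show ?thesis using that[of "r + 1"] by (simp add: ennreal_less_iff)
      qed
      then have "eventually (\<lambda>n. ennreal (real (Suc n) / 2) * emeasure N {x - 1 / real (Suc n)<..<x + 1 / real (Suc n)} < ennreal M) sequentially"
        unfolding sym_upper_density_def by (intro Limsup_lessD)
      then obtain n0 where n0: "\<And>n. n \<ge> n0 \<Longrightarrow> ennreal (real (Suc n) / 2) * emeasure N {x - 1 / real (Suc n)<..<x + 1 / real (Suc n)} < ennreal M"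
        by (auto simp: eventually_sequentially)
      \<comment> \<open>A density below \<open>M\<close> means a window mass below
        \<open>2 * M / Suc n\<close>, so \<open>k\<close> has to reach both \<open>n0\<close> and
        \<open>2 * M\<close>.\<close>
      define k where "k = max n0 (nat \<lceil>2 * M\<rceil>)"
      have kM: "2 * M \<le> real k" unfolding k_def by linarith
      have "emeasure N {x - 1 / real (Suc n)<..<x + 1 / real (Suc n)} \<le> ennreal (real k / real (Suc n))" if "n \<ge> k" for n
      proof -
        have "emeasure N {x - 1 / real (Suc n)<..<x + 1 / real (Suc n)} = 
          ennreal (2 / real (Suc n)) * (ennreal (real (Suc n) / 2) * emeasure N {x - 1 / real (Suc n)<..<x + 1 / real (Suc n)})"
          by (simp add: mult.assoc[symmetric] ennreal_mult[symmetric] del: of_nat_Suc)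
        also have "\<dots> \<le> ennreal (2 / real (Suc n)) * ennreal M"
          using n0[of n] that by (intro mult_left_mono) (auto simp: k_def)
        also have "\<dots> = ennreal (2 * M / real (Suc n))" using M by (subst ennreal_mult[symmetric]) auto
        also have "\<dots> \<le> ennreal (real k / real (Suc n))"
          using kM by (intro ennreal_leI divide_right_mono) auto
        finally show ?thesis .
      qed
      then have "x \<in> C k" using \<open>x \<in> Z\<close> by (simp add: C_def)
      with elim(2) show False by blast
    qed
  qed
  then show "Z \<in> null_sets N" by (subst AE_iff_null_sets) auto
qed

text \<open>The one-sided differentiation theorem concerns averages over \<open>[x, x + h]\<close>.
  Applied also to the reflection of \<open>g\<close>, at the point \<open>- x\<close>, it yields the
  left-hand average, and the symmetric average is the mean of the two.\<close>

lemma Lebesgue_differentiation_symmetric: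
  fixes g :: "real \<Rightarrow> real"
  assumes g: "integrable lborel g"
  shows "AE x in lborel. ((\<lambda>h. integral {x - h..x + h} g / (2 * h)) \<longlongrightarrow> g x) (at_right 0)"
proof -
  have int: "f integrable_on cbox a b" if "integrable lborel f" for f :: "real \<Rightarrow> real" and a b
    using integrable_on_lborel[OF that] integrable_on_subcbox by blast
  have *: "\<exists>N. negligible N \<and> (\<forall>x. x \<notin> N \<longrightarrow> ((\<lambda>h. integral {x..x + h} f / h) \<longlongrightarrow> f x) (at_right 0))"
    if f: "integrable lborel f" for f :: "real \<Rightarrow> real"
  proof -
    obtain N where N: "negligible N" "\<And>x e. \<lbrakk>x \<notin> N; 0 < e\<rbrakk> \<Longrightarrow>
      \<exists>d>0. \<forall>h. 0 < h \<and> h < d \<longrightarrow> norm (integral (cbox x (x + h *\<^sub>R One)) f /\<^sub>R h ^ DIM(real) - f x) < e"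
      by (rule integrable_ccontinuous_explicit[of f]) (use int[OF f] in blast)+
    have "((\<lambda>h. integral {x..x + h} f / h) \<longlongrightarrow> f x) (at_right 0)" if "x \<notin> N" for x
    proof (rule tendstoI)
      fix e :: real assume "e > 0"
      from N(2)[OF \<open>x \<notin> N\<close> this] obtain d where "d > 0"
        "\<forall>h. 0 < h \<and> h < d \<longrightarrow> norm (integral (cbox x (x + h *\<^sub>R One)) f /\<^sub>R h ^ DIM(real) - f x) < e" by blast
      then show "\<forall>\<^sub>F h in at_right 0. dist (integral {x..x + h} f / h) (f x) < e"
        by (auto simp: eventually_at_right_field dist_real_def field_simps intro!: exI[of _ d])
    qed
    with N(1) show ?thesis by blast
  qed
  define g' where "g' x = g (- x)" for x
  have g': "integrable lborel g'"
    using lborel_integrable_real_affine[OF g, of "-1" 0] by (simp add: g'_def[abs_def])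
  obtain N where N: "negligible N" "\<And>x. x \<notin> N \<Longrightarrow> ((\<lambda>h. integral {x..x + h} g / h) \<longlongrightarrow> g x) (at_right 0)"
    using *[OF g] by blast
  obtain N' where N': "negligible N'" "\<And>x. x \<notin> N' \<Longrightarrow> ((\<lambda>h. integral {x..x + h} g' / h) \<longlongrightarrow> g' x) (at_right 0)"
    using *[OF g'] by blast
  have conv: "((\<lambda>h. integral {x - h..x + h} g / (2 * h)) \<longlongrightarrow> g x) (at_right 0)" if "x \<notin> N" "- x \<notin> N'" for x
  proof -
    have refl: "integral {- x..- x + h} g' = integral {x - h..x} g" for h
      unfolding g'_def using Henstock_Kurzweil_Integration.integral_reflect_real[of x "x - h" "\<lambda>x. g x"] by simp
    have "((\<lambda>h. (integral {x..x + h} g / h + integral {- x..- x + h} g' / h) / 2) \<longlongrightarrow> (g x + g' (- x)) / 2) (at_right 0)"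
      by (intro tendsto_intros N(2) N'(2) that) auto
    then have "((\<lambda>h. (integral {x..x + h} g / h + integral {- x..- x + h} g' / h) / 2) \<longlongrightarrow> g x) (at_right 0)"
      by (simp add: g'_def)
    then show ?thesis
    proof (rule Lim_transform_eventually)
      show "\<forall>\<^sub>F h in at_right 0. (integral {x..x + h} g / h + integral {- x..- x + h} g' / h) / 2 = integral {x - h..x + h} g / (2 * h)"
      proof (rule eventually_at_right_less[THEN eventually_mono])
        fix h :: real assume "0 < h"
        then have "integral {x - h..x} g + integral {x..x + h} g = integral {x - h..x + h} g"
          using int[OF g] by (intro Henstock_Kurzweil_Integration.integral_combine) (auto simp: cbox_interval)
        with \<open>0 < h\<close> show "(integral {x..x + h} g / h + integral {- x..- x + h} g' / h) / 2 = integral {x - h..x + h} g / (2 * h)"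
          unfolding refl by (simp add: field_simps)
      qed
    qed
  qed
  have "negligible (N \<union> uminus ` N')"
    using N(1) N'(1) by (intro negligible_Un negligible_differentiable_image_negligible)
      (auto intro!: derivative_intros simp: differentiable_on_def)
  then have "AE x in lebesgue. x \<notin> N \<union> uminus ` N'"
    by (intro AE_not_in) (simp add: negligible_iff_null_sets)
  then have "AE x in lborel. x \<notin> N \<union> uminus ` N'" by (simp add: AE_completion_iff)
  then show ?thesis
  proof eventually_elim
    case (elim x)
    then show ?case using conv[of x] by (metis Un_iff add.inverse_inverse image_eqI)
  qed
qed

lemma sym_density_tendsto:
  assumes N: "finite_measure N" and sN[measurable_cong, simp]: "sets N = sets borel"
    and ac: "absolutely_continuous lborel N"
  shows "\<exists>f\<in>borel_measurable lborel. density lborel f = N \<and>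
    (AE x in lborel. (\<lambda>n. ennreal (real (Suc n) / 2) * emeasure N {x - 1 / real (Suc n)<..<x + 1 / real (Suc n)}) \<longlonglongrightarrow> f x)"
proof -
  interpret N: finite_measure N by fact
  obtain f where f[measurable]: "f \<in> borel_measurable lborel" and Nf: "density lborel f = N"
    using sigma_finite_measure.Radon_Nikodym[OF lborel.sigma_finite_measure_axioms ac] by auto
  have "(\<integral>\<^sup>+ x. f x \<partial>lborel) = emeasure N UNIV"
    unfolding Nf[symmetric] by (subst emeasure_density) auto
  then have fin: "(\<integral>\<^sup>+ x. f x \<partial>lborel) < \<infinity>" using N.emeasure_finite[of UNIV] by (simp add: less_top[symmetric])
  then have f_fin: "AE x in lborel. f x \<noteq> \<infinity>" by (intro nn_integral_noteq_infinite) auto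
  define g where "g x = enn2real (f x)" for x
  have fg: "AE x in lborel. f x = ennreal (g x)" using f_fin by eventually_elim (simp add: g_def less_top)
  have g0: "g x \<ge> 0" for x by (simp add: g_def)
  have g[measurable]: "g \<in> borel_measurable borel" unfolding g_def by measurable
  have gi: "integrable lborel g"
  proof (rule integrableI_nonneg)
    have "(\<integral>\<^sup>+ x. ennreal (g x) \<partial>lborel) = (\<integral>\<^sup>+ x. f x \<partial>lborel)" using fg by (intro nn_integral_cong_AE) auto
    then show "(\<integral>\<^sup>+ x. ennreal (g x) \<partial>lborel) < \<infinity>" using fin by simp
  qed (auto simp: g0)
  have win: "emeasure N {x - h<..<x + h} = ennreal (integral {x - h..x + h} g)" for x h
  proof -
    have "emeasure N {x - h<..<x + h} = (\<integral>\<^sup>+ y. f y * indicator {x - h<..<x + h} y \<partial>lborel)"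
      unfolding Nf[symmetric] by (subst emeasure_density) auto
    also have "\<dots> = (\<integral>\<^sup>+ y. ennreal (g y * indicator {x - h..x + h} y) \<partial>lborel)"
    proof (rule nn_integral_cong_AE)
      show "AE y in lborel. f y * indicator {x - h<..<x + h} y = ennreal (g y * indicator {x - h..x + h} y)"
        using fg AE_lborel_singleton[of "x - h"] AE_lborel_singleton[of "x + h"]
        by eventually_elim (auto simp: indicator_def)
    qed
    also have "\<dots> = ennreal (LINT y|lborel. g y * indicator {x - h..x + h} y)"
      using gi by (intro nn_integral_eq_integral) (auto simp: g0 intro!: integrable_real_mult_indicator)
    also have "(LINT y|lborel. g y * indicator {x - h..x + h} y) = integral {x - h..x + h} g"
    proof -
      have "set_integrable lborel {x - h..x + h} g"
        unfolding set_integrable_def using gi by (intro integrable_mult_indicator) auto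
      from set_borel_integral_eq_integral(2)[OF this] show ?thesis
        by (simp add: set_lebesgue_integral_def mult.commute)
    qed
    finally show ?thesis .
  qed
  have "AE x in lborel. (\<lambda>n. ennreal (real (Suc n) / 2) * emeasure N {x - 1 / real (Suc n)<..<x + 1 / real (Suc n)}) \<longlonglongrightarrow> f x"
    using Lebesgue_differentiation_symmetric[OF gi] fg
  proof eventually_elim
    case (elim x)
    have "filterlim (\<lambda>n. 1 / real (Suc n)) (at_right 0) sequentially"
      using LIMSEQ_inverse_real_of_nat by (auto simp: filterlim_at inverse_eq_divide)
    from filterlim_compose[OF elim(1) this]
    have "(\<lambda>n. real (Suc n) / 2 * integral {x - 1 / real (Suc n)..x + 1 / real (Suc n)} g) \<longlonglongrightarrow> g x"
      by (simp add: field_simps)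
    from tendsto_ennrealI[OF this] show ?case
      unfolding win elim(2) by (simp add: ennreal_mult'[symmetric] del: of_nat_Suc)
  qed
  with f Nf show ?thesis by blast
qed

text \<open>A Radon-Nikodym density is a class of functions modulo null sets. Here the
  representative is the one that the window masses determine pointwise, so that it can be evaluated
  at a random level and depends measurably on the path.\<close>

lemma density_sym_upper_density:
  assumes N: "finite_measure N" and sN: "sets N = sets borel" and ac: "absolutely_continuous lborel N"
  shows "density lborel (sym_upper_density N) = N"
    and "AE x in lborel. (\<lambda>n. ennreal (real (Suc n) / 2) * emeasure N {x - 1 / real (Suc n)<..<x + 1 / real (Suc n)}) \<longlonglongrightarrow> sym_upper_density N x"
proof -
  obtain f where f: "f \<in> borel_measurable lborel" "density lborel f = N"
    "AE x in lborel. (\<lambda>n. ennreal (real (Suc n) / 2) * emeasure N {x - 1 / real (Suc n)<..<x + 1 / real (Suc n)}) \<longlonglongrightarrow> f x"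
    using sym_density_tendsto[OF assms] by blast
  have ae: "AE x in lborel. sym_upper_density N x = f x"
    using f(3) by eventually_elim (auto simp: sym_upper_density_def intro!: lim_imp_Limsup)
  then have "density lborel (sym_upper_density N) = density lborel f"
    using f(1) sym_upper_density_measurable[OF N sN] by (intro density_cong) auto
  with f(2) show "density lborel (sym_upper_density N) = N" by simp
  show "AE x in lborel. (\<lambda>n. ennreal (real (Suc n) / 2) * emeasure N {x - 1 / real (Suc n)<..<x + 1 / real (Suc n)}) \<longlonglongrightarrow> sym_upper_density N x"
    using f(3) ae by eventually_elim simp
qed

section \<open>Local times of paths\<close>

definition occupation :: "(real \<Rightarrow> real) \<Rightarrow> real \<Rightarrow> real \<Rightarrow> real measure" where
  "occupation b a c = distr (density lborel (indicator {a<..c})) borel b"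

text \<open>Being an upper limit, the local time is defined at every level; only at almost every level is it
  a limit.\<close>

definition path_local_time :: "(real \<Rightarrow> real) \<Rightarrow> real \<Rightarrow> real \<Rightarrow> real \<Rightarrow> ennreal" where
  "path_local_time b a c = sym_upper_density (occupation b a c)"

lemma sets_occupation[simp, measurable_cong]: "sets (occupation b a c) = sets borel"
  by (simp add: occupation_def)

text \<open>Read \<open>d i\<close> as the mass of step \<open>i\<close> and \<open>a i\<close> as
  the mass from step \<open>i\<close> on. Counting a step when the mass including it is at most
  \<open>s\<close> omits the step that straddles \<open>s\<close>; counting it when the mass after
  it is at most \<open>s\<close> includes that step entirely. The true value
  \<open>min s (a 0)\<close> lies between.\<close>

lemma telescoping_min:
  fixes a d :: "nat \<Rightarrow> ennreal"
  assumes "\<And>i. i < n \<Longrightarrow> a i = d i + a (Suc i)" and "a n = 0"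
  shows "(\<Sum>i<n. d i * of_bool (a i \<le> s)) \<le> min s (a 0)"
    and "min s (a 0) \<le> (\<Sum>i<n. d i * of_bool (a (Suc i) \<le> s))"
proof -
  have "(\<Sum>i<n. d i * of_bool (a i \<le> s)) \<le> min s (a 0) \<and> min s (a 0) \<le> (\<Sum>i<n. d i * of_bool (a (Suc i) \<le> s))"
    using assms
  proof (induction n arbitrary: a d)
    case (Suc n)
    have a0: "a 0 = d 0 + a 1" using Suc.prems(1)[of 0] by simp
    let ?L = "\<Sum>i<n. d (Suc i) * of_bool (a (Suc i) \<le> s)" and ?U = "\<Sum>i<n. d (Suc i) * of_bool (a (Suc (Suc i)) \<le> s)"
    have IH: "?L \<le> min s (a 1)" "min s (a 1) \<le> ?U"
      using Suc.IH[of "\<lambda>i. a (Suc i)" "\<lambda>i. d (Suc i)"] Suc.prems by auto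
    have L: "(\<Sum>i<Suc n. d i * of_bool (a i \<le> s)) = d 0 * of_bool (a 0 \<le> s) + ?L"
      and U: "(\<Sum>i<Suc n. d i * of_bool (a (Suc i) \<le> s)) = d 0 * of_bool (a 1 \<le> s) + ?U"
      by (simp_all only: sum.lessThan_Suc_shift One_nat_def)
    have "a 1 \<le> a 0" using a0 by simp
    then have "d 0 * of_bool (a 0 \<le> s) + ?L \<le> min s (a 0)"
      using IH(1) add_left_mono[of ?L "a 1" "d 0"] unfolding a0 by (cases "d 0 + a 1 \<le> s") (auto simp: min_def split: if_splits)
    moreover have "min s (a 0) \<le> d 0 * of_bool (a 1 \<le> s) + ?U"
    proof (cases "a 1 \<le> s")
      case True
      then have "a 1 \<le> ?U" using IH(2) by (simp add: min_def split: if_splits)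
      then show ?thesis using True a0 add_left_mono[of "a 1" ?U "d 0"] by (simp add: min.coboundedI2)
    next
      case False
      then have "min s (a 1) = s" by simp
      then have "s \<le> ?U" using IH(2) by simp
      then show ?thesis using False by (simp add: min.coboundedI1)
    qed
    ultimately show ?case unfolding L U by simp
  qed simp
  then show "(\<Sum>i<n. d i * of_bool (a i \<le> s)) \<le> min s (a 0)"
    and "min s (a 0) \<le> (\<Sum>i<n. d i * of_bool (a (Suc i) \<le> s))" by auto
qed

lemma indicator_partition:
  assumes "N > 0"
  shows "(\<Sum>i<n. indicator {real i / real N<..real (Suc i) / real N} t) = (indicator {0<..real n / real N} t :: ennreal)"
proof (induction n)
  case (Suc n)
  have "real n / real N \<le> real (Suc n) / real N" using assms by (intro divide_right_mono) auto
  moreover have "0 < t" if "real n / real N < t"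
    using that by (rule le_less_trans[rotated]) simp
  ultimately show ?case using Suc by (auto simp: indicator_def simp del: of_nat_Suc)
qed (simp add: indicator_def)

context
  fixes b :: "real \<Rightarrow> real"
  assumes b[measurable]: "b \<in> borel_measurable borel"
begin

lemma emeasure_occupation:
  "S \<in> sets borel \<Longrightarrow> emeasure (occupation b a c) S = (\<integral>\<^sup>+ t. indicator {a<..c} t * indicator S (b t) \<partial>lborel)"
  unfolding occupation_def using measurable_sets[OF b, of S]
  by (subst emeasure_distr, simp, simp, subst emeasure_density)
    (auto simp: indicator_def intro!: nn_integral_cong)

lemma nn_integral_occupation:
  "h \<in> borel_measurable borel \<Longrightarrow> (\<integral>\<^sup>+ x. h x \<partial>occupation b a c) = (\<integral>\<^sup>+ t. indicator {a<..c} t * h (b t) \<partial>lborel)"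
  unfolding occupation_def
  by (subst nn_integral_distr, simp, simp, subst nn_integral_density) auto

lemma finite_measure_occupation: "finite_measure (occupation b a c)"
proof
  have "emeasure (occupation b a c) (space (occupation b a c)) = (\<integral>\<^sup>+ t. indicator {a<..c} t \<partial>lborel)"
    by (subst emeasure_occupation) (auto simp: occupation_def)
  also have "\<dots> < \<infinity>" by (cases "a \<le> c") auto
  finally show "emeasure (occupation b a c) (space (occupation b a c)) \<noteq> \<infinity>" by simp
qed

lemma path_local_time_measurable: "path_local_time b a c \<in> borel_measurable borel"
  unfolding path_local_time_def by (intro sym_upper_density_measurable finite_measure_occupation sets_occupation)

lemma emeasure_occupation_mono:
  assumes "a' \<le> a" "c \<le> c'" "S \<in> sets borel"
  shows "emeasure (occupation b a c) S \<le> emeasure (occupation b a' c') S"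
  using assms by (simp add: emeasure_occupation) (intro nn_integral_mono, auto simp: indicator_def)

lemma path_local_time_mono:
  assumes "a' \<le> a" "c \<le> c'"
  shows "path_local_time b a c x \<le> path_local_time b a' c' x"
  unfolding path_local_time_def sym_upper_density_def
  using assms by (intro Limsup_mono always_eventually allI mult_left_mono emeasure_occupation_mono) auto

lemma path_local_time_empty: "c \<le> a \<Longrightarrow> path_local_time b a c x = 0"
  unfolding path_local_time_def sym_upper_density_def
  by (simp add: emeasure_occupation Limsup_const)

context
  assumes fin: "AE t in lborel. t \<in> {0<..1} \<longrightarrow> path_local_time b 0 1 (b t) < \<infinity>"
begin

text \<open>A property of \<open>b t\<close> for almost every \<open>t\<close> in (0,1] is a
  property of almost every level with respect to the occupation measure itself, so
  \<open>fin\<close> is exactly what the density criterion asks for. Smaller time intervals have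
  smaller occupation measures.\<close>

lemma absolutely_continuous_occupation:
  assumes "0 \<le> a" "c \<le> 1"
  shows "absolutely_continuous lborel (occupation b a c)"
proof -
  have "absolutely_continuous lborel (occupation b 0 1)"
  proof (rule absolutely_continuous_of_sym_upper_density[OF finite_measure_occupation sets_occupation])
    have "{x. sym_upper_density (occupation b 0 1) x < \<infinity>} \<in> sets borel"
      using path_local_time_measurable[of 0 1] unfolding path_local_time_def[symmetric] by measurable
    then show "AE x in occupation b 0 1. sym_upper_density (occupation b 0 1) x < \<infinity>"
      unfolding occupation_def using fin
      by (subst AE_distr_iff) (auto simp: AE_density indicator_def occupation_def path_local_time_def)
  qed
  then show ?thesis
    unfolding absolutely_continuous_def null_sets_def
    using assms emeasure_occupation_mono[of 0 a c 1] by (auto simp: subset_eq) (metis le_zero_eq sets_lborel)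
qed

lemma occupation_density:
  assumes "0 \<le> a" "c \<le> 1"
  shows "density lborel (path_local_time b a c) = occupation b a c"
  unfolding path_local_time_def
  by (intro density_sym_upper_density(1) finite_measure_occupation sets_occupation absolutely_continuous_occupation assms)

lemma occupation_formula:
  assumes "0 \<le> a" "c \<le> 1" and [measurable]: "h \<in> borel_measurable borel"
  shows "(\<integral>\<^sup>+ t. indicator {a<..c} t * h (b t) \<partial>lborel) = (\<integral>\<^sup>+ x. path_local_time b a c x * h x \<partial>lborel)"
  using path_local_time_measurable[of a c]
  by (subst nn_integral_occupation[symmetric], simp, subst occupation_density[OF assms(1,2), symmetric], subst nn_integral_density) auto

text \<open>An upper limit is only subadditive; the equality holds at the levels where the windows
  of all three time intervals have a limit.\<close>

lemma path_local_time_add: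
  assumes "0 \<le> a" "a \<le> c" "c \<le> e" "e \<le> 1"
  shows "AE x in lborel. path_local_time b a e x = path_local_time b a c x + path_local_time b c e x"
proof -
  have add: "emeasure (occupation b a e) S = emeasure (occupation b a c) S + emeasure (occupation b c e) S"
    if [measurable]: "S \<in> sets borel" for S
    using assms by (simp add: emeasure_occupation nn_integral_add[symmetric])
      (intro nn_integral_cong, auto simp: indicator_def)
  have "AE x in lborel. (\<lambda>n. ennreal (real (Suc n) / 2) * emeasure (occupation b a' c') {x - 1 / real (Suc n)<..<x + 1 / real (Suc n)})
      \<longlonglongrightarrow> path_local_time b a' c' x" if "0 \<le> a'" "c' \<le> 1" for a' c'
    unfolding path_local_time_def
    by (intro density_sym_upper_density(2) finite_measure_occupation sets_occupation absolutely_continuous_occupation that)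
  note lim = this
  have "AE x in lborel. (\<lambda>n. ennreal (real (Suc n) / 2) * emeasure (occupation b a e) {x - 1 / real (Suc n)<..<x + 1 / real (Suc n)})
      \<longlonglongrightarrow> path_local_time b a e x"
    and "AE x in lborel. (\<lambda>n. ennreal (real (Suc n) / 2) * emeasure (occupation b a c) {x - 1 / real (Suc n)<..<x + 1 / real (Suc n)})
      \<longlonglongrightarrow> path_local_time b a c x"
    and "AE x in lborel. (\<lambda>n. ennreal (real (Suc n) / 2) * emeasure (occupation b c e) {x - 1 / real (Suc n)<..<x + 1 / real (Suc n)})
      \<longlonglongrightarrow> path_local_time b c e x"
    using assms by - (intro lim; linarith)+
  then show ?thesis
  proof eventually_elim
    case (elim x)
    show ?case
    proof (rule LIMSEQ_unique[OF elim(1)])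
      show "(\<lambda>n. ennreal (real (Suc n) / 2) * emeasure (occupation b a e) {x - 1 / real (Suc n)<..<x + 1 / real (Suc n)})
          \<longlonglongrightarrow> path_local_time b a c x + path_local_time b c e x"
        using tendsto_add[OF elim(2,3)] by (simp only: add distrib_left borel_open open_greaterThanLessThan)
    qed
  qed
qed

text \<open>For a fixed partition of (0,1] only finitely many additivity relations are involved, so
  \<open>telescoping_min\<close> applies at almost every level. A time \<open>t\<close> is within
  \<open>1 / N\<close> of both ends of its piece, whence the shifts. For small \<open>t\<close> the
  shifted interval may start before 0, and for \<open>t\<close> near 1 it may be empty.\<close>

theorem local_time_sandwich:
  fixes N :: nat and s :: ennreal
  assumes N: "N > 0"
  shows "(\<integral>\<^sup>+ t. indicator {0<..1} t * of_bool (path_local_time b (t - 1 / N) 1 (b t) \<le> s) \<partial>lborel)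
      \<le> (\<integral>\<^sup>+ x. min s (path_local_time b 0 1 x) \<partial>lborel)"
    and "(\<integral>\<^sup>+ x. min s (path_local_time b 0 1 x) \<partial>lborel)
      \<le> (\<integral>\<^sup>+ t. indicator {0<..1} t * of_bool (path_local_time b (t + 1 / N) 1 (b t) \<le> s) \<partial>lborel)"
proof -
  define \<tau> where "\<tau> i = real i / real N" for i
  have \<tau>: "0 \<le> \<tau> i" "\<tau> i \<le> \<tau> (Suc i)" "i \<le> N \<Longrightarrow> \<tau> i \<le> 1" "\<tau> 0 = 0" "\<tau> N = 1" "\<tau> (Suc i) = \<tau> i + 1 / real N" for i
    using N by (auto simp: \<tau>_def field_simps)
  have \<tau>_le_1: "\<tau> (Suc i) \<le> 1" if "i < N" for i using \<tau>(3)[of "Suc i"] that by simp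
  define A where "A i = path_local_time b (\<tau> i) 1" for i
  define D where "D i = path_local_time b (\<tau> i) (\<tau> (Suc i))" for i
  note [measurable] = path_local_time_measurable
  have [measurable]: "A i \<in> borel_measurable borel" "D i \<in> borel_measurable borel" for i
    by (auto simp: A_def D_def)
  have "AE x in lborel. \<forall>i\<in>{..<N}. A i x = D i x + A (Suc i) x"
    unfolding A_def D_def by (intro AE_finite_allI) (auto intro!: path_local_time_add \<tau>(1,2) \<tau>_le_1 simp del: \<tau>(6))
  then have tel: "AE x in lborel. (\<Sum>i<N. D i x * of_bool (A i x \<le> s)) \<le> min s (A 0 x) \<and>
      min s (A 0 x) \<le> (\<Sum>i<N. D i x * of_bool (A (Suc i) x \<le> s))"
  proof eventually_elim
    case (elim x)
    have "A N x = 0" unfolding A_def \<tau>(5) by (rule path_local_time_empty) simp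
    with elim show ?case by (intro conjI telescoping_min) auto
  qed
  \<comment> \<open>The mass to come is measured from a division time, so inside a piece the
    condition depends on \<open>t\<close> only through \<open>b t\<close> and the occupation formula
    applies. \<open>j\<close> is the identity for the lower sum and \<open>Suc\<close> for the upper
    one.\<close>
  have form: "(\<integral>\<^sup>+ t. (\<Sum>i<N. indicator {\<tau> i<..\<tau> (Suc i)} t * of_bool (A (j i) (b t) \<le> s)) \<partial>lborel) =
      (\<integral>\<^sup>+ x. (\<Sum>i<N. D i x * of_bool (A (j i) x \<le> s)) \<partial>lborel)" for j :: "nat \<Rightarrow> nat"
  proof -
    have "(\<integral>\<^sup>+ t. indicator {\<tau> i<..\<tau> (Suc i)} t * of_bool (A (j i) (b t) \<le> s) \<partial>lborel) =
      (\<integral>\<^sup>+ x. D i x * of_bool (A (j i) x \<le> s) \<partial>lborel)" if "i < N" for i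
      unfolding D_def by (intro occupation_formula \<tau>(1) \<tau>_le_1 that) measurable
    moreover have "(\<lambda>t. indicator {\<tau> i<..\<tau> (Suc i)} t * of_bool (A (j i) (b t) \<le> s) :: ennreal) \<in> borel_measurable lborel"
      "(\<lambda>x. D i x * of_bool (A (j i) x \<le> s)) \<in> borel_measurable lborel" for i
      by measurable
    ultimately show ?thesis by (simp only: nn_integral_sum) (auto intro!: sum.cong)
  qed
  have part: "indicator {0<..1} t * z = (\<Sum>i<N. indicator {\<tau> i<..\<tau> (Suc i)} t * z)" for t and z :: ennreal
    using indicator_partition[where N=N and n=N and t=t, OF N] N by (simp add: \<tau>_def sum_distrib_right[symmetric] del: of_nat_Suc)
  have "(\<integral>\<^sup>+ t. indicator {0<..1} t * of_bool (path_local_time b (t - 1 / N) 1 (b t) \<le> s) \<partial>lborel)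
     \<le> (\<integral>\<^sup>+ t. (\<Sum>i<N. indicator {\<tau> i<..\<tau> (Suc i)} t * of_bool (A i (b t) \<le> s)) \<partial>lborel)"
  proof (unfold part, intro nn_integral_mono sum_mono)
    fix t i
    have "A i (b t) \<le> path_local_time b (t - 1 / N) 1 (b t)" if "t \<in> {\<tau> i<..\<tau> (Suc i)}"
      unfolding A_def using that \<tau>(6)[of i] by (intro path_local_time_mono) auto
    then show "indicator {\<tau> i<..\<tau> (Suc i)} t * of_bool (path_local_time b (t - 1 / N) 1 (b t) \<le> s)
       \<le> (indicator {\<tau> i<..\<tau> (Suc i)} t * of_bool (A i (b t) \<le> s) :: ennreal)"
      by (auto simp: indicator_def dest: order_trans)
  qed
  also have "\<dots> \<le> (\<integral>\<^sup>+ x. min s (A 0 x) \<partial>lborel)"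
    unfolding form[of "\<lambda>i. i"] using tel by (intro nn_integral_mono_AE) auto
  finally show "(\<integral>\<^sup>+ t. indicator {0<..1} t * of_bool (path_local_time b (t - 1 / N) 1 (b t) \<le> s) \<partial>lborel)
      \<le> (\<integral>\<^sup>+ x. min s (path_local_time b 0 1 x) \<partial>lborel)" by (simp add: A_def \<tau>(4))
  have "(\<integral>\<^sup>+ x. min s (A 0 x) \<partial>lborel) \<le> (\<integral>\<^sup>+ t. (\<Sum>i<N. indicator {\<tau> i<..\<tau> (Suc i)} t * of_bool (A (Suc i) (b t) \<le> s)) \<partial>lborel)"
    unfolding form[of Suc] using tel by (intro nn_integral_mono_AE) auto
  also have "\<dots> \<le> (\<integral>\<^sup>+ t. indicator {0<..1} t * of_bool (path_local_time b (t + 1 / N) 1 (b t) \<le> s) \<partial>lborel)"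
  proof (unfold part, intro nn_integral_mono sum_mono)
    fix t i
    have "path_local_time b (t + 1 / N) 1 (b t) \<le> A (Suc i) (b t)" if "t \<in> {\<tau> i<..\<tau> (Suc i)}"
      unfolding A_def using that \<tau>(6)[of i] by (intro path_local_time_mono) auto
    then show "indicator {\<tau> i<..\<tau> (Suc i)} t * of_bool (A (Suc i) (b t) \<le> s)
       \<le> (indicator {\<tau> i<..\<tau> (Suc i)} t * of_bool (path_local_time b (t + 1 / N) 1 (b t) \<le> s) :: ennreal)"
      by (auto simp: indicator_def dest: order_trans)
  qed
  finally show "(\<integral>\<^sup>+ x. min s (path_local_time b 0 1 x) \<partial>lborel)
      \<le> (\<integral>\<^sup>+ t. indicator {0<..1} t * of_bool (path_local_time b (t + 1 / N) 1 (b t) \<le> s) \<partial>lborel)" by (simp add: A_def \<tau>(4))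
qed

end

end

section \<open>A monotone density theorem\<close>

text \<open>\<open>k\<close> increases to a finite positive limit \<open>K\<close>. The two bounds
  compare \<open>I\<close> and \<open>k\<close> at different arguments; at ratio
  \<open>l > 1\<close> they squeeze \<open>I R * R powr (\<alpha> - 1)\<close> between
  \<open>l powr (- \<alpha>) * k (l * R)\<close> and \<open>l powr \<alpha> * k (R / l)\<close>.
  Letting \<open>R\<close> tend to infinity and then \<open>l\<close> to 1 closes the gap.\<close>

lemma regular_growth_of_sandwich:
  fixes I k :: "real \<Rightarrow> real" and \<alpha> C :: real
  assumes mono: "\<And>R R'. 0 < R \<Longrightarrow> R \<le> R' \<Longrightarrow> k R \<le> k R'"
    and bdd: "\<And>R. 0 < R \<Longrightarrow> k R \<le> C" and pos: "0 < R0" "0 < k R0"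
    and up: "\<And>R R'. 0 < R \<Longrightarrow> R < R' \<Longrightarrow> I R' \<le> R' * R powr (- \<alpha>) * k R"
    and low: "\<And>R R'. 0 < R \<Longrightarrow> R < R' \<Longrightarrow> R * R' powr (- \<alpha>) * k R' \<le> I R"
  shows "\<exists>K>0. ((\<lambda>R. I R * R powr (\<alpha> - 1)) \<longlongrightarrow> K) at_top"
proof -
  define K where "K = (SUP R\<in>{0<..}. k R)"
  have bdd': "bdd_above (k ` {0<..})" using bdd by (auto intro!: bdd_aboveI[of _ C])
  have le_K: "k R \<le> K" if "0 < R" for R unfolding K_def using that bdd' by (intro cSUP_upper) auto
  have K0: "K > 0" using le_K[OF pos(1)] pos(2) by simp
  have k_lim: "(k \<longlongrightarrow> K) at_top"
  proof (rule order_tendstoI)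
    fix a assume "a < K"
    then obtain R where R: "0 < R" "a < k R" unfolding K_def using bdd' by (subst (asm) less_cSUP_iff) auto
    show "\<forall>\<^sub>F x in at_top. a < k x"
      using eventually_ge_at_top[of R]
    proof eventually_elim
      case (elim x)
      show ?case using R(2) mono[OF R(1) elim] by simp
    qed
  next
    fix a assume a: "K < a"
    show "\<forall>\<^sub>F x in at_top. k x < a"
      using eventually_gt_at_top[of 0]
    proof eventually_elim
      case (elim x)
      show ?case using a le_K[OF elim] by simp
    qed
  qed
  have scale_lim: "((\<lambda>R. k (l * R)) \<longlongrightarrow> K) at_top" if "l > 0" for l
    using k_lim filterlim_tendsto_pos_mult_at_top[OF tendsto_const that filterlim_ident] by (rule filterlim_compose)
  have pw: "((\<lambda>l. l powr b * K) \<longlongrightarrow> K) (at_right 1)" for b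
  proof -
    have "((\<lambda>l. l powr b * K) \<longlongrightarrow> 1 powr b * K) (at_right 1)" by (intro tendsto_intros) auto
    then show ?thesis by simp
  qed
  have "((\<lambda>R. I R * R powr (\<alpha> - 1)) \<longlongrightarrow> K) at_top"
  proof (rule order_tendstoI)
    fix a assume "a < K"
    from order_tendstoD(1)[OF pw[of "- \<alpha>"] this] have "\<forall>\<^sub>F l in at_right 1. a < l powr - \<alpha> * K \<and> 1 < l"
      by (intro eventually_conj eventually_at_right_less)
    then obtain l :: real where l: "a < l powr - \<alpha> * K" "1 < l" using eventually_happens' trivial_limit_at_right_real by blast
    have "((\<lambda>R. l powr - \<alpha> * k (l * R)) \<longlongrightarrow> l powr - \<alpha> * K) at_top"
      using l by (intro tendsto_intros scale_lim) auto
    from order_tendstoD(1)[OF this l(1)] show "\<forall>\<^sub>F R in at_top. a < I R * R powr (\<alpha> - 1)"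
      using eventually_gt_at_top[of 0]
    proof eventually_elim
      case (elim R)
      have "l powr - \<alpha> * k (l * R) = (R * (l * R) powr (- \<alpha>) * k (l * R)) * R powr (\<alpha> - 1)"
        using elim l by (simp add: powr_mult powr_diff powr_minus field_simps)
      also have "\<dots> \<le> I R * R powr (\<alpha> - 1)"
        using elim l by (intro mult_right_mono low) auto
      finally show ?case using elim by simp
    qed
  next
    fix a assume "K < a"
    from order_tendstoD(2)[OF pw[of "\<alpha>"] this] have "\<forall>\<^sub>F l in at_right 1. l powr \<alpha> * K < a \<and> 1 < l"
      by (intro eventually_conj eventually_at_right_less)
    then obtain l :: real where l: "l powr \<alpha> * K < a" "1 < l" using eventually_happens' trivial_limit_at_right_real by blast
    have "((\<lambda>R. l powr \<alpha> * k (inverse l * R)) \<longlongrightarrow> l powr \<alpha> * K) at_top"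
      using l by (intro tendsto_intros scale_lim) auto
    from order_tendstoD(2)[OF this l(1)] show "\<forall>\<^sub>F R in at_top. I R * R powr (\<alpha> - 1) < a"
      using eventually_gt_at_top[of 0]
    proof eventually_elim
      case (elim R)
      have "I R * R powr (\<alpha> - 1) \<le> (R * (inverse l * R) powr (- \<alpha>) * k (inverse l * R)) * R powr (\<alpha> - 1)"
        using elim l by (intro mult_right_mono up) (auto simp: field_simps)
      also have "\<dots> = l powr \<alpha> * k (inverse l * R)"
        using elim l by (simp add: powr_mult powr_diff powr_minus powr_divide inverse_eq_divide field_simps)
      finally show ?case using elim by simp
    qed
  qed
  with K0 show ?thesis by blast
qed

text \<open>The difference quotient of \<open>I\<close> between \<open>R\<close> and
  \<open>m * R\<close> lies below \<open>h R\<close> for \<open>m > 1\<close> and above it for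
  \<open>m < 1\<close>. Scaled by \<open>R powr (1 - \<rho>)\<close> it tends to
  \<open>K * ((m powr \<rho> - 1) / (m - 1))\<close>, and \<open>m \<rightarrow> 1\<close> turns
  this into a derivative, which produces the factor \<open>\<rho>\<close>.\<close>

lemma monotone_density:
  fixes I h :: "real \<Rightarrow> real" and \<rho> K :: real
  assumes incr: "\<And>R R'. 0 < R \<Longrightarrow> R < R' \<Longrightarrow> (R' - R) * h R' \<le> I R' - I R"
      "\<And>R R'. 0 < R \<Longrightarrow> R < R' \<Longrightarrow> I R' - I R \<le> (R' - R) * h R"
    and lim: "((\<lambda>R. I R * R powr (- \<rho>)) \<longlongrightarrow> K) at_top"
  shows "((\<lambda>R. R powr (1 - \<rho>) * h R) \<longlongrightarrow> K * \<rho>) at_top"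
proof -
  define g where "g R = I R * R powr (- \<rho>)" for R
  \<comment> \<open>This is the scaled difference quotient of \<open>I\<close>, written through the
    convergent function \<open>g\<close> so that its limit is immediate; \<open>q_eq\<close>
    identifies the two forms.\<close>
  define q where "q m R = (g (m * R) * m powr \<rho> - g R) / (m - 1)" for m R
  have q_lim: "(q m \<longlongrightarrow> K * ((m powr \<rho> - 1) / (m - 1))) at_top" if "0 < m" "m \<noteq> 1" for m
  proof -
    have "((\<lambda>R. g (m * R)) \<longlongrightarrow> K) at_top"
      using lim filterlim_tendsto_pos_mult_at_top[OF tendsto_const \<open>0 < m\<close> filterlim_ident]
      unfolding g_def by (rule filterlim_compose)
    then have "(q m \<longlongrightarrow> (K * m powr \<rho> - K) / (m - 1)) at_top"
      unfolding q_def using that lim by (intro tendsto_intros) (auto simp: g_def)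
    then show ?thesis by (simp add: algebra_simps)
  qed
  have q_eq: "q m R = R powr (1 - \<rho>) * ((I (m * R) - I R) / (m * R - R))" if "0 < m" "m \<noteq> 1" "0 < R" for m R
  proof -
    have "g (m * R) * m powr \<rho> = I (m * R) * R powr (- \<rho>)"
      using that by (simp add: g_def powr_mult powr_minus field_simps)
    then have "q m R = R powr (- \<rho>) * (I (m * R) - I R) / (m - 1)"
      by (simp add: q_def g_def algebra_simps)
    also have "\<dots> = R powr (1 - \<rho>) * ((I (m * R) - I R) / (m * R - R))"
    proof -
      have "R powr (1 - \<rho>) = R * R powr (- \<rho>)" using that by (simp add: powr_diff powr_minus field_simps)
      moreover have "m * R - R = (m - 1) * R" by (simp add: algebra_simps)
      ultimately show ?thesis using that by simp
    qed
    finally show ?thesis .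
  qed
  have D: "((\<lambda>m. K * ((m powr \<rho> - 1) / (m - 1))) \<longlongrightarrow> K * \<rho>) (at 1)"
  proof -
    have "((\<lambda>m. m powr \<rho>) has_field_derivative \<rho>) (at 1)"
      by (auto intro!: derivative_eq_intros)
    then show ?thesis by (intro tendsto_intros) (simp add: has_field_derivative_iff)
  qed
  show ?thesis
  proof (rule order_tendstoI)
    fix a assume a: "a < K * \<rho>"
    have "((\<lambda>m. K * ((m powr \<rho> - 1) / (m - 1))) \<longlongrightarrow> K * \<rho>) (at_right 1)"
      using D by (rule filterlim_mono) (auto simp: at_le)
    from order_tendstoD(1)[OF this a] have "\<forall>\<^sub>F m in at_right 1. a < K * ((m powr \<rho> - 1) / (m - 1)) \<and> 1 < m"
      by (intro eventually_conj eventually_at_right_less)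
    then obtain m :: real where m: "a < K * ((m powr \<rho> - 1) / (m - 1))" "1 < m"
      using eventually_happens' trivial_limit_at_right_real by blast
    from order_tendstoD(1)[OF q_lim m(1)] m have "\<forall>\<^sub>F R in at_top. a < q m R" by simp
    then show "\<forall>\<^sub>F R in at_top. a < R powr (1 - \<rho>) * h R" using eventually_gt_at_top[of 0]
    proof eventually_elim
      case (elim R)
      have "(I (m * R) - I R) / (m * R - R) \<le> h R"
        using incr(2)[of R "m * R"] elim m by (simp add: divide_le_eq mult.commute)
      then have "R powr (1 - \<rho>) * ((I (m * R) - I R) / (m * R - R)) \<le> R powr (1 - \<rho>) * h R"
        by (intro mult_left_mono) auto
      then have "q m R \<le> R powr (1 - \<rho>) * h R"
        using q_eq[of m R] elim m by simp
      with elim show ?case by simp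
    qed
  next
    fix a assume a: "K * \<rho> < a"
    have "((\<lambda>m. K * ((m powr \<rho> - 1) / (m - 1))) \<longlongrightarrow> K * \<rho>) (at_left 1)"
      using D by (rule filterlim_mono) (auto simp: at_le)
    from order_tendstoD(2)[OF this a] have "\<forall>\<^sub>F m in at_left 1. K * ((m powr \<rho> - 1) / (m - 1)) < a \<and> m \<in> {0<..<1}"
      by (intro eventually_conj eventually_at_left_real) auto
    from eventually_happens'[OF trivial_limit_at_left_real this]
    obtain m :: real where m: "K * ((m powr \<rho> - 1) / (m - 1)) < a" "0 < m" "m < 1" by auto
    from order_tendstoD(2)[OF q_lim m(1)] m have "\<forall>\<^sub>F R in at_top. q m R < a" by simp
    then show "\<forall>\<^sub>F R in at_top. R powr (1 - \<rho>) * h R < a" using eventually_gt_at_top[of 0]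
    proof eventually_elim
      case (elim R)
      have mR: "0 < m * R" "m * R < R" using elim m by auto
      have "(I (m * R) - I R) / (m * R - R) = (I R - I (m * R)) / (R - m * R)"
        by (metis minus_diff_eq minus_divide_divide)
      moreover have "h R \<le> (I R - I (m * R)) / (R - m * R)"
        using incr(1)[OF mR] mR by (simp add: le_divide_eq mult.commute)
      ultimately have "h R \<le> (I (m * R) - I R) / (m * R - R)" by simp
      then have "R powr (1 - \<rho>) * h R \<le> R powr (1 - \<rho>) * ((I (m * R) - I R) / (m * R - R))"
        by (intro mult_left_mono) auto
      then have "R powr (1 - \<rho>) * h R \<le> q m R"
        using q_eq[of m R] elim m by simp
      with elim show ?case by simp
    qed
  qed
qed

section \<open>Gaussian laws and fractional Brownian motion\<close>

lemma sets_gaussian_law[simp, measurable_cong]: "sets (gaussian_law \<mu> \<sigma>) = sets borel"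
  by (simp add: gaussian_law_def)

lemma integrable_gaussian_law_moment:
  assumes "\<sigma> \<ge> 0" shows "integrable (gaussian_law \<mu> \<sigma>) (\<lambda>x. (x - \<mu>) ^ k)"
proof (cases "\<sigma> = 0")
  case True
  have "integrable (return borel \<mu>) (\<lambda>x::real. (x - \<mu>) ^ k)"
    by (rule integrableI_bounded) (simp_all add: nn_integral_return)
  with True show ?thesis by (simp add: gaussian_law_def)
next
  case False
  then show ?thesis using assms integrable_normal_moment[of \<sigma> \<mu> k]
    by (simp add: gaussian_law_def integrable_density)
qed

lemma integral_gaussian_law_even_moment:
  assumes "\<sigma> \<ge> 0"
  shows "(LINT x|gaussian_law \<mu> \<sigma>. (x - \<mu>) ^ (2 * k)) = \<sigma> ^ (2 * k) * (fact (2 * k) / (2 ^ k * fact k))"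
proof (cases "\<sigma> = 0")
  case True
  then show ?thesis by (cases k) (simp_all add: gaussian_law_def integral_return measure_def)
next
  case False
  then have "(LINT x|gaussian_law \<mu> \<sigma>. (x - \<mu>) ^ (2 * k)) = fact (2 * k) / ((2 / \<sigma>\<^sup>2) ^ k * fact k)"
    using assms integral_normal_moment_even[of \<sigma> \<mu> k] by (simp add: gaussian_law_def integral_density)
  then show ?thesis using False by (simp add: power_divide power_mult)
qed

lemma integral_gaussian_law:
  assumes "\<sigma> \<ge> 0" shows "(LINT x|gaussian_law \<mu> \<sigma>. x) = \<mu>"
proof (cases "\<sigma> = 0")
  case True
  then show ?thesis by (simp add: gaussian_law_def integral_return)
next
  case False
  then show ?thesis using assms integral_normal_moment_nz_1[of \<sigma> \<mu>] by (simp add: gaussian_law_def integral_density)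
qed

lemma emeasure_gaussian_law_window:
  assumes "\<sigma> > 0" "d \<ge> 0"
  shows "emeasure (gaussian_law \<mu> \<sigma>) {- d<..<d} \<le> ennreal (2 * d / \<sigma>)"
proof -
  have "emeasure (gaussian_law \<mu> \<sigma>) {- d<..<d} = (\<integral>\<^sup>+ x. ennreal (normal_density \<mu> \<sigma> x) * indicator {- d<..<d} x \<partial>lborel)"
    using assms by (simp add: gaussian_law_def emeasure_density)
  also have "\<dots> \<le> (\<integral>\<^sup>+ x. ennreal (1 / \<sigma>) * indicator {- d<..<d} x \<partial>lborel)"
  proof (intro nn_integral_mono mult_right_mono ennreal_leI)
    fix x
    have "\<sigma> \<le> sqrt (2 * pi * \<sigma>\<^sup>2)"
    proof (rule real_le_rsqrt)
      show "\<sigma>\<^sup>2 \<le> 2 * pi * \<sigma>\<^sup>2" using pi_gt3 by (intro mult_right_mono[of 1 "2 * pi" "\<sigma>\<^sup>2", simplified]) auto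
    qed
    then have "1 / sqrt (2 * pi * \<sigma>\<^sup>2) \<le> 1 / \<sigma>" using assms by (intro divide_left_mono) auto
    then have "normal_density \<mu> \<sigma> x \<le> 1 / \<sigma> * 1"
      unfolding normal_density_def using assms by (intro mult_mono) auto
    then show "normal_density \<mu> \<sigma> x \<le> 1 / \<sigma>" by simp
  qed simp
  also have "\<dots> = ennreal (1 / \<sigma>) * ennreal (2 * d)"
    using assms by (subst nn_integral_cmult_indicator) auto
  also have "\<dots> = ennreal (2 * d / \<sigma>)" using assms by (subst ennreal_mult[symmetric]) auto
  finally show ?thesis .
qed

section \<open>Joint measurability in path and time\<close>

text \<open>A path is evaluated through countably many of its values, which makes the evaluation jointly
  measurable in path and time; on continuous paths it is the ordinary one.\<close>

definition path_eval :: "(real \<Rightarrow> real) \<Rightarrow> real \<Rightarrow> real" where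
  "path_eval x t = lim (\<lambda>n. x (real_of_int \<lfloor>real n * t\<rfloor> / real n))"

lemma path_eval_continuous:
  assumes "continuous_on UNIV x" shows "path_eval x t = x t"
proof -
  have "(\<lambda>n. real_of_int \<lfloor>real n * t\<rfloor> / real n) \<longlonglongrightarrow> t" by real_asymp
  then have "(\<lambda>n. x (real_of_int \<lfloor>real n * t\<rfloor> / real n)) \<longlonglongrightarrow> x t"
    using assms by (intro continuous_on_tendsto_compose[OF assms]) auto
  then show ?thesis unfolding path_eval_def by (rule limI)
qed

lemma path_eval_measurable:
  "(\<lambda>(x, t). path_eval x t) \<in> borel_measurable (PiM UNIV (\<lambda>_. borel) \<Otimes>\<^sub>M borel)"
proof -
  have "(\<lambda>p. fst p (real_of_int \<lfloor>real n * snd p\<rfloor> / real n)) \<in> borel_measurable (PiM UNIV (\<lambda>_. borel) \<Otimes>\<^sub>M borel)" for n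
    by (rule measurable_compose_countable[where f="\<lambda>i p. fst p (real_of_int i / real n)" and g="\<lambda>p. \<lfloor>real n * snd p\<rfloor>"]) measurable
  then show ?thesis unfolding path_eval_def case_prod_beta by (rule borel_measurable_lim_metric)
qed

lemma continuous_process_measurable:
  fixes X :: "real \<Rightarrow> 'a \<Rightarrow> real"
  assumes [measurable]: "\<And>t. X t \<in> borel_measurable M"
    and "\<And>\<omega>. \<omega> \<in> space M \<Longrightarrow> continuous_on UNIV (\<lambda>t. X t \<omega>)"
  shows "(\<lambda>(\<omega>, t). X t \<omega>) \<in> borel_measurable (M \<Otimes>\<^sub>M borel)"
proof -
  have "(\<lambda>p. X (real_of_int \<lfloor>real n * snd p\<rfloor> / real n) (fst p)) \<in> borel_measurable (M \<Otimes>\<^sub>M borel)" for n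
    by (rule measurable_compose_countable[where f="\<lambda>i p. X (real_of_int i / real n) (fst p)" and g="\<lambda>p. \<lfloor>real n * snd p\<rfloor>"]) measurable
  then have "(\<lambda>p. path_eval (\<lambda>t. X t (fst p)) (snd p)) \<in> borel_measurable (M \<Otimes>\<^sub>M borel)"
    unfolding path_eval_def by (rule borel_measurable_lim_metric)
  also have "(\<lambda>p. path_eval (\<lambda>t. X t (fst p)) (snd p)) \<in> borel_measurable (M \<Otimes>\<^sub>M borel) \<longleftrightarrow>
      (\<lambda>(\<omega>, t). X t \<omega>) \<in> borel_measurable (M \<Otimes>\<^sub>M borel)"
    using assms(2) by (intro measurable_cong) (auto simp: space_pair_measure path_eval_continuous)
  finally show ?thesis .
qed

text \<open>The window masses are time integrals of a jointly measurable integrand, hence measurable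
  in the parameter. Interval and level vary with the parameter too, because the level of interest is
  the random value \<open>B t \<omega>\<close>.\<close>

lemma path_local_time_measurable_process:
  fixes F :: "'z \<Rightarrow> real \<Rightarrow> real"
  assumes F[measurable]: "(\<lambda>(z, t). F z t) \<in> borel_measurable (Z \<Otimes>\<^sub>M borel)"
    and [measurable]: "a \<in> borel_measurable Z" "c \<in> borel_measurable Z" "y \<in> borel_measurable Z"
  shows "(\<lambda>z. path_local_time (F z) (a z) (c z) (y z)) \<in> borel_measurable Z"
proof -
  have m: "F z \<in> borel_measurable borel" if "z \<in> space Z" for z
    using measurable_compose[OF measurable_Pair1' F, OF that] by simp
  have "(\<lambda>z. \<integral>\<^sup>+ t. (if a z < t \<and> t \<le> c z \<and> \<bar>F z t - y z\<bar> < d then 1 else 0) \<partial>lborel) \<in> borel_measurable Z" for d :: real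
    by measurable
  also have "(\<lambda>z. \<integral>\<^sup>+ t. (if a z < t \<and> t \<le> c z \<and> \<bar>F z t - y z\<bar> < d then 1 else 0) \<partial>lborel) \<in> borel_measurable Z \<longleftrightarrow>
     (\<lambda>z. emeasure (occupation (F z) (a z) (c z)) {y z - d<..<y z + d}) \<in> borel_measurable Z" for d :: real
    by (intro measurable_cong, subst emeasure_occupation[OF m]) 
      (auto intro!: nn_integral_cong simp: indicator_def abs_real_def)
  finally have [measurable]: "(\<lambda>z. emeasure (occupation (F z) (a z) (c z)) {y z - d<..<y z + d}) \<in> borel_measurable Z" for d .
  show ?thesis unfolding path_local_time_def sym_upper_density_def by measurable
qed

section \<open>Gaussian linear combinations and stationarity of the local time\<close>

locale fbm_local_time = prob_space M for M :: "'a measure" +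
  fixes H \<sigma> :: real and B :: "real \<Rightarrow> 'a \<Rightarrow> real" and L :: "'a \<Rightarrow> real measure"
  assumes H: "0 < H" "H < 1" and \<sigma>: "0 < \<sigma>"
    and gaussian: "gaussian_process M B"
    and mean_zero: "integral\<^sup>L M (B t) = 0"
    and continuous_paths: "\<omega> \<in> space M \<Longrightarrow> continuous_on UNIV (\<lambda>t. B t \<omega>)"
    and covariance: "integral\<^sup>L M (\<lambda>\<omega>. B s \<omega> * B t \<omega>) =
        \<sigma>\<^sup>2 / 2 * (\<bar>s\<bar> powr (2 * H) + \<bar>t\<bar> powr (2 * H) - \<bar>t - s\<bar> powr (2 * H))"
    and local_time: "local_time_at_zero M B L"
begin

text \<open>The linear span of the \<open>B t\<close> consists of centred Gaussian variables, each
  determined in law by its second moment. Shifted and rescaled processes take values in it, so they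
  can be compared with \<open>B\<close> through covariances alone.\<close>

definition combinations :: "('a \<Rightarrow> real) set" where
  "combinations = {X. \<exists>J a. finite J \<and> X = (\<lambda>\<omega>. \<Sum>j\<in>J. a j * B j \<omega>)}"

lemma combinationsI: "finite J \<Longrightarrow> (\<And>\<omega>. X \<omega> = (\<Sum>j\<in>J. a j * B j \<omega>)) \<Longrightarrow> X \<in> combinations"
  unfolding combinations_def by (intro CollectI exI[of _ J] exI[of _ a] conjI ext)

lemma combinationsE:
  assumes "X \<in> combinations" obtains J a where "finite J" "X = (\<lambda>\<omega>. \<Sum>j\<in>J. a j * B j \<omega>)"
  using assms unfolding combinations_def by (elim CollectE exE conjE) rule

lemma combinations_B: "B t \<in> combinations"
  by (rule combinationsI[of "{t}" _ "\<lambda>_. 1"]) auto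

lemma combinations_add:
  assumes "X \<in> combinations" "Y \<in> combinations"
  shows "(\<lambda>\<omega>. X \<omega> + Y \<omega>) \<in> combinations"
proof -
  obtain J a K c where J: "finite J" "X = (\<lambda>\<omega>. \<Sum>j\<in>J. a j * B j \<omega>)" and K: "finite K" "Y = (\<lambda>\<omega>. \<Sum>j\<in>K. c j * B j \<omega>)"
    using assms by (elim combinationsE)
  have "(\<Sum>j\<in>J. a j * B j \<omega>) + (\<Sum>j\<in>K. c j * B j \<omega>) =
      (\<Sum>j\<in>J \<union> K. ((if j \<in> J then a j else 0) + (if j \<in> K then c j else 0)) * B j \<omega>)" for \<omega>
  proof -
    have "(\<Sum>j\<in>J. a j * B j \<omega>) = (\<Sum>j\<in>J \<union> K. (if j \<in> J then a j else 0) * B j \<omega>)"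
      using J(1) K(1) by (intro sum.mono_neutral_cong_left) auto
    moreover have "(\<Sum>j\<in>K. c j * B j \<omega>) = (\<Sum>j\<in>J \<union> K. (if j \<in> K then c j else 0) * B j \<omega>)"
      using J(1) K(1) by (intro sum.mono_neutral_cong_left) auto
    ultimately show ?thesis by (simp add: sum.distrib distrib_right)
  qed
  then show ?thesis using J K by (intro combinationsI[of "J \<union> K"]) auto
qed

lemma combinations_scale:
  assumes "X \<in> combinations" shows "(\<lambda>\<omega>. r * X \<omega>) \<in> combinations"
proof -
  obtain J a where J: "finite J" "X = (\<lambda>\<omega>. \<Sum>j\<in>J. a j * B j \<omega>)"
    using assms by (elim combinationsE)
  show ?thesis
    by (rule combinationsI[OF J(1), of _ "\<lambda>j. r * a j"]) (simp add: J(2) sum_distrib_left mult.assoc)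
qed

lemma combinations_sum:
  "finite I \<Longrightarrow> (\<And>i. i \<in> I \<Longrightarrow> X i \<in> combinations) \<Longrightarrow> (\<lambda>\<omega>. \<Sum>i\<in>I. a i * X i \<omega>) \<in> combinations"
proof (induction I rule: finite_induct)
  case empty
  show ?case by (rule combinationsI[of "{}" _ "\<lambda>_. 0"]) auto
next
  case (insert i I)
  then show ?case using combinations_add[OF combinations_scale[of "X i" "a i"]] by simp
qed

lemma combinations_gaussian:
  assumes "X \<in> combinations"
  obtains \<mu> v where "X \<in> borel_measurable M" "v \<ge> 0" "distr M borel X = gaussian_law \<mu> v"
proof -
  obtain J a where J: "finite J" "X = (\<lambda>\<omega>. \<Sum>j\<in>J. a j * B j \<omega>)"
    using assms by (elim combinationsE)
  then have "gaussian_variable M X" using gaussian unfolding gaussian_process_def by blast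
  then show ?thesis using that unfolding gaussian_variable_def by blast
qed

lemma combinations_measurable: "X \<in> combinations \<Longrightarrow> X \<in> borel_measurable M"
  by (erule combinations_gaussian)

lemma B_measurable[measurable]: "B t \<in> borel_measurable M"
  by (intro combinations_measurable combinations_B)

lemma combinations_integrable:
  assumes X: "X \<in> combinations" shows "integrable M X" "integrable M (\<lambda>\<omega>. X \<omega> * X \<omega>)"
proof -
  obtain \<mu> v where v: "X \<in> borel_measurable M" "v \<ge> 0" "distr M borel X = gaussian_law \<mu> v"
    using combinations_gaussian[OF X] .
  have i: "integrable M (\<lambda>\<omega>. (X \<omega> - \<mu>) ^ k)" for k
    using integrable_gaussian_law_moment[OF v(2), of \<mu> k] v(1) unfolding v(3)[symmetric]
    by (subst (asm) integrable_distr_eq) auto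
  from Bochner_Integration.integrable_add[OF i[of 1] integrable_const[of \<mu>]]
  show 1: "integrable M X" by simp
  have "integrable M (\<lambda>\<omega>. (X \<omega> - \<mu>) ^ 2 + (2 * \<mu>) * X \<omega> - \<mu> ^ 2)"
    by (intro Bochner_Integration.integrable_add Bochner_Integration.integrable_diff
        integrable_mult_right 1 i integrable_const)
  then show "integrable M (\<lambda>\<omega>. X \<omega> * X \<omega>)" by (simp add: power2_eq_square algebra_simps)
qed

lemma combinations_mult_integrable:
  assumes X: "X \<in> combinations" and Y: "Y \<in> combinations"
  shows "integrable M (\<lambda>\<omega>. X \<omega> * Y \<omega>)"
proof (rule Bochner_Integration.integrable_bound)
  show "integrable M (\<lambda>\<omega>. X \<omega> * X \<omega> + Y \<omega> * Y \<omega>)"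
    using combinations_integrable X Y by auto
  show "(\<lambda>\<omega>. X \<omega> * Y \<omega>) \<in> borel_measurable M"
    using combinations_measurable X Y by auto
  have "\<bar>x * y\<bar> \<le> \<bar>x * x + y * y\<bar>" for x y :: real
  proof -
    have "2 * \<bar>x * y\<bar> \<le> x * x + y * y"
      using sum_squares_bound[of "\<bar>x\<bar>" "\<bar>y\<bar>"] by (simp add: power2_eq_square abs_mult)
    then show ?thesis using abs_ge_self[of "x * x + y * y"] abs_ge_zero[of "x * y"] by linarith
  qed
  then show "AE \<omega> in M. norm (X \<omega> * Y \<omega>) \<le> norm (X \<omega> * X \<omega> + Y \<omega> * Y \<omega>)" by simp
qed

lemma combinations_mean:
  assumes "X \<in> combinations" shows "expectation X = 0"
proof -
  obtain J a where J: "finite J" "X = (\<lambda>\<omega>. \<Sum>j\<in>J. a j * B j \<omega>)"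
    using assms by (elim combinationsE)
  have "expectation X = (\<Sum>j\<in>J. a j * expectation (B j))"
    unfolding J(2) using combinations_integrable(1)[OF combinations_B] by simp
  then show ?thesis by (simp add: mean_zero)
qed

lemma combinations_law:
  assumes X: "X \<in> combinations"
  shows "distr M borel X = gaussian_law 0 (sqrt (expectation (\<lambda>\<omega>. X \<omega> * X \<omega>)))"
proof -
  obtain \<mu> v where v: "X \<in> borel_measurable M" "v \<ge> 0" "distr M borel X = gaussian_law \<mu> v"
    using combinations_gaussian[OF X] .
  have "expectation X = (LINT x|distr M borel X. x)" using v(1) by (subst integral_distr) auto
  then have \<mu>: "\<mu> = 0" using v integral_gaussian_law combinations_mean[OF X] by simp
  have "expectation (\<lambda>\<omega>. X \<omega> * X \<omega>) = (LINT x|distr M borel X. (x - \<mu>) ^ (2 * 1))"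
    using v(1) \<mu> by (subst integral_distr) (auto simp: power2_eq_square)
  also have "\<dots> = v\<^sup>2" unfolding v(3) using integral_gaussian_law_even_moment[OF v(2), of \<mu> 1] by simp
  finally show ?thesis using v \<mu> by simp
qed

text \<open>A finite linear combination of the \<open>X t\<close> is a centred Gaussian variable
  whose variance is a quadratic form in the covariances. Equal covariances thus give equal laws of
  combinations, and \<open>process_law_unique\<close> applies.\<close>

lemma combinations_process_law:
  assumes X: "\<And>t. X t \<in> combinations" and Y: "\<And>t. Y t \<in> combinations"
    and cov: "\<And>s t. expectation (\<lambda>\<omega>. X s \<omega> * X t \<omega>) = expectation (\<lambda>\<omega>. Y s \<omega> * Y t \<omega>)"
  shows "distr M (PiM UNIV (\<lambda>_. borel)) (\<lambda>\<omega> t. X t \<omega>) = distr M (PiM UNIV (\<lambda>_. borel)) (\<lambda>\<omega> t. Y t \<omega>)"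
proof (rule process_law_unique)
  fix J :: "'b set" and a :: "'b \<Rightarrow> real" assume J: "finite J"
  have sq: "expectation (\<lambda>\<omega>. (\<Sum>j\<in>J. a j * Z j \<omega>) * (\<Sum>j\<in>J. a j * Z j \<omega>)) =
      (\<Sum>i\<in>J. \<Sum>j\<in>J. a i * a j * expectation (\<lambda>\<omega>. Z i \<omega> * Z j \<omega>))" if "\<And>t. Z t \<in> combinations" for Z
  proof -
    have "(\<Sum>j\<in>J. a j * Z j \<omega>) * (\<Sum>j\<in>J. a j * Z j \<omega>) = (\<Sum>i\<in>J. \<Sum>j\<in>J. a i * a j * (Z i \<omega> * Z j \<omega>))" for \<omega>
      by (simp add: sum_product algebra_simps)
    then show ?thesis using combinations_mult_integrable[OF that that]
      by (simp add: Bochner_Integration.integrable_sum)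
  qed
  show "distr M borel (\<lambda>\<omega>. \<Sum>j\<in>J. a j * X j \<omega>) = distr M borel (\<lambda>\<omega>. \<Sum>j\<in>J. a j * Y j \<omega>)"
    using J X Y by (subst (1 2) combinations_law) (auto intro!: combinations_sum simp: sq cov)
qed (auto intro: combinations_measurable X Y prob_space_axioms)

text \<open>The set of continuous paths is not measurable in the product space. With
  \<open>path_eval\<close> the local time factors through the functional \<open>\<Lambda>\<close>,
  which is measurable on all paths and is the ordinary local time on continuous ones, so equality of
  the process laws suffices.\<close>

lemma path_local_time_law:
  assumes X: "\<And>t. X t \<in> combinations" 
    and cont: "\<And>\<omega>. \<omega> \<in> space M \<Longrightarrow> continuous_on UNIV (\<lambda>t. X t \<omega>)"
    and cov: "\<And>s t. expectation (\<lambda>\<omega>. X s \<omega> * X t \<omega>) = expectation (\<lambda>\<omega>. B s \<omega> * B t \<omega>)"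
  shows "distr M borel (\<lambda>\<omega>. path_local_time (\<lambda>t. X t \<omega>) a c y) = distr M borel (\<lambda>\<omega>. path_local_time (\<lambda>t. B t \<omega>) a c y)"
proof -
  let ?P = "PiM UNIV (\<lambda>_. borel) :: (real \<Rightarrow> real) measure"
  define \<Lambda> where "\<Lambda> x = path_local_time (path_eval x) a c y" for x
  have \<Lambda>: "\<Lambda> \<in> borel_measurable ?P"
    unfolding \<Lambda>_def by (intro path_local_time_measurable_process path_eval_measurable) auto
  have *: "distr M borel (\<lambda>\<omega>. path_local_time (\<lambda>t. Z t \<omega>) a c y) = distr (distr M ?P (\<lambda>\<omega> t. Z t \<omega>)) borel \<Lambda>"
    if Z: "\<And>t. Z t \<in> borel_measurable M" "\<And>\<omega>. \<omega> \<in> space M \<Longrightarrow> continuous_on UNIV (\<lambda>t. Z t \<omega>)" for Z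
  proof -
    have "(\<lambda>\<omega> t. Z t \<omega>) \<in> measurable M ?P" by (auto intro!: measurable_PiM_single' simp: Z)
    then have "distr (distr M ?P (\<lambda>\<omega> t. Z t \<omega>)) borel \<Lambda> = distr M borel (\<Lambda> \<circ> (\<lambda>\<omega> t. Z t \<omega>))"
      using \<Lambda> by (intro distr_distr)
    also have "\<dots> = distr M borel (\<lambda>\<omega>. path_local_time (\<lambda>t. Z t \<omega>) a c y)"
    proof (intro distr_cong refl)
      fix \<omega> assume "\<omega> \<in> space M"
      then have "path_eval (\<lambda>t. Z t \<omega>) = (\<lambda>t. Z t \<omega>)" by (intro ext path_eval_continuous Z(2))
      then show "(\<Lambda> \<circ> (\<lambda>\<omega> t. Z t \<omega>)) \<omega> = path_local_time (\<lambda>t. Z t \<omega>) a c y" by (simp add: \<Lambda>_def)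
    qed
    finally show ?thesis by simp
  qed
  show ?thesis
    using cont continuous_paths combinations_process_law[of X B] X cov combinations_B
    by (subst (1 2) *) (auto intro: combinations_measurable)
qed

text \<open>The increments \<open>B (t + r) - B t\<close> form a process in \<open>r\<close> with
  the covariance of \<open>B\<close>, and moving the origin of time to \<open>t\<close> and that of
  space to \<open>B t\<close> carries the local time of \<open>B\<close> at level \<open>B t\<close>
  to that of the increments at level 0.\<close>

lemma stationary_path_local_time:
  "distr M borel (\<lambda>\<omega>. path_local_time (\<lambda>r. B r \<omega>) (t + a) (t + c) (B t \<omega>)) =
   distr M borel (\<lambda>\<omega>. path_local_time (\<lambda>r. B r \<omega>) a c 0)"
proof -
  define X where "X r \<omega> = B (t + r) \<omega> - B t \<omega>" for r \<omega>
  have X: "X r \<in> combinations" for r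
    using combinations_add[OF combinations_B combinations_scale[OF combinations_B, of "-1"]] by (simp add: X_def[abs_def])
  have BB: "integrable M (\<lambda>\<omega>. B s \<omega> * B r \<omega>)" for s r
    by (intro combinations_mult_integrable combinations_B)
  have "expectation (\<lambda>\<omega>. X s \<omega> * X r \<omega>) = expectation (\<lambda>\<omega>. B s \<omega> * B r \<omega>)" for s r
  proof -
    have "X s \<omega> * X r \<omega> = B (t + s) \<omega> * B (t + r) \<omega> - B (t + s) \<omega> * B t \<omega> - B t \<omega> * B (t + r) \<omega> + B t \<omega> * B t \<omega>" for \<omega>
      by (simp add: X_def algebra_simps)
    then have "expectation (\<lambda>\<omega>. X s \<omega> * X r \<omega>) = expectation (\<lambda>\<omega>. B (t + s) \<omega> * B (t + r) \<omega>)
        - expectation (\<lambda>\<omega>. B (t + s) \<omega> * B t \<omega>) - expectation (\<lambda>\<omega>. B t \<omega> * B (t + r) \<omega>) + expectation (\<lambda>\<omega>. B t \<omega> * B t \<omega>)"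
      by (simp add: BB)
    then show ?thesis unfolding covariance using H by (simp add: algebra_simps)
  qed
  then have "distr M borel (\<lambda>\<omega>. path_local_time (\<lambda>r. X r \<omega>) a c 0) = distr M borel (\<lambda>\<omega>. path_local_time (\<lambda>r. B r \<omega>) a c 0)"
    by (intro path_local_time_law X) 
      (auto simp: X_def intro!: continuous_intros continuous_on_compose2[OF continuous_paths])
  moreover have "path_local_time (\<lambda>r. X r \<omega>) a c 0 = path_local_time (\<lambda>r. B r \<omega>) (t + a) (t + c) (B t \<omega>)"
    if \<omega>: "\<omega> \<in> space M" for \<omega>
  proof -
    have b: "(\<lambda>r. B r \<omega>) \<in> borel_measurable borel" "(\<lambda>r. X r \<omega>) \<in> borel_measurable borel"
      using continuous_paths[OF \<omega>] unfolding X_def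
      by (auto intro!: borel_measurable_continuous_onI continuous_intros continuous_on_compose2[OF continuous_paths[OF \<omega>]])
    have "emeasure (occupation (\<lambda>r. B r \<omega>) (t + a) (t + c)) {B t \<omega> - d<..<B t \<omega> + d} =
        emeasure (occupation (\<lambda>r. X r \<omega>) a c) {0 - d<..<0 + d}" for d
    proof -
      have "(\<integral>\<^sup>+ r. indicator {t + a<..t + c} r * indicator {B t \<omega> - d<..<B t \<omega> + d} (B r \<omega>) \<partial>lborel) =
        ennreal \<bar>1\<bar> * (\<integral>\<^sup>+ r. indicator {t + a<..t + c} (t + 1 * r) * indicator {B t \<omega> - d<..<B t \<omega> + d} (B (t + 1 * r) \<omega>) \<partial>lborel)"
        using b(1) by (intro nn_integral_real_affine) auto
      also have "\<dots> = (\<integral>\<^sup>+ r. indicator {a<..c} r * indicator {0 - d<..<0 + d} (X r \<omega>) \<partial>lborel)"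
        by (auto intro!: nn_integral_cong simp: indicator_def X_def)
      finally show ?thesis using b by (simp add: emeasure_occupation)
    qed
    then show ?thesis by (simp add: path_local_time_def sym_upper_density_def)
  qed
  ultimately show ?thesis by (simp cong: distr_cong)
qed

text \<open>The radii are kept general because a change of scale replaces \<open>1 / Suc n\<close>
  by \<open>c powr H / Suc n\<close>.\<close>

lemma AE_local_time_limit:
  assumes e: "filterlim e (at_right 0) sequentially"
  shows "AE \<omega> in M. (\<lambda>n. ennreal (1 / (2 * e n)) * emeasure (occupation (\<lambda>r. B r \<omega>) a c) {- e n<..<e n})
    \<longlonglongrightarrow> emeasure (L \<omega>) {a<..c}"
proof -
  have "is_interval {a<..c} \<and> bounded {a<..c}" by (auto simp: is_interval_1)
  then have "AE \<omega> in M. ((\<lambda>\<epsilon>. ennreal (1 / (2 * \<epsilon>)) * (\<integral>\<^sup>+t\<in>{a<..c}. indicator {-\<epsilon><..<\<epsilon>} (B t \<omega>) \<partial>lborel))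
            \<longlongrightarrow> emeasure (L \<omega>) {a<..c}) (at_right 0)"
    using local_time unfolding local_time_at_zero_def by blast
  then show ?thesis using AE_space
  proof eventually_elim
    case (elim \<omega>)
    have "(\<lambda>r. B r \<omega>) \<in> borel_measurable borel"
      using continuous_paths[OF elim(2)] by (rule borel_measurable_continuous_onI)
    then have "(\<integral>\<^sup>+t\<in>{a<..c}. indicator {-\<epsilon><..<\<epsilon>} (B t \<omega>) \<partial>lborel) = emeasure (occupation (\<lambda>r. B r \<omega>) a c) {- \<epsilon><..<\<epsilon>}" for \<epsilon>
      by (simp add: emeasure_occupation mult.commute)
    with filterlim_compose[OF elim(1) e] show ?case by simp
  qed
qed

lemma AE_path_local_time:
  "AE \<omega> in M. path_local_time (\<lambda>r. B r \<omega>) a c 0 = emeasure (L \<omega>) {a<..c}"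
proof -
  have "filterlim (\<lambda>n. 1 / real (Suc n)) (at_right 0) sequentially"
    using LIMSEQ_inverse_real_of_nat by (auto simp: filterlim_at inverse_eq_divide)
  from AE_local_time_limit[OF this, of a c] show ?thesis
  proof eventually_elim
    case (elim \<omega>)
    then show ?case unfolding path_local_time_def sym_upper_density_def
      by (intro lim_imp_Limsup) (simp_all del: of_nat_Suc)
  qed
qed

lemma L_measurable[measurable]: "(\<lambda>\<omega>. emeasure (L \<omega>) {a<..c}) \<in> borel_measurable M"
  using local_time unfolding local_time_at_zero_def random_measure_def by auto

lemma sets_L: "\<omega> \<in> space M \<Longrightarrow> sets (L \<omega>) = sets borel"
  using local_time unfolding local_time_at_zero_def random_measure_def by auto

lemma B_joint_measurable: "(\<lambda>(\<omega>, t). B t \<omega>) \<in> borel_measurable (M \<Otimes>\<^sub>M borel)"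
  by (intro continuous_process_measurable continuous_paths) auto

lemma path_local_time_B_measurable[measurable]: "(\<lambda>\<omega>. path_local_time (\<lambda>r. B r \<omega>) a c y) \<in> borel_measurable M"
  using path_local_time_measurable_process[OF B_joint_measurable, of "\<lambda>_. a" "\<lambda>_. c" "\<lambda>_. y"] by simp

lemma stationary_local_time:
  assumes S: "S \<in> sets borel"
  shows "emeasure M {\<omega>\<in>space M. path_local_time (\<lambda>r. B r \<omega>) (t + a) (t + c) (B t \<omega>) \<in> S} =
    emeasure M {\<omega>\<in>space M. emeasure (L \<omega>) {a<..c} \<in> S}"
proof -
  have m: "(\<lambda>\<omega>. path_local_time (\<lambda>r. B r \<omega>) (t + a) (t + c) (B t \<omega>)) \<in> borel_measurable M"
    using path_local_time_measurable_process[OF B_joint_measurable, of "\<lambda>_. t + a" "\<lambda>_. t + c" "B t"] by simp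
  have "distr M borel (\<lambda>\<omega>. path_local_time (\<lambda>r. B r \<omega>) a c 0) = distr M borel (\<lambda>\<omega>. emeasure (L \<omega>) {a<..c})"
    using AE_path_local_time[of a c] by (intro distr_cong_AE) auto
  with stationary_path_local_time[of t a c]
  have "emeasure (distr M borel (\<lambda>\<omega>. path_local_time (\<lambda>r. B r \<omega>) (t + a) (t + c) (B t \<omega>))) S =
      emeasure (distr M borel (\<lambda>\<omega>. emeasure (L \<omega>) {a<..c})) S" by simp
  moreover have "{\<omega>\<in>space M. f \<omega> \<in> S} = f -` S \<inter> space M" for f :: "'a \<Rightarrow> ennreal" by auto
  ultimately show ?thesis using m S by (simp only: emeasure_distr L_measurable)
qed

end

section \<open>Self-similarity and the mean of the local time\<close>

lemma nn_integral_abs_powr_bound: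
  fixes H d :: real
  assumes H: "H < 1" and d: "d \<ge> 0"
  shows "(\<integral>\<^sup>+ t. indicator {- d<..d} t * ennreal (\<bar>t\<bar> powr (- H)) \<partial>lborel) \<le> ennreal (2 * d powr (1 - H) / (1 - H))"
proof -
  have pos: "(\<integral>\<^sup>+ t. indicator {0..d} t * ennreal (\<bar>t\<bar> powr (- H)) \<partial>lborel) = ennreal (d powr (1 - H) / (1 - H))"
  proof -
    have "((\<lambda>t. t powr (- H)) has_integral (d powr (- H + 1) / (- H + 1))) {0..d}"
      using H d by (intro has_integral_powr_from_0) auto
    then have "((\<lambda>t. indicator {0..d} t * \<bar>t\<bar> powr (- H)) has_integral (d powr (1 - H) / (1 - H))) UNIV"
    proof -
      have "(\<lambda>t. if t \<in> {0..d} then t powr (- H) else 0) = (\<lambda>t. indicator {0..d} t * \<bar>t\<bar> powr (- H))"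
        by (auto simp: indicator_def)
      then show ?thesis
        using \<open>((\<lambda>t. t powr (- H)) has_integral _) _\<close> has_integral_restrict_UNIV[of "{0..d}" "\<lambda>t. t powr (- H)"]
        by (simp add: add.commute)
    qed
    then have "(\<integral>\<^sup>+ t. ennreal (indicator {0..d} t * \<bar>t\<bar> powr (- H)) \<partial>lborel) = ennreal (d powr (1 - H) / (1 - H))"
      by (intro nn_integral_has_integral_lborel) auto
    then show ?thesis by (simp add: ennreal_mult' ennreal_indicator)
  qed
  have "(\<integral>\<^sup>+ t. indicator {- d..0} t * ennreal (\<bar>t\<bar> powr (- H)) \<partial>lborel) =
      ennreal \<bar>-1\<bar> * (\<integral>\<^sup>+ t. indicator {- d..0} (0 + (-1) * t) * ennreal (\<bar>0 + (-1) * t\<bar> powr (- H)) \<partial>lborel)"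
    by (intro nn_integral_real_affine) auto
  also have "\<dots> = (\<integral>\<^sup>+ t. indicator {0..d} t * ennreal (\<bar>t\<bar> powr (- H)) \<partial>lborel)"
    by (auto intro!: nn_integral_cong simp: indicator_def)
  finally have neg: "(\<integral>\<^sup>+ t. indicator {- d..0} t * ennreal (\<bar>t\<bar> powr (- H)) \<partial>lborel) = ennreal (d powr (1 - H) / (1 - H))"
    using pos by simp
  have "(\<integral>\<^sup>+ t. indicator {- d<..d} t * ennreal (\<bar>t\<bar> powr (- H)) \<partial>lborel) \<le>
      (\<integral>\<^sup>+ t. indicator {- d..0} t * ennreal (\<bar>t\<bar> powr (- H)) + indicator {0..d} t * ennreal (\<bar>t\<bar> powr (- H)) \<partial>lborel)"
    by (intro nn_integral_mono) (auto simp: indicator_def)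
  also have "\<dots> = ennreal (d powr (1 - H) / (1 - H)) + ennreal (d powr (1 - H) / (1 - H))"
    unfolding neg[symmetric] by (subst nn_integral_add) (simp_all add: neg pos)
  also have "\<dots> = ennreal (2 * d powr (1 - H) / (1 - H))"
    using H by (subst ennreal_plus[symmetric]) auto
  finally show ?thesis .
qed

lemma emeasure_Markov:
  fixes d :: real
  assumes [measurable]: "f \<in> borel_measurable M" and d: "d > 0"
  shows "emeasure M {\<omega>\<in>space M. ennreal d \<le> f \<omega>} \<le> ennreal (1 / d) * (\<integral>\<^sup>+ \<omega>. f \<omega> \<partial>M)"
proof -
  have "emeasure M {\<omega>\<in>space M. ennreal d \<le> f \<omega>} = (\<integral>\<^sup>+ \<omega>. indicator {\<omega>\<in>space M. ennreal d \<le> f \<omega>} \<omega> \<partial>M)"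
    by simp
  also have "\<dots> \<le> (\<integral>\<^sup>+ \<omega>. ennreal (1 / d) * f \<omega> \<partial>M)"
  proof (rule nn_integral_mono)
    fix \<omega>
    have "(1::ennreal) \<le> ennreal (1 / d) * f \<omega>" if "ennreal d \<le> f \<omega>"
      using mult_left_mono[OF that, of "ennreal (1 / d)"] d by (simp add: ennreal_mult[symmetric])
    then show "indicator {\<omega>\<in>space M. ennreal d \<le> f \<omega>} \<omega> \<le> ennreal (1 / d) * f \<omega>"
      by (auto simp: indicator_def)
  qed
  also have "\<dots> = ennreal (1 / d) * (\<integral>\<^sup>+ \<omega>. f \<omega> \<partial>M)" by (rule nn_integral_cmult) simp
  finally show ?thesis .
qed

context fbm_local_time
begin

lemma law_B: "distr M borel (B t) = gaussian_law 0 (\<sigma> * \<bar>t\<bar> powr H)"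
proof -
  have "expectation (\<lambda>\<omega>. B t \<omega> * B t \<omega>) = (\<sigma> * \<bar>t\<bar> powr H)\<^sup>2"
    using H by (simp add: covariance power_mult_distrib power2_eq_square[of "\<bar>t\<bar> powr H"] powr_add[symmetric])
  then show ?thesis using combinations_law[OF combinations_B, of t] \<sigma> by simp
qed

lemma B_path_measurable: "\<omega> \<in> space M \<Longrightarrow> (\<lambda>r. B r \<omega>) \<in> borel_measurable borel"
  using continuous_paths by (rule borel_measurable_continuous_onI)

text \<open>The process \<open>c powr (- H) * B (c * r)\<close> has the covariance of
  \<open>B\<close>. The time it spends in a window of radius \<open>d\<close> during
  \<open>(0, u]\<close> is \<open>1 / c\<close> times the time \<open>B\<close> spends in the window
  of radius \<open>c powr H * d\<close> during \<open>(0, c * u]\<close>; division by the window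
  lengths leaves the factor \<open>c powr (H - 1)\<close>.\<close>

lemma scaled_local_time:
  assumes c: "c > 0" and S: "S \<in> sets borel"
  shows "emeasure M {\<omega>\<in>space M. emeasure (L \<omega>) {0<..u} \<in> S} =
    emeasure M {\<omega>\<in>space M. ennreal (c powr (H - 1)) * emeasure (L \<omega>) {0<..c * u} \<in> S}"
proof -
  define X where "X r \<omega> = c powr (- H) * B (c * r) \<omega>" for r \<omega>
  have X: "X r \<in> combinations" for r unfolding X_def[abs_def] by (intro combinations_scale combinations_B)
  have "expectation (\<lambda>\<omega>. X s \<omega> * X r \<omega>) = expectation (\<lambda>\<omega>. B s \<omega> * B r \<omega>)" for s r
  proof -
    have "X s \<omega> * X r \<omega> = c powr (- 2 * H) * (B (c * s) \<omega> * B (c * r) \<omega>)" for \<omega>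
      using c by (simp add: X_def powr_add[symmetric])
    then have "expectation (\<lambda>\<omega>. X s \<omega> * X r \<omega>) = c powr (- 2 * H) * expectation (\<lambda>\<omega>. B (c * s) \<omega> * B (c * r) \<omega>)"
      by simp
    also have "\<dots> = (c powr (- 2 * H) * c powr (2 * H)) *
        (\<sigma>\<^sup>2 / 2 * (\<bar>s\<bar> powr (2 * H) + \<bar>r\<bar> powr (2 * H) - \<bar>r - s\<bar> powr (2 * H)))"
    proof -
      have p: "\<bar>c * z\<bar> powr (2 * H) = c powr (2 * H) * \<bar>z\<bar> powr (2 * H)" for z
        using c by (simp add: abs_mult powr_mult)
      show ?thesis unfolding covariance right_diff_distrib[symmetric, of c] p by algebra
    qed
    also have "c powr (- 2 * H) * c powr (2 * H) = 1" using c by (simp add: powr_add[symmetric])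
    finally show ?thesis by (simp add: covariance)
  qed
  then have law: "distr M borel (\<lambda>\<omega>. path_local_time (\<lambda>r. X r \<omega>) 0 u 0) = distr M borel (\<lambda>\<omega>. path_local_time (\<lambda>r. B r \<omega>) 0 u 0)"
    by (intro path_local_time_law X) 
      (auto simp: X_def intro!: continuous_intros continuous_on_compose2[OF continuous_paths])
  have "filterlim (\<lambda>n. c powr H / real (Suc n)) (at_right 0) sequentially"
    using c LIMSEQ_Suc[OF lim_const_over_n[of "c powr H"]] by (auto simp: filterlim_at simp del: of_nat_Suc)
  from AE_local_time_limit[OF this, of 0 "c * u"]
  have AE: "AE \<omega> in M. path_local_time (\<lambda>r. X r \<omega>) 0 u 0 = ennreal (c powr (H - 1)) * emeasure (L \<omega>) {0<..c * u}"
    using AE_space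
  proof eventually_elim
    case (elim \<omega>)
    have [measurable]: "(\<lambda>r. B r \<omega>) \<in> borel_measurable borel" by (rule B_path_measurable[OF elim(2)])
    have [measurable]: "(\<lambda>r. X r \<omega>) \<in> borel_measurable borel" unfolding X_def by measurable
    have occ: "ennreal c * emeasure (occupation (\<lambda>r. X r \<omega>) 0 u) {- d<..<d} =
        emeasure (occupation (\<lambda>r. B r \<omega>) 0 (c * u)) {- (c powr H * d)<..<c powr H * d}" for d
    proof -
      have "(\<integral>\<^sup>+ r. indicator {0<..c * u} r * indicator {- (c powr H * d)<..<c powr H * d} (B r \<omega>) \<partial>lborel) =
        ennreal \<bar>c\<bar> * (\<integral>\<^sup>+ r. indicator {0<..c * u} (0 + c * r) * indicator {- (c powr H * d)<..<c powr H * d} (B (0 + c * r) \<omega>) \<partial>lborel)"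
        using c by (intro nn_integral_real_affine) auto
      also have "(\<integral>\<^sup>+ r. indicator {0<..c * u} (0 + c * r) * indicator {- (c powr H * d)<..<c powr H * d} (B (0 + c * r) \<omega>) \<partial>lborel) =
         (\<integral>\<^sup>+ r. indicator {0<..u} r * indicator {- d<..<d} (X r \<omega>) \<partial>lborel)"
        using c by (intro nn_integral_cong)
          (auto simp: indicator_def X_def powr_minus field_simps zero_less_mult_iff)
      finally show ?thesis using c by (simp add: emeasure_occupation)
    qed
    have "ennreal (c powr (H - 1)) * (ennreal (1 / (2 * (c powr H / real (Suc n)))) *
          emeasure (occupation (\<lambda>r. B r \<omega>) 0 (c * u)) {- (c powr H / real (Suc n))<..<c powr H / real (Suc n)}) =
        ennreal (real (Suc n) / 2) * emeasure (occupation (\<lambda>r. X r \<omega>) 0 u) {0 - 1 / real (Suc n)<..<0 + 1 / real (Suc n)}" for n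
    proof -
      have "c powr (H - 1) * (1 / (2 * (c powr H / real (Suc n)))) * c = real (Suc n) / 2"
        using c by (simp add: powr_diff field_simps)
      then have "ennreal (c powr (H - 1)) * ennreal (1 / (2 * (c powr H / real (Suc n)))) * ennreal c = ennreal (real (Suc n) / 2)"
        using c by (simp only: ennreal_mult[symmetric] powr_ge_zero mult_nonneg_nonneg divide_nonneg_nonneg
            of_nat_0_le_iff zero_le_numeral zero_le_one less_imp_le)
      then show ?thesis using occ[of "1 / real (Suc n)", symmetric] by (simp add: mult.assoc[symmetric] del: of_nat_Suc)
    qed
    moreover have "(\<lambda>n. ennreal (c powr (H - 1)) * (ennreal (1 / (2 * (c powr H / real (Suc n)))) *
          emeasure (occupation (\<lambda>r. B r \<omega>) 0 (c * u)) {- (c powr H / real (Suc n))<..<c powr H / real (Suc n)}))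
       \<longlonglongrightarrow> ennreal (c powr (H - 1)) * emeasure (L \<omega>) {0<..c * u}"
      using elim(1) by (intro ennreal_tendsto_cmult) auto
    ultimately show ?case unfolding path_local_time_def sym_upper_density_def
      by (intro lim_imp_Limsup) (simp_all del: of_nat_Suc)
  qed
  have [measurable]: "(\<lambda>\<omega>. path_local_time (\<lambda>r. X r \<omega>) 0 u 0) \<in> borel_measurable M"
  proof -
    have "(\<lambda>(\<omega>, r). X r \<omega>) \<in> borel_measurable (M \<Otimes>\<^sub>M borel)"
      by (intro continuous_process_measurable combinations_measurable X)
        (auto simp: X_def intro!: continuous_intros continuous_on_compose2[OF continuous_paths])
    from path_local_time_measurable_process[OF this, of "\<lambda>_. 0" "\<lambda>_. u" "\<lambda>_. 0"] show ?thesis by simp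
  qed
  have "distr M borel (\<lambda>\<omega>. emeasure (L \<omega>) {0<..u}) = distr M borel (\<lambda>\<omega>. path_local_time (\<lambda>r. B r \<omega>) 0 u 0)"
    using AE_path_local_time[of 0 u] by (intro distr_cong_AE) auto
  also have "\<dots> = distr M borel (\<lambda>\<omega>. ennreal (c powr (H - 1)) * emeasure (L \<omega>) {0<..c * u})"
    unfolding law[symmetric] using AE by (intro distr_cong_AE) auto
  finally have "emeasure (distr M borel (\<lambda>\<omega>. emeasure (L \<omega>) {0<..u})) S =
      emeasure (distr M borel (\<lambda>\<omega>. ennreal (c powr (H - 1)) * emeasure (L \<omega>) {0<..c * u})) S" by simp
  moreover have "{\<omega>\<in>space M. f \<omega> \<in> S} = f -` S \<inter> space M" for f :: "'a \<Rightarrow> ennreal" by auto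
  moreover have "(\<lambda>\<omega>. ennreal (c powr (H - 1)) * emeasure (L \<omega>) {0<..c * u}) \<in> borel_measurable M" by measurable
  ultimately show ?thesis using S by (simp only: emeasure_distr L_measurable)
qed

lemma window_probability:
  assumes "t \<noteq> 0" "d \<ge> 0"
  shows "emeasure M {\<omega>\<in>space M. B t \<omega> \<in> {- d<..<d}} \<le> ennreal (2 * d / \<sigma>) * ennreal (\<bar>t\<bar> powr (- H))"
proof -
  have "emeasure M {\<omega>\<in>space M. B t \<omega> \<in> {- d<..<d}} = emeasure (distr M borel (B t)) {- d<..<d}"
    by (subst emeasure_distr) (auto intro!: arg_cong[where f="emeasure M"])
  also have "\<dots> \<le> ennreal (2 * d / (\<sigma> * \<bar>t\<bar> powr H))"
    unfolding law_B using assms \<sigma> by (intro emeasure_gaussian_law_window) auto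
  also have "\<dots> = ennreal (2 * d / \<sigma>) * ennreal (\<bar>t\<bar> powr (- H))"
    using assms \<sigma> by (subst ennreal_mult[symmetric]) (auto simp: powr_minus field_simps)
  finally show ?thesis .
qed

text \<open>The density of \<open>B t\<close> is at most
  \<open>1 / (\<sigma> * \<bar>t\<bar> powr H)\<close>, which is integrable near 0 as
  \<open>H < 1\<close>; Fatou's lemma passes the bound to the limit. Finiteness leads to absolutely
  continuous occupation measures, and the decay for small \<open>d\<close> removes the time shifts
  of the partition.\<close>

lemma expected_local_time:
  assumes d: "d \<ge> 0"
  shows "(\<integral>\<^sup>+ \<omega>. emeasure (L \<omega>) {- d<..d} \<partial>M) \<le> ennreal (2 * d powr (1 - H) / (\<sigma> * (1 - H)))"
proof -
  let ?P = "\<lambda>n \<omega>. ennreal (real (Suc n) / 2) * emeasure (occupation (\<lambda>r. B r \<omega>) (- d) d) {0 - 1 / real (Suc n)<..<0 + 1 / real (Suc n)}"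
  interpret P: pair_sigma_finite lborel M
    by (simp add: sigma_finite_measure_axioms lborel.sigma_finite_measure_axioms pair_sigma_finite.intro)
  note [measurable] = B_joint_measurable
  have [measurable]: "(\<lambda>(t, \<omega>). B t \<omega>) \<in> borel_measurable (lborel \<Otimes>\<^sub>M M)"
  proof -
    have "(\<lambda>p. (snd p, fst p)) \<in> measurable (lborel \<Otimes>\<^sub>M M) (M \<Otimes>\<^sub>M borel)" by measurable
    from measurable_compose[OF this B_joint_measurable] show ?thesis by (simp add: case_prod_beta')
  qed
  have [measurable]: "?P n \<in> borel_measurable M" for n
  proof -
    have "(\<lambda>\<omega>. \<integral>\<^sup>+ t. indicator {- d<..d} t * indicator {- 1 / real (Suc n)<..<1 / real (Suc n)} (B t \<omega>) \<partial>lborel) \<in> borel_measurable M"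
      by measurable
    also have "(\<lambda>\<omega>. \<integral>\<^sup>+ t. indicator {- d<..d} t * indicator {- 1 / real (Suc n)<..<1 / real (Suc n)} (B t \<omega>) \<partial>lborel) \<in> borel_measurable M \<longleftrightarrow>
      (\<lambda>\<omega>. emeasure (occupation (\<lambda>r. B r \<omega>) (- d) d) {0 - 1 / real (Suc n)<..<0 + 1 / real (Suc n)}) \<in> borel_measurable M"
      by (intro measurable_cong) (simp add: emeasure_occupation B_path_measurable del: of_nat_Suc)
    finally show ?thesis by measurable
  qed
  have int: "(\<integral>\<^sup>+ \<omega>. ?P n \<omega> \<partial>M) \<le> ennreal (2 * d powr (1 - H) / (\<sigma> * (1 - H)))" for n
  proof -
    let ?e = "1 / real (Suc n)"
    have "(\<integral>\<^sup>+ \<omega>. ?P n \<omega> \<partial>M) = (\<integral>\<^sup>+ \<omega>. ennreal (real (Suc n) / 2) * (\<integral>\<^sup>+ t. indicator {- d<..d} t * indicator {- ?e<..<?e} (B t \<omega>) \<partial>lborel) \<partial>M)"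
      by (intro nn_integral_cong) (simp add: emeasure_occupation B_path_measurable del: of_nat_Suc)
    also have "\<dots> = ennreal (real (Suc n) / 2) * (\<integral>\<^sup>+ \<omega>. (\<integral>\<^sup>+ t. indicator {- d<..d} t * indicator {- ?e<..<?e} (B t \<omega>) \<partial>lborel) \<partial>M)"
      by (intro nn_integral_cmult) measurable
    finally have 1: "(\<integral>\<^sup>+ \<omega>. ?P n \<omega> \<partial>M) = ennreal (real (Suc n) / 2) *
      (\<integral>\<^sup>+ \<omega>. (\<integral>\<^sup>+ t. indicator {- d<..d} t * indicator {- ?e<..<?e} (B t \<omega>) \<partial>lborel) \<partial>M)" .
    have "(\<integral>\<^sup>+ \<omega>. (\<integral>\<^sup>+ t. indicator {- d<..d} t * indicator {- ?e<..<?e} (B t \<omega>) \<partial>lborel) \<partial>M) =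
      (\<integral>\<^sup>+ t. (\<integral>\<^sup>+ \<omega>. indicator {- d<..d} t * indicator {- ?e<..<?e} (B t \<omega>) \<partial>M) \<partial>lborel)"
      by (rule P.Fubini') measurable
    also have "\<dots> \<le> (\<integral>\<^sup>+ t. ennreal (2 * ?e / \<sigma>) * (indicator {- d<..d} t * ennreal (\<bar>t\<bar> powr (- H))) \<partial>lborel)"
    proof (intro nn_integral_mono_AE)
      show "AE t in lborel. (\<integral>\<^sup>+ \<omega>. indicator {- d<..d} t * indicator {- ?e<..<?e} (B t \<omega>) \<partial>M) \<le>
          ennreal (2 * ?e / \<sigma>) * (indicator {- d<..d} t * ennreal (\<bar>t\<bar> powr (- H)))"
        using AE_lborel_singleton[of 0]
      proof eventually_elim
        case (elim t)
        have 2: "(\<integral>\<^sup>+ \<omega>. indicator {- d<..d} t * indicator {- ?e<..<?e} (B t \<omega>) \<partial>M) =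
            indicator {- d<..d} t * (\<integral>\<^sup>+ \<omega>. indicator {- ?e<..<?e} (B t \<omega>) \<partial>M)"
          by (rule nn_integral_cmult) measurable
        have 3: "(\<integral>\<^sup>+ \<omega>. indicator {- ?e<..<?e} (B t \<omega>) \<partial>M) = (\<integral>\<^sup>+ \<omega>. indicator {\<omega>\<in>space M. B t \<omega> \<in> {- ?e<..<?e}} \<omega> \<partial>M)"
          by (intro nn_integral_cong) (auto simp: indicator_def)
        have 4: "\<dots> = emeasure M {\<omega>\<in>space M. B t \<omega> \<in> {- ?e<..<?e}}" by (rule nn_integral_indicator) measurable
        have "indicator {- d<..d} t * emeasure M {\<omega>\<in>space M. B t \<omega> \<in> {- ?e<..<?e}} \<le> indicator {- d<..d} t * (ennreal (2 * ?e / \<sigma>) * ennreal (\<bar>t\<bar> powr (- H)))"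
          using elim by (intro mult_left_mono window_probability) auto
        then show ?case unfolding 2 3 4 by (simp only: mult_ac)
      qed
    qed
    also have "\<dots> = ennreal (2 * ?e / \<sigma>) * (\<integral>\<^sup>+ t. (indicator {- d<..d} t * ennreal (\<bar>t\<bar> powr (- H))) \<partial>lborel)"
      by (rule nn_integral_cmult) simp
    also have "\<dots> \<le> ennreal (2 * ?e / \<sigma>) * ennreal (2 * d powr (1 - H) / (1 - H))"
      using H d by (intro mult_left_mono nn_integral_abs_powr_bound) auto
    finally have "(\<integral>\<^sup>+ \<omega>. ?P n \<omega> \<partial>M) \<le>
        ennreal (real (Suc n) / 2) * (ennreal (2 * ?e / \<sigma>) * ennreal (2 * d powr (1 - H) / (1 - H)))"
      unfolding 1 by (intro mult_left_mono) auto
    also have "\<dots> = ennreal (2 * d powr (1 - H) / (\<sigma> * (1 - H)))"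
    proof -
      have "m / 2 * (2 * (1 / m) / \<sigma> * (2 * p / q)) = 2 * p / (\<sigma> * q)" if "m \<noteq> 0" for m p q :: real
        using that by simp
      then have "real (Suc n) / 2 * (2 * ?e / \<sigma> * (2 * d powr (1 - H) / (1 - H))) = 2 * d powr (1 - H) / (\<sigma> * (1 - H))"
        by simp
      moreover have "0 \<le> 2 * ?e / \<sigma>" "0 \<le> 2 * d powr (1 - H) / (1 - H)" "0 \<le> real (Suc n) / 2"
        using H \<sigma> by auto
      ultimately show ?thesis by (simp only: ennreal_mult[symmetric] mult_nonneg_nonneg)
    qed
    finally show ?thesis .
  qed
  have "filterlim (\<lambda>n. 1 / real (Suc n)) (at_right 0) sequentially"
    using LIMSEQ_inverse_real_of_nat by (auto simp: filterlim_at inverse_eq_divide)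
  from AE_local_time_limit[OF this, of "- d" d]
  have "AE \<omega> in M. emeasure (L \<omega>) {- d<..d} = liminf (\<lambda>n. ?P n \<omega>)"
  proof eventually_elim
    case (elim \<omega>)
    then have "(\<lambda>n. ?P n \<omega>) \<longlonglongrightarrow> emeasure (L \<omega>) {- d<..d}" by (simp del: of_nat_Suc)
    then show ?case by (simp add: lim_imp_Liminf del: of_nat_Suc)
  qed
  then have "(\<integral>\<^sup>+ \<omega>. emeasure (L \<omega>) {- d<..d} \<partial>M) = (\<integral>\<^sup>+ \<omega>. liminf (\<lambda>n. ?P n \<omega>) \<partial>M)"
    by (rule nn_integral_cong_AE)
  also have "\<dots> \<le> liminf (\<lambda>n. \<integral>\<^sup>+ \<omega>. ?P n \<omega> \<partial>M)" by (rule nn_integral_liminf) measurable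
  also have "\<dots> \<le> liminf (\<lambda>n. ennreal (2 * d powr (1 - H) / (\<sigma> * (1 - H))))"
    using int by (intro Liminf_mono always_eventually allI)
  also have "\<dots> = ennreal (2 * d powr (1 - H) / (\<sigma> * (1 - H)))" by (rule Liminf_const) simp
  finally show ?thesis .
qed

end

section \<open>The occupation identity in expectation\<close>

context fbm_local_time
begin

definition level_prob :: "real \<Rightarrow> real \<Rightarrow> ennreal \<Rightarrow> ennreal" where
  "level_prob a c s = emeasure M {\<omega>\<in>space M. emeasure (L \<omega>) {a<..c} \<le> s}"

definition truncated_mass :: "ennreal \<Rightarrow> ennreal" where
  "truncated_mass s = (\<integral>\<^sup>+ \<omega>. (\<integral>\<^sup>+ x. min s (path_local_time (\<lambda>r. B r \<omega>) 0 1 x) \<partial>lborel) \<partial>M)"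

lemma L_mono: "\<omega> \<in> space M \<Longrightarrow> a' \<le> a \<Longrightarrow> c \<le> c' \<Longrightarrow> emeasure (L \<omega>) {a<..c} \<le> emeasure (L \<omega>) {a'<..c'}"
  by (intro emeasure_mono) (auto simp: sets_L)

lemma L_subadditive: "\<omega> \<in> space M \<Longrightarrow> emeasure (L \<omega>) {a<..e} \<le> emeasure (L \<omega>) {a<..c} + emeasure (L \<omega>) {c<..e}"
  by (rule order_trans[OF emeasure_mono emeasure_subadditive]) (auto simp: sets_L)

lemma expected_local_time_le:
  assumes "d \<ge> 0" "- d \<le> a" "c \<le> d"
  shows "(\<integral>\<^sup>+ \<omega>. emeasure (L \<omega>) {a<..c} \<partial>M) \<le> ennreal (2 * d powr (1 - H) / (\<sigma> * (1 - H)))"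
  using assms by (intro order_trans[OF nn_integral_mono expected_local_time] L_mono) auto

lemma B_pair_measurable: "(\<lambda>z. B (snd z) (fst z)) \<in> borel_measurable (M \<Otimes>\<^sub>M lborel)"
proof -
  have "(\<lambda>z. (fst z, snd z)) \<in> measurable (M \<Otimes>\<^sub>M lborel) (M \<Otimes>\<^sub>M borel)" by measurable
  from measurable_compose[OF this B_joint_measurable] show ?thesis by (simp add: case_prod_beta')
qed

lemma path_local_time_pair_measurable:
  assumes "a \<in> borel_measurable (M \<Otimes>\<^sub>M lborel)" "c \<in> borel_measurable (M \<Otimes>\<^sub>M lborel)"
    "y \<in> borel_measurable (M \<Otimes>\<^sub>M lborel)"
  shows "(\<lambda>z. path_local_time (\<lambda>r. B r (fst z)) (a z) (c z) (y z)) \<in> borel_measurable (M \<Otimes>\<^sub>M lborel)"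
proof -
  have "(\<lambda>q. (fst (fst q), snd q)) \<in> measurable ((M \<Otimes>\<^sub>M lborel) \<Otimes>\<^sub>M borel) (M \<Otimes>\<^sub>M borel)" by measurable
  from measurable_compose[OF this B_joint_measurable]
  have "(\<lambda>(z, r). B r (fst z)) \<in> borel_measurable ((M \<Otimes>\<^sub>M lborel) \<Otimes>\<^sub>M borel)"
    by (simp add: case_prod_beta')
  then show ?thesis using assms by (rule path_local_time_measurable_process)
qed

text \<open>Seen from time \<open>t\<close> and level \<open>B t\<close>, the interval
  \<open>(t + d, 1]\<close> becomes \<open>(d, 1 - t]\<close> and the level becomes 0.\<close>

lemma level_prob_eq:
  "level_prob d (1 - t) s = (\<integral>\<^sup>+ \<omega>. of_bool (path_local_time (\<lambda>r. B r \<omega>) (t + d) 1 (B t \<omega>) \<le> s) \<partial>M)"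
proof -
  have m: "{\<omega>\<in>space M. path_local_time (\<lambda>r. B r \<omega>) (t + d) 1 (B t \<omega>) \<le> s} \<in> sets M"
  proof -
    have "(\<lambda>\<omega>. path_local_time (\<lambda>r. B r \<omega>) (t + d) 1 (B t \<omega>)) \<in> borel_measurable M"
      using path_local_time_measurable_process[OF B_joint_measurable, of "\<lambda>_. t + d" "\<lambda>_. 1" "B t"] by simp
    then show ?thesis by measurable
  qed
  have "level_prob d (1 - t) s = emeasure M {\<omega>\<in>space M. path_local_time (\<lambda>r. B r \<omega>) (t + d) 1 (B t \<omega>) \<le> s}"
    using stationary_local_time[of "{..s}" t d "1 - t"] by (simp add: level_prob_def)
  also have "\<dots> = (\<integral>\<^sup>+ \<omega>. indicator {\<omega>\<in>space M. path_local_time (\<lambda>r. B r \<omega>) (t + d) 1 (B t \<omega>) \<le> s} \<omega> \<partial>M)"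
    using m by (rule nn_integral_indicator[symmetric])
  also have "\<dots> = (\<integral>\<^sup>+ \<omega>. of_bool (path_local_time (\<lambda>r. B r \<omega>) (t + d) 1 (B t \<omega>) \<le> s) \<partial>M)"
    by (intro nn_integral_cong) (simp add: indicator_def)
  finally show ?thesis .
qed

lemma of_bool_joint_measurable:
  "(\<lambda>(\<omega>, t). of_bool (path_local_time (\<lambda>r. B r \<omega>) (t + d) 1 (B t \<omega>) \<le> s) :: ennreal) \<in> borel_measurable (M \<Otimes>\<^sub>M lborel)"
proof -
  have "(\<lambda>z. path_local_time (\<lambda>r. B r (fst z)) (snd z + d) 1 (B (snd z) (fst z))) \<in> borel_measurable (M \<Otimes>\<^sub>M lborel)"
    by (intro path_local_time_pair_measurable B_pair_measurable) measurable
  then have "(\<lambda>z. of_bool (path_local_time (\<lambda>r. B r (fst z)) (snd z + d) 1 (B (snd z) (fst z)) \<le> s) :: ennreal) \<in> borel_measurable (M \<Otimes>\<^sub>M lborel)"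
    by measurable
  then show ?thesis by (simp add: case_prod_beta')
qed

interpretation P: pair_sigma_finite M lborel
  by (simp add: sigma_finite_measure_axioms lborel.sigma_finite_measure_axioms pair_sigma_finite.intro)

lemma level_prob_measurable: "(\<lambda>t. level_prob d (1 - t) s) \<in> borel_measurable lborel"
proof -
  have "(\<lambda>p. (snd p, fst p)) \<in> measurable (lborel \<Otimes>\<^sub>M M) (M \<Otimes>\<^sub>M lborel)" by measurable
  from measurable_compose[OF this of_bool_joint_measurable[of d s]]
  have "(\<lambda>(t, \<omega>). of_bool (path_local_time (\<lambda>r. B r \<omega>) (t + d) 1 (B t \<omega>) \<le> s) :: ennreal) \<in> borel_measurable (lborel \<Otimes>\<^sub>M M)"
    by (simp add: case_prod_beta')
  then show ?thesis unfolding level_prob_eq by measurable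
qed

lemma time_average:
  "(\<integral>\<^sup>+ \<omega>. (\<integral>\<^sup>+ t. indicator {0<..1} t * of_bool (path_local_time (\<lambda>r. B r \<omega>) (t + d) 1 (B t \<omega>) \<le> s) \<partial>lborel) \<partial>M) =
   (\<integral>\<^sup>+ t. indicator {0<..1} t * level_prob d (1 - t) s \<partial>lborel)"
proof -
  have m: "(\<lambda>(\<omega>, t). indicator {0<..1} t * of_bool (path_local_time (\<lambda>r. B r \<omega>) (t + d) 1 (B t \<omega>) \<le> s) :: ennreal) \<in> borel_measurable (M \<Otimes>\<^sub>M lborel)"
    using of_bool_joint_measurable[of d s] by (simp add: case_prod_beta')
  have "(\<integral>\<^sup>+ \<omega>. (\<integral>\<^sup>+ t. indicator {0<..1} t * of_bool (path_local_time (\<lambda>r. B r \<omega>) (t + d) 1 (B t \<omega>) \<le> s) \<partial>lborel) \<partial>M) =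
    (\<integral>\<^sup>+ t. (\<integral>\<^sup>+ \<omega>. indicator {0<..1} t * of_bool (path_local_time (\<lambda>r. B r \<omega>) (t + d) 1 (B t \<omega>) \<le> s) \<partial>M) \<partial>lborel)"
    by (rule P.Fubini'[OF m, symmetric])
  also have "\<dots> = (\<integral>\<^sup>+ t. indicator {0<..1} t * level_prob d (1 - t) s \<partial>lborel)"
    unfolding level_prob_eq
  proof (intro nn_integral_cong nn_integral_cmult)
    fix t
    from measurable_compose[OF measurable_Pair2'[of t lborel M] of_bool_joint_measurable[of d s]]
    show "(\<lambda>\<omega>. of_bool (path_local_time (\<lambda>r. B r \<omega>) (t + d) 1 (B t \<omega>) \<le> s) :: ennreal) \<in> borel_measurable M"
      by simp
  qed
  finally show ?thesis .
qed

text \<open>For fixed \<open>t\<close> in (0,1] stationarity identifies the law of the local time at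
  \<open>B t\<close> with that of \<open>L\<close> on \<open>(- t, 1 - t]\<close>, which has finite
  mean. Fubini's theorem then moves the exceptional set from paths to times.\<close>

lemma AE_finite_local_time:
  "AE \<omega> in M. AE t in lborel. t \<in> {0<..1} \<longrightarrow> path_local_time (\<lambda>r. B r \<omega>) 0 1 (B t \<omega>) < \<infinity>"
proof -
  have "(\<lambda>z. path_local_time (\<lambda>r. B r (fst z)) 0 1 (B (snd z) (fst z))) \<in> borel_measurable (M \<Otimes>\<^sub>M lborel)"
    by (intro path_local_time_pair_measurable B_pair_measurable) measurable
  then have "{z \<in> space (M \<Otimes>\<^sub>M lborel). snd z \<in> {0<..1} \<longrightarrow> path_local_time (\<lambda>r. B r (fst z)) 0 1 (B (snd z) (fst z)) < \<infinity>} \<in> sets (M \<Otimes>\<^sub>M lborel)"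
    by measurable
  note commute = P.AE_commute[OF this]
  have "AE \<omega> in M. t \<in> {0<..1} \<longrightarrow> path_local_time (\<lambda>r. B r \<omega>) 0 1 (B t \<omega>) < \<infinity>" for t
  proof (cases "t \<in> {0<..1}")
    case True
    have "(\<integral>\<^sup>+ \<omega>. emeasure (L \<omega>) {- t<..1 - t} \<partial>M) \<le> ennreal (2 * 1 powr (1 - H) / (\<sigma> * (1 - H)))"
      using True by (intro expected_local_time_le) auto
    then have "(\<integral>\<^sup>+ \<omega>. emeasure (L \<omega>) {- t<..1 - t} \<partial>M) \<noteq> \<infinity>" by (auto simp: top_unique)
    then have "AE \<omega> in M. emeasure (L \<omega>) {- t<..1 - t} \<noteq> \<infinity>" by (intro nn_integral_PInf_AE) auto
    then have "emeasure M {\<omega>\<in>space M. emeasure (L \<omega>) {- t<..1 - t} \<in> {\<infinity>}} = 0"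
      by (subst (asm) AE_iff_measurable[OF _ refl]) auto
    then have z: "emeasure M {\<omega>\<in>space M. path_local_time (\<lambda>r. B r \<omega>) 0 1 (B t \<omega>) \<in> {\<infinity>}} = 0"
      using stationary_local_time[of "{\<infinity>}" t "- t" "1 - t"] by simp
    have "(\<lambda>\<omega>. path_local_time (\<lambda>r. B r \<omega>) 0 1 (B t \<omega>)) \<in> borel_measurable M"
      using path_local_time_measurable_process[OF B_joint_measurable, of "\<lambda>_. 0" "\<lambda>_. 1" "B t"] by simp
    then have "{\<omega>\<in>space M. path_local_time (\<lambda>r. B r \<omega>) 0 1 (B t \<omega>) \<in> {\<infinity>}} \<in> sets M" by measurable
    with z have "AE \<omega> in M. path_local_time (\<lambda>r. B r \<omega>) 0 1 (B t \<omega>) \<noteq> \<infinity>"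
      by (intro AE_I[of _ _ "{\<omega>\<in>space M. path_local_time (\<lambda>r. B r \<omega>) 0 1 (B t \<omega>) \<in> {\<infinity>}}"]) auto
    then show ?thesis by eventually_elim (auto simp: less_top)
  next
    case False
    then show ?thesis by (intro AE_I2) blast
  qed
  then have "AE t in lborel. AE \<omega> in M. t \<in> {0<..1} \<longrightarrow> path_local_time (\<lambda>r. B r \<omega>) 0 1 (B t \<omega>) < \<infinity>"
    by simp
  then show ?thesis using commute by blast
qed

lemma truncated_mass_sandwich:
  assumes N: "N > (0::nat)"
  shows "(\<integral>\<^sup>+ t. indicator {0<..1} t * level_prob (- 1 / N) (1 - t) s \<partial>lborel) \<le> truncated_mass s"
    and "truncated_mass s \<le> (\<integral>\<^sup>+ t. indicator {0<..1} t * level_prob (1 / N) (1 - t) s \<partial>lborel)"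
proof -
  show "(\<integral>\<^sup>+ t. indicator {0<..1} t * level_prob (- 1 / N) (1 - t) s \<partial>lborel) \<le> truncated_mass s"
    unfolding truncated_mass_def time_average[symmetric]
  proof (intro nn_integral_mono_AE)
    show "AE \<omega> in M. (\<integral>\<^sup>+ t. indicator {0<..1} t * of_bool (path_local_time (\<lambda>r. B r \<omega>) (t + - 1 / N) 1 (B t \<omega>) \<le> s) \<partial>lborel)
        \<le> (\<integral>\<^sup>+ x. min s (path_local_time (\<lambda>r. B r \<omega>) 0 1 x) \<partial>lborel)"
      using AE_finite_local_time AE_space
    proof eventually_elim
      case (elim \<omega>)
      show ?case using local_time_sandwich(1)[OF B_path_measurable[OF elim(2)] elim(1) N, of s] by simp
    qed
  qed
  show "truncated_mass s \<le> (\<integral>\<^sup>+ t. indicator {0<..1} t * level_prob (1 / N) (1 - t) s \<partial>lborel)"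
    unfolding truncated_mass_def time_average[symmetric]
  proof (intro nn_integral_mono_AE)
    show "AE \<omega> in M. (\<integral>\<^sup>+ x. min s (path_local_time (\<lambda>r. B r \<omega>) 0 1 x) \<partial>lborel) \<le>
        (\<integral>\<^sup>+ t. indicator {0<..1} t * of_bool (path_local_time (\<lambda>r. B r \<omega>) (t + 1 / N) 1 (B t \<omega>) \<le> s) \<partial>lborel)"
      using AE_finite_local_time AE_space
    proof eventually_elim
      case (elim \<omega>)
      show ?case using local_time_sandwich(2)[OF B_path_measurable[OF elim(2)] elim(1) N, of s] by simp
    qed
  qed
qed

text \<open>If \<open>(b, c]\<close> has mass at most \<open>s\<close> but \<open>(a, c]\<close>
  more than \<open>s'\<close>, then the short interval \<open>(a, b]\<close> carries at least
  \<open>s' - s\<close>, which Markov's inequality makes unlikely. A shift in time is thus paid for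
  by raising the level.\<close>

lemma level_prob_perturb:
  fixes s s' :: real
  assumes s: "0 \<le> s" "s < s'" and le: "a \<le> b" and d: "0 \<le> d" "- d \<le> a" "b \<le> d"
  shows "level_prob b c s \<le> level_prob a c s' + ennreal (1 / (s' - s) * (2 * d powr (1 - H) / (\<sigma> * (1 - H))))"
proof -
  let ?A = "{\<omega>\<in>space M. emeasure (L \<omega>) {a<..c} \<le> ennreal s'}"
  let ?C = "{\<omega>\<in>space M. ennreal (s' - s) \<le> emeasure (L \<omega>) {a<..b}}"
  have "level_prob b c s \<le> emeasure M (?A \<union> ?C)"
    unfolding level_prob_def
  proof (intro emeasure_mono subsetI)
    fix \<omega> assume \<omega>: "\<omega> \<in> {\<omega>\<in>space M. emeasure (L \<omega>) {b<..c} \<le> ennreal s}"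
    show "\<omega> \<in> ?A \<union> ?C"
    proof (cases "ennreal (s' - s) \<le> emeasure (L \<omega>) {a<..b}")
      case False
      have "emeasure (L \<omega>) {a<..c} \<le> emeasure (L \<omega>) {a<..b} + emeasure (L \<omega>) {b<..c}"
        using \<omega> by (intro L_subadditive) auto
      also have "\<dots> \<le> ennreal (s' - s) + ennreal s" using False \<omega> by (intro add_mono) auto
      also have "\<dots> = ennreal s'" using s by (simp flip: ennreal_plus)
      finally show ?thesis using \<omega> by simp
    qed (use \<omega> in simp)
  qed auto
  also have "\<dots> \<le> emeasure M ?A + emeasure M ?C" by (intro emeasure_subadditive) auto
  also have "emeasure M ?C \<le> ennreal (1 / (s' - s)) * ennreal (2 * d powr (1 - H) / (\<sigma> * (1 - H)))"
    using s d by (intro order_trans[OF emeasure_Markov] mult_left_mono expected_local_time_le) auto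
  also have "\<dots> = ennreal (1 / (s' - s) * (2 * d powr (1 - H) / (\<sigma> * (1 - H))))"
    using s H \<sigma> by (intro ennreal_mult[symmetric]) auto
  finally show ?thesis by (simp add: level_prob_def add_left_mono)
qed

definition mean_level_prob :: "ennreal \<Rightarrow> ennreal" where
  "mean_level_prob s = (\<integral>\<^sup>+ t. indicator {0<..1} t * level_prob 0 (1 - t) s \<partial>lborel)"

lemma integral_level_prob_perturb:
  fixes s s' :: real
  assumes s: "0 \<le> s" "s < s'" and le: "a \<le> b" and d: "0 \<le> d" "- d \<le> a" "b \<le> d"
  shows "(\<integral>\<^sup>+ t. indicator {0<..1} t * level_prob b (1 - t) s \<partial>lborel) \<le>
    (\<integral>\<^sup>+ t. indicator {0<..1} t * level_prob a (1 - t) s' \<partial>lborel) + ennreal (1 / (s' - s) * (2 * d powr (1 - H) / (\<sigma> * (1 - H))))"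
proof -
  let ?e = "ennreal (1 / (s' - s) * (2 * d powr (1 - H) / (\<sigma> * (1 - H))))"
  have "(\<integral>\<^sup>+ t. indicator {0<..1} t * level_prob b (1 - t) s \<partial>lborel) \<le>
     (\<integral>\<^sup>+ t. indicator {0<..1} t * level_prob a (1 - t) s' + ?e * indicator {0<..1} t \<partial>lborel)"
  proof (rule nn_integral_mono)
    fix t
    show "indicator {0<..1} t * level_prob b (1 - t) s \<le> indicator {0<..1} t * level_prob a (1 - t) s' + ?e * indicator {0<..1} t"
      using level_prob_perturb[OF assms, of "1 - t"] by (simp add: indicator_def)
  qed
  also have "\<dots> = (\<integral>\<^sup>+ t. indicator {0<..1} t * level_prob a (1 - t) s' \<partial>lborel) + ?e"
    using level_prob_measurable[of a s'] by (subst nn_integral_add) (auto simp: nn_integral_cmult_indicator)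
  finally show ?thesis .
qed

lemma le_of_perturb:
  fixes x y :: ennreal and k :: real
  assumes "\<And>N. (0::nat) < N \<Longrightarrow> x \<le> y + ennreal (k * (2 * (1 / N) powr (1 - H) / (\<sigma> * (1 - H))))"
  shows "x \<le> y"
proof -
  have "(\<lambda>N. (1 / real N) powr (1 - H)) \<longlonglongrightarrow> 0"
    using H by real_asymp
  then have "(\<lambda>N. k * (2 * (1 / real N) powr (1 - H) / (\<sigma> * (1 - H)))) \<longlonglongrightarrow> k * (2 * 0 / (\<sigma> * (1 - H)))"
    using H \<sigma> by (intro tendsto_intros) auto
  then have "(\<lambda>N. y + ennreal (k * (2 * (1 / real N) powr (1 - H) / (\<sigma> * (1 - H))))) \<longlonglongrightarrow> y + ennreal 0"
    by (intro tendsto_add tendsto_const tendsto_ennrealI) simp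
  then have "(\<lambda>N. y + ennreal (k * (2 * (1 / real N) powr (1 - H) / (\<sigma> * (1 - H))))) \<longlonglongrightarrow> y" by simp
  then show ?thesis by (rule LIMSEQ_le_const) (use assms in \<open>auto intro!: exI[of _ 1]\<close>)
qed

text \<open>For a fixed gap \<open>s' - s\<close> the cost of the shift \<open>1 / N\<close> is of
  order \<open>N powr (H - 1)\<close> and vanishes in the limit. The gap itself remains; it is
  absorbed by the ratio \<open>l\<close> in \<open>regular_growth_of_sandwich\<close>.\<close>

lemma mean_level_prob_le_truncated_mass:
  fixes s s' :: real
  assumes "0 \<le> s" "s < s'" shows "mean_level_prob s \<le> truncated_mass s'"
proof (rule le_of_perturb[where k="1 / (s' - s)"])
  fix N :: nat assume N: "N > 0"
  have "mean_level_prob s \<le> (\<integral>\<^sup>+ t. indicator {0<..1} t * level_prob (- 1 / N) (1 - t) s' \<partial>lborel)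
      + ennreal (1 / (s' - s) * (2 * (1 / N) powr (1 - H) / (\<sigma> * (1 - H))))"
    unfolding mean_level_prob_def using assms by (intro integral_level_prob_perturb) auto
  also have "\<dots> \<le> truncated_mass s' + ennreal (1 / (s' - s) * (2 * (1 / N) powr (1 - H) / (\<sigma> * (1 - H))))"
    by (intro add_right_mono truncated_mass_sandwich N)
  finally show "mean_level_prob s \<le> truncated_mass s' + ennreal (1 / (s' - s) * (2 * (1 / N) powr (1 - H) / (\<sigma> * (1 - H))))" .
qed

lemma truncated_mass_le_mean_level_prob:
  fixes s s' :: real
  assumes "0 \<le> s" "s < s'" shows "truncated_mass s \<le> mean_level_prob s'"
proof (rule le_of_perturb[where k="1 / (s' - s)"])
  fix N :: nat assume N: "N > 0"
  have "truncated_mass s \<le> (\<integral>\<^sup>+ t. indicator {0<..1} t * level_prob (1 / N) (1 - t) s \<partial>lborel)"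
    by (intro truncated_mass_sandwich N)
  also have "\<dots> \<le> mean_level_prob s' + ennreal (1 / (s' - s) * (2 * (1 / N) powr (1 - H) / (\<sigma> * (1 - H))))"
    unfolding mean_level_prob_def using assms by (intro integral_level_prob_perturb) auto
  finally show "truncated_mass s \<le> mean_level_prob s' + ennreal (1 / (s' - s) * (2 * (1 / N) powr (1 - H) / (\<sigma> * (1 - H))))" .
qed

end

section \<open>The expected range\<close>

text \<open>A dyadic point of order \<open>n + 1\<close> with odd numerator is one step of that
  order away from a point of order \<open>n\<close>, so each order contributes a single term to the
  distance from \<open>b 0\<close>. Continuity extends the bound to all \<open>t\<close>.\<close>

lemma dyadic_chaining:
  fixes b :: "real \<Rightarrow> real"
  assumes cont: "continuous_on {0..1} b"
    and A: "\<And>n k. k < 2 ^ n \<Longrightarrow> \<bar>b (real (Suc k) / 2 ^ n) - b (real k / 2 ^ n)\<bar> \<le> A n"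
    and S: "\<And>n. (\<Sum>j\<le>n. A j) \<le> S" and t: "t \<in> {0..1}"
  shows "\<bar>b t - b 0\<bar> \<le> S"
proof -
  have dyadic: "\<bar>b (real k / 2 ^ n) - b 0\<bar> \<le> (\<Sum>j\<le>n. A j)" if "k \<le> 2 ^ n" for n k
    using that
  proof (induction n arbitrary: k)
    case 0
    then have "k = 0 \<or> k = 1" by auto
    then show ?case using A[of 0 0] by auto
  next
    case (Suc n)
    show ?case
    proof (cases "even k")
      case True
      then obtain i where i: "k = 2 * i" by blast
      then have "real k / 2 ^ Suc n = real i / 2 ^ n" by simp
      moreover have "\<bar>b (real i / 2 ^ n) - b 0\<bar> \<le> (\<Sum>j\<le>n. A j)" using Suc.IH[of i] Suc.prems i by simp
      moreover have "0 \<le> A (Suc n)" using A[of 0 "Suc n"] by (rule order_trans[rotated]) auto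
      ultimately show ?thesis by simp
    next
      case False
      then obtain i where i: "k = 2 * i + 1" by (rule oddE)
      then have "real (2 * i) / 2 ^ Suc n = real i / 2 ^ n" by simp
      moreover have "\<bar>b (real i / 2 ^ n) - b 0\<bar> \<le> (\<Sum>j\<le>n. A j)" using Suc.IH[of i] Suc.prems i by simp
      moreover have "\<bar>b (real (Suc (2 * i)) / 2 ^ Suc n) - b (real (2 * i) / 2 ^ Suc n)\<bar> \<le> A (Suc n)"
        using Suc.prems i by (intro A) simp
      moreover have "k = Suc (2 * i)" using i by simp
      ultimately show ?thesis by (simp only: sum.atMost_Suc)
    qed
  qed
  define x where "x n = real (nat \<lfloor>t * 2 ^ n\<rfloor>) / 2 ^ n" for n :: nat
  have x: "x n = real_of_int \<lfloor>t * 2 ^ n\<rfloor> / 2 ^ n" for n using t by (simp add: x_def)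
  have x_mem: "x n \<in> {0..1}" for n
  proof -
    have "t * 2 ^ n \<le> 1 * 2 ^ n" using t by (intro mult_right_mono) auto
    then have "real_of_int \<lfloor>t * 2 ^ n\<rfloor> \<le> 2 ^ n" by linarith
    then show ?thesis using t by (simp add: x divide_le_eq)
  qed
  have "x \<longlonglongrightarrow> t"
  proof (rule LIMSEQ_I)
    fix r :: real assume "0 < r"
    then obtain n0 where n0: "(1 / 2) ^ n0 < r" using real_arch_pow_inv[of r "1 / 2"] by auto
    have "\<bar>x n - t\<bar> < r" if "n \<ge> n0" for n
    proof -
      have "\<bar>real_of_int \<lfloor>t * 2 ^ n\<rfloor> - t * 2 ^ n\<bar> \<le> 1" by linarith
      then have "\<bar>real_of_int \<lfloor>t * 2 ^ n\<rfloor> - t * 2 ^ n\<bar> / 2 ^ n \<le> 1 / 2 ^ n" by (intro divide_right_mono) auto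
      moreover have "x n - t = (real_of_int \<lfloor>t * 2 ^ n\<rfloor> - t * 2 ^ n) / 2 ^ n" by (simp add: x diff_divide_distrib)
      ultimately have "\<bar>x n - t\<bar> \<le> 1 / 2 ^ n" by (simp only: abs_divide) simp
      then have "\<bar>x n - t\<bar> \<le> (1 / 2) ^ n" by (simp add: power_one_over)
      also have "\<dots> \<le> (1 / 2) ^ n0" using that by (intro power_decreasing) auto
      finally show ?thesis using n0 by simp
    qed
    then show "\<exists>no. \<forall>n\<ge>no. norm (x n - t) < r" by auto
  qed
  then have "(\<lambda>n. b (x n)) \<longlonglongrightarrow> b t"
    using x_mem t by (intro continuous_on_tendsto_compose[OF cont]) auto
  then have "(\<lambda>n. \<bar>b (x n) - b 0\<bar>) \<longlonglongrightarrow> \<bar>b t - b 0\<bar>" by (intro tendsto_intros)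
  moreover have "\<bar>b (x n) - b 0\<bar> \<le> S" for n
  proof -
    have "nat \<lfloor>t * 2 ^ n\<rfloor> \<le> 2 ^ n"
    proof -
      have "t * 2 ^ n \<le> 1 * 2 ^ n" using t by (intro mult_right_mono) auto
      then have "real_of_int \<lfloor>t * 2 ^ n\<rfloor> \<le> 2 ^ n" by linarith
      then have "\<lfloor>t * 2 ^ n\<rfloor> \<le> 2 ^ n" using of_int_le_iff[where 'a=real, of "\<lfloor>t * 2 ^ n\<rfloor>" "2 ^ n"] by simp
      then show ?thesis by (simp add: nat_le_iff)
    qed
    from order_trans[OF dyadic[OF this] S] show ?thesis by (simp add: x_def)
  qed
  ultimately show ?thesis by (intro LIMSEQ_le_const2) auto
qed

text \<open>An increment below the threshold \<open>a\<close> costs \<open>a\<close>, a larger one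
  at most its power divided by \<open>a ^ m\<close>. The maximum of many increments is thereby
  dominated by a threshold plus a sum whose expectation consists of moments.\<close>

lemma le_add_power_div:
  fixes x a :: real
  assumes "0 \<le> x" "0 < a" shows "x \<le> a + x ^ Suc m / a ^ m"
proof (cases "x \<le> a")
  case True
  then show ?thesis using assms by (simp add: add_increasing2)
next
  case False
  then have "1 \<le> (x / a) ^ m" using assms by (intro one_le_power) auto
  from mult_left_mono[OF this assms(1)] show ?thesis using assms by (simp add: power_divide)
qed

context fbm_local_time
begin

lemma increment_combination: "(\<lambda>\<omega>. B t \<omega> - B s \<omega>) \<in> combinations"
  using combinations_add[OF combinations_B combinations_scale[OF combinations_B, of "-1"]] by simp

lemma increment_even_moment:
  "expectation (\<lambda>\<omega>. (B t \<omega> - B s \<omega>) ^ (2 * m)) = (\<sigma> * \<bar>t - s\<bar> powr H) ^ (2 * m) * (fact (2 * m) / (2 ^ m * fact m))"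
  "integrable M (\<lambda>\<omega>. (B t \<omega> - B s \<omega>) ^ (2 * m))"
proof -
  have BB: "integrable M (\<lambda>\<omega>. B s \<omega> * B r \<omega>)" for s r
    by (intro combinations_mult_integrable combinations_B)
  have "(B t \<omega> - B s \<omega>) * (B t \<omega> - B s \<omega>) = B t \<omega> * B t \<omega> - 2 * (B t \<omega> * B s \<omega>) + B s \<omega> * B s \<omega>" for \<omega>
    by (simp add: algebra_simps)
  then have "expectation (\<lambda>\<omega>. (B t \<omega> - B s \<omega>) * (B t \<omega> - B s \<omega>)) =
      expectation (\<lambda>\<omega>. B t \<omega> * B t \<omega>) - 2 * expectation (\<lambda>\<omega>. B t \<omega> * B s \<omega>) + expectation (\<lambda>\<omega>. B s \<omega> * B s \<omega>)"
    by (simp add: BB)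
  also have "\<dots> = \<sigma>\<^sup>2 * \<bar>t - s\<bar> powr (2 * H)"
    unfolding covariance abs_minus_commute[of s t] by (simp add: algebra_simps)
  also have "\<dots> = (\<sigma> * \<bar>t - s\<bar> powr H)\<^sup>2" using H
    by (simp add: power_mult_distrib power2_eq_square[of "\<bar>t - s\<bar> powr H"] powr_add[symmetric])
  finally have law: "distr M borel (\<lambda>\<omega>. B t \<omega> - B s \<omega>) = gaussian_law 0 (\<sigma> * \<bar>t - s\<bar> powr H)"
    using combinations_law[OF increment_combination, of t s] \<sigma> by simp
  have v: "\<sigma> * \<bar>t - s\<bar> powr H \<ge> 0" using \<sigma> by simp
  have "expectation (\<lambda>\<omega>. (B t \<omega> - B s \<omega>) ^ (2 * m)) = (LINT x|distr M borel (\<lambda>\<omega>. B t \<omega> - B s \<omega>). (x - 0) ^ (2 * m))"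
    by (subst integral_distr) auto
  then show "expectation (\<lambda>\<omega>. (B t \<omega> - B s \<omega>) ^ (2 * m)) = (\<sigma> * \<bar>t - s\<bar> powr H) ^ (2 * m) * (fact (2 * m) / (2 ^ m * fact m))"
    unfolding law integral_gaussian_law_even_moment[OF v] .
  have "integrable (distr M borel (\<lambda>\<omega>. B t \<omega> - B s \<omega>)) (\<lambda>x. (x - 0) ^ (2 * m))"
    unfolding law by (rule integrable_gaussian_law_moment[OF v])
  then show "integrable M (\<lambda>\<omega>. (B t \<omega> - B s \<omega>) ^ (2 * m))"
    by (subst (asm) integrable_distr_eq) auto
qed

text \<open>A series over the dyadic orders stands in for the maximum of the path: it is measurable
  by construction, and its mean is controlled by moments of increments.\<close>

lemma integrable_path_bound:
  obtains S where "S \<in> borel_measurable M" "(\<integral>\<^sup>+ \<omega>. S \<omega> \<partial>M) < \<infinity>"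
    "\<And>\<omega> t. \<omega> \<in> space M \<Longrightarrow> t \<in> {0..1} \<Longrightarrow> ennreal \<bar>B t \<omega>\<bar> \<le> S \<omega>"
proof -
  \<comment> \<open>There are \<open>2 ^ n\<close> increments of order \<open>n\<close>, with
    moments of order \<open>2 * m\<close> proportional to \<open>2 powr (- 2 * m * H * n)\<close>.
    Division by \<open>(r ^ n) ^ (2 * m - 1)\<close> leaves the exponent
    \<open>n * (1 - m * H - H / 2)\<close>, and \<open>m * H \<ge> 2\<close> brings it below
    \<open>- n\<close>.\<close>
  obtain m :: nat where m: "2 / H \<le> real m" using real_arch_simple by blast
  then have mH: "2 \<le> real m * H" using H by (simp add: field_simps)
  then have "m \<noteq> 0" by (intro notI) simp
  then obtain j where j: "2 * m = Suc j" by (cases "2 * m") auto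
  \<comment> \<open>Typical increments of order \<open>n\<close> have size
    \<open>2 powr (- H * n)\<close>; the threshold \<open>r ^ n\<close>, with half that exponent, is
    far larger and still summable.\<close>
  define r where "r = 2 powr (- H / 2)"
  have r: "0 < r" "r < 1" using H by (auto simp: r_def powr_less_one)
  define C where "C = \<sigma> ^ (2 * m) * (fact (2 * m) / (2 ^ m * fact m))"
  have C: "C \<ge> 0" using \<sigma> by (simp add: C_def)
  define inc where "inc n k \<omega> = B (real (Suc k) / 2 ^ n) \<omega> - B (real k / 2 ^ n) \<omega>" for n k \<omega>
  define A where "A n \<omega> = r ^ n + (\<Sum>k<2 ^ n. inc n k \<omega> ^ (2 * m)) / (r ^ n) ^ j" for n :: nat and \<omega>
  have A0: "0 \<le> A n \<omega>" for n \<omega>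
    using r by (auto simp: A_def intro!: add_nonneg_nonneg divide_nonneg_nonneg sum_nonneg)
  have [measurable]: "A n \<in> borel_measurable M" for n unfolding A_def inc_def by measurable
  have inc_le: "\<bar>inc n k \<omega>\<bar> \<le> A n \<omega>" if "k < 2 ^ n" for n k \<omega>
  proof -
    have "\<bar>inc n k \<omega>\<bar> \<le> r ^ n + \<bar>inc n k \<omega>\<bar> ^ Suc j / (r ^ n) ^ j"
      using r by (intro le_add_power_div) auto
    also have "\<bar>inc n k \<omega>\<bar> ^ Suc j = inc n k \<omega> ^ (2 * m)" unfolding j[symmetric] by (simp add: power_even_abs)
    also have "\<dots> \<le> (\<Sum>k<2 ^ n. inc n k \<omega> ^ (2 * m))"
      using that by (intro member_le_sum) auto
    finally show ?thesis using r by (simp add: A_def divide_right_mono)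
  qed
  have EA: "(\<integral>\<^sup>+ \<omega>. ennreal (A n \<omega>) \<partial>M) \<le> ennreal (r ^ n + C * (1 / 2) ^ n)" for n
  proof -
    have step: "real (Suc k) / 2 ^ n - real k / 2 ^ n = 1 / 2 ^ n" for k by (simp add: diff_divide_distrib[symmetric])
    have E: "expectation (\<lambda>\<omega>. inc n k \<omega> ^ (2 * m)) = C * ((1 / 2 ^ n) powr H) ^ (2 * m)" 
      and I: "integrable M (\<lambda>\<omega>. inc n k \<omega> ^ (2 * m))" for k
      using increment_even_moment[of "real (Suc k) / 2 ^ n" "real k / 2 ^ n" m]
      unfolding step by (simp_all add: inc_def C_def power_mult_distrib)
    have "integrable M (A n)" unfolding A_def using I
      by (intro Bochner_Integration.integrable_add integrable_const integrable_divide_zero Bochner_Integration.integrable_sum) auto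
    then have "(\<integral>\<^sup>+ \<omega>. ennreal (A n \<omega>) \<partial>M) = ennreal (expectation (A n))"
      using A0 by (intro nn_integral_eq_integral) auto
    also have "expectation (A n) = r ^ n + 2 ^ n * (C * ((1 / 2 ^ n) powr H) ^ (2 * m)) / (r ^ n) ^ j"
      unfolding A_def using I by (simp add: E prob_space)
    also have "2 ^ n * (C * ((1 / 2 ^ n) powr H) ^ (2 * m)) / (r ^ n) ^ j \<le> C * (1 / 2) ^ n"
    proof -
      have p2: "(2::real) ^ n = 2 powr n" by (simp add: powr_realpow)
      have a: "((1 / 2 ^ n) powr H) ^ (2 * m) = 2 powr (- (real n * H * real (2 * m)))"
        unfolding p2 by (simp add: powr_powr powr_divide powr_minus_divide[symmetric] flip: powr_realpow powr_minus)
      have b: "(r ^ n) ^ j = 2 powr (- (H / 2) * real n * real j)"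
        unfolding r_def by (simp add: powr_powr powr_realpow[symmetric] flip: power_mult)
      have "2 ^ n * (((1 / 2 ^ n) powr H) ^ (2 * m)) / (r ^ n) ^ j = 2 powr (real n - real n * H * real (2 * m) + H / 2 * real n * real j)"
        unfolding a b unfolding p2 by (simp add: powr_add[symmetric] powr_diff[symmetric])
      also have "\<dots> \<le> 2 powr (- real n)"
      proof (rule powr_mono)
        have j': "real j = 2 * real m - 1" using j by linarith
        have "real n - real n * H * real (2 * m) + H / 2 * real n * real j = real n * (1 - real m * H - H / 2)"
          unfolding j' by (simp add: algebra_simps diff_divide_distrib add_divide_distrib)
        also have "\<dots> \<le> real n * (- 1)" using mH H by (intro mult_left_mono) auto
        finally show "real n - real n * H * real (2 * m) + H / 2 * real n * real j \<le> - real n" by simp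
      qed simp
      also have "2 powr (- real n) = (1 / 2) ^ n" by (simp add: powr_minus powr_realpow power_one_over inverse_eq_divide)
      finally have "C * (2 ^ n * (((1 / 2 ^ n) powr H) ^ (2 * m)) / (r ^ n) ^ j) \<le> C * (1 / 2) ^ n"
        using C by (rule mult_left_mono)
      then show ?thesis by (simp add: mult.left_commute)
    qed
    finally show ?thesis by (simp add: ennreal_leI)
  qed
  define S where "S \<omega> = ennreal \<bar>B 0 \<omega>\<bar> + (\<Sum>n. ennreal (A n \<omega>))" for \<omega>
  show ?thesis
  proof (rule that[of S])
    show "S \<in> borel_measurable M" unfolding S_def by measurable
    have "(\<integral>\<^sup>+ \<omega>. S \<omega> \<partial>M) = (\<integral>\<^sup>+ \<omega>. ennreal \<bar>B 0 \<omega>\<bar> \<partial>M) + (\<Sum>n. \<integral>\<^sup>+ \<omega>. ennreal (A n \<omega>) \<partial>M)"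
      unfolding S_def by (subst nn_integral_add) (auto simp: nn_integral_suminf)
    moreover have "(\<integral>\<^sup>+ \<omega>. ennreal \<bar>B 0 \<omega>\<bar> \<partial>M) < \<infinity>"
      using combinations_integrable(1)[OF combinations_B, of 0] unfolding integrable_iff_bounded by simp
    moreover have "(\<Sum>n. \<integral>\<^sup>+ \<omega>. ennreal (A n \<omega>) \<partial>M) < \<infinity>"
    proof -
      have "summable (\<lambda>n. r ^ n + C * (1 / 2) ^ n)"
        using r by (intro summable_add summable_mult summable_geometric) auto
      then have "(\<Sum>n. ennreal (r ^ n + C * (1 / 2) ^ n)) < \<infinity>"
        using r C by (subst suminf_ennreal2) auto
      moreover have "(\<Sum>n. \<integral>\<^sup>+ \<omega>. ennreal (A n \<omega>) \<partial>M) \<le> (\<Sum>n. ennreal (r ^ n + C * (1 / 2) ^ n))"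
        by (intro suminf_le EA) auto
      ultimately show ?thesis by (rule le_less_trans[rotated])
    qed
    ultimately show "(\<integral>\<^sup>+ \<omega>. S \<omega> \<partial>M) < \<infinity>" by simp
    fix \<omega> t assume \<omega>: "\<omega> \<in> space M" and t: "t \<in> {0..1::real}"
    show "ennreal \<bar>B t \<omega>\<bar> \<le> S \<omega>"
    \<comment> \<open>Where the series diverges \<open>S\<close> is infinite and the bound is
      trivial; chaining concerns its finite values.\<close>
    proof (cases "(\<Sum>n. ennreal (A n \<omega>))")
      case (real s)
      have "(\<Sum>k\<le>n. A k \<omega>) \<le> s" for n
      proof -
        have "ennreal (\<Sum>k\<le>n. A k \<omega>) = (\<Sum>k\<le>n. ennreal (A k \<omega>))" using A0 by (simp add: sum_ennreal)
        also have "\<dots> \<le> (\<Sum>n. ennreal (A n \<omega>))" by (intro sum_le_suminf) auto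
        finally show ?thesis using real by simp
      qed
      then have "\<bar>B t \<omega> - B 0 \<omega>\<bar> \<le> s"
        using inc_le t continuous_on_subset[OF continuous_paths[OF \<omega>]] unfolding inc_def
        by (intro dyadic_chaining[where A="\<lambda>n. A n \<omega>"]) auto
      then have "ennreal \<bar>B t \<omega>\<bar> \<le> ennreal (\<bar>B 0 \<omega>\<bar> + s)" by (intro ennreal_leI) linarith
      then show ?thesis using real by (simp add: S_def)
    qed (simp add: S_def)
  qed
qed

end

section \<open>Asymptotics of the persistence probability\<close>

lemma min_scale_ennreal:
  assumes "r > 0"
  shows "min (ennreal r) x = ennreal r * min 1 (ennreal (1 / r) * x)"
proof -
  have "ennreal r * min 1 (ennreal (1 / r) * x) = min (ennreal r * 1) (ennreal r * (ennreal (1 / r) * x))"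
    by (rule min_of_mono[symmetric]) (auto intro!: monoI mult_left_mono)
  also have "ennreal r * (ennreal (1 / r) * x) = x"
    using assms by (subst mult.assoc[symmetric]) (simp add: ennreal_mult[symmetric])
  finally show ?thesis by simp
qed

lemma path_local_time_eq_0:
  assumes b: "b \<in> borel_measurable borel" and bound: "\<And>r. a < r \<Longrightarrow> r \<le> c \<Longrightarrow> \<bar>b r\<bar> \<le> S" and x: "S < \<bar>x\<bar>"
  shows "path_local_time b a c x = 0"
proof -
  obtain n0 where n0: "1 / real (Suc n0) < \<bar>x\<bar> - S" using x reals_Archimedean[of "\<bar>x\<bar> - S"] by (auto simp: inverse_eq_divide)
  have "emeasure (occupation b a c) {x - 1 / real (Suc n)<..<x + 1 / real (Suc n)} = 0" if "n \<ge> n0" for n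
  proof -
    have "1 / real (Suc n) \<le> 1 / real (Suc n0)" using that by (intro divide_left_mono) auto
    then have far: "1 / real (Suc n) < \<bar>x\<bar> - S" using n0 by linarith
    have "indicator {a<..c} r * indicator {x - 1 / real (Suc n)<..<x + 1 / real (Suc n)} (b r) = (0::ennreal)" for r
    proof (cases "a < r \<and> r \<le> c")
      case True
      then have "\<bar>b r\<bar> \<le> S" using bound by blast
      then have "b r \<notin> {x - 1 / real (Suc n)<..<x + 1 / real (Suc n)}" using far by auto
      then show ?thesis by simp
    qed simp
    then show ?thesis by (subst emeasure_occupation[OF b]) (simp_all only: nn_integral_const mult_zero_left borel_open open_greaterThanLessThan)
  qed
  then have "eventually (\<lambda>n. ennreal (real (Suc n) / 2) * emeasure (occupation b a c) {x - 1 / real (Suc n)<..<x + 1 / real (Suc n)} = 0) sequentially"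
    by (auto simp: eventually_sequentially simp del: of_nat_Suc)
  then have "path_local_time b a c x = limsup (\<lambda>n. 0)"
    unfolding path_local_time_def sym_upper_density_def by (rule Limsup_eq)
  then show ?thesis by (simp add: Limsup_const)
qed

context fbm_local_time
begin

text \<open>This is \<open>truncated_mass s / s\<close> with \<open>q = 1 / s\<close>, in a form
  where monotonicity in \<open>q\<close> is evident.\<close>

definition scaled_mass :: "real \<Rightarrow> ennreal" where
  "scaled_mass q = (\<integral>\<^sup>+ \<omega>. (\<integral>\<^sup>+ x. min 1 (ennreal q * path_local_time (\<lambda>r. B r \<omega>) 0 1 x) \<partial>lborel) \<partial>M)"

lemma truncated_mass_eq:
  assumes r: "r > 0" shows "truncated_mass (ennreal r) = ennreal r * scaled_mass (1 / r)"
proof -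
  have m: "(\<lambda>\<omega>. \<integral>\<^sup>+ x. min 1 (ennreal (1 / r) * path_local_time (\<lambda>r. B r \<omega>) 0 1 x) \<partial>lborel) \<in> borel_measurable M"
  proof -
    have "(\<lambda>z. path_local_time (\<lambda>r. B r (fst z)) 0 1 (snd z)) \<in> borel_measurable (M \<Otimes>\<^sub>M lborel)"
      by (intro path_local_time_pair_measurable) measurable
    then have "(\<lambda>z. min 1 (ennreal (1 / r) * path_local_time (\<lambda>r. B r (fst z)) 0 1 (snd z))) \<in> borel_measurable (M \<Otimes>\<^sub>M lborel)"
      by measurable
    then have "(\<lambda>(\<omega>, x). min 1 (ennreal (1 / r) * path_local_time (\<lambda>r. B r \<omega>) 0 1 x)) \<in> borel_measurable (M \<Otimes>\<^sub>M lborel)"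
      by (simp add: case_prod_beta')
    then show ?thesis by (rule lborel.borel_measurable_nn_integral)
  qed
  have "truncated_mass (ennreal r) = (\<integral>\<^sup>+ \<omega>. ennreal r * (\<integral>\<^sup>+ x. min 1 (ennreal (1 / r) * path_local_time (\<lambda>r. B r \<omega>) 0 1 x) \<partial>lborel) \<partial>M)"
    unfolding truncated_mass_def min_scale_ennreal[OF r]
  proof (intro nn_integral_cong nn_integral_cmult)
    fix \<omega> assume "\<omega> \<in> space M"
    from path_local_time_measurable[OF B_path_measurable[OF this], of 0 1]
    show "(\<lambda>x. min 1 (ennreal (1 / r) * path_local_time (\<lambda>r. B r \<omega>) 0 1 x)) \<in> borel_measurable lborel"
      by measurable
  qed
  also have "\<dots> = ennreal r * scaled_mass (1 / r)" unfolding scaled_mass_def using m by (rule nn_integral_cmult)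
  finally show ?thesis .
qed

lemma scaled_mass_mono: "q \<le> q' \<Longrightarrow> scaled_mass q \<le> scaled_mass q'"
  unfolding scaled_mass_def by (intro nn_integral_mono min.mono order_refl mult_right_mono ennreal_leI) auto

text \<open>The integrand is at most 1 and vanishes at levels beyond the path bound
  \<open>S \<omega>\<close>, so \<open>2 * S \<omega>\<close> bounds the inner integral for every
  \<open>q\<close>.\<close>

lemma scaled_mass_bounded: "\<exists>C. \<forall>q. scaled_mass q \<le> ennreal C"
proof -
  obtain S where S: "S \<in> borel_measurable M" "(\<integral>\<^sup>+ \<omega>. S \<omega> \<partial>M) < \<infinity>"
    and bound: "\<And>\<omega> t. \<omega> \<in> space M \<Longrightarrow> t \<in> {0..1} \<Longrightarrow> ennreal \<bar>B t \<omega>\<bar> \<le> S \<omega>"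
    using integrable_path_bound by blast
  have "scaled_mass q \<le> (\<integral>\<^sup>+ \<omega>. 2 * S \<omega> \<partial>M)" for q
    unfolding scaled_mass_def
  proof (rule nn_integral_mono)
    fix \<omega> assume \<omega>: "\<omega> \<in> space M"
    show "(\<integral>\<^sup>+ x. min 1 (ennreal q * path_local_time (\<lambda>r. B r \<omega>) 0 1 x) \<partial>lborel) \<le> 2 * S \<omega>"
    proof (cases "S \<omega>")
      case (real s)
      have "(\<integral>\<^sup>+ x. min 1 (ennreal q * path_local_time (\<lambda>r. B r \<omega>) 0 1 x) \<partial>lborel) \<le> (\<integral>\<^sup>+ x. indicator {- s..s} x \<partial>lborel)"
      proof (rule nn_integral_mono)
        fix x
        have b: "\<bar>B r \<omega>\<bar> \<le> s" if "0 < r" "r \<le> 1" for r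
          using bound[OF \<omega>, of r] that real by simp
        have "path_local_time (\<lambda>r. B r \<omega>) 0 1 x = 0" if "s < \<bar>x\<bar>"
          using B_path_measurable[OF \<omega>] b that by (rule path_local_time_eq_0)
        then show "min 1 (ennreal q * path_local_time (\<lambda>r. B r \<omega>) 0 1 x) \<le> indicator {- s..s} x"
          by (auto simp: indicator_def abs_real_def split: if_splits)
      qed
      also have "\<dots> = ennreal (2 * s)" using real by simp
      also have "\<dots> = 2 * S \<omega>" using real by (simp add: ennreal_mult)
      finally show ?thesis .
    qed (simp add: ennreal_mult_top)
  qed
  also have "(\<integral>\<^sup>+ \<omega>. 2 * S \<omega> \<partial>M) = 2 * (\<integral>\<^sup>+ \<omega>. S \<omega> \<partial>M)" using S(1) by (rule nn_integral_cmult)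
  finally have *: "scaled_mass q \<le> 2 * (\<integral>\<^sup>+ \<omega>. S \<omega> \<partial>M)" for q .
  have "2 * (\<integral>\<^sup>+ \<omega>. S \<omega> \<partial>M) < \<infinity>" using S(2) by (simp add: ennreal_mult_less_top)
  then obtain C where "2 * (\<integral>\<^sup>+ \<omega>. S \<omega> \<partial>M) = ennreal C" by (cases "2 * (\<integral>\<^sup>+ \<omega>. S \<omega> \<partial>M)") auto
  with * show ?thesis by auto
qed

definition persistence :: "real \<Rightarrow> real" where
  "persistence v = measure M {\<omega>\<in>space M. emeasure (L \<omega>) {0<..v} \<le> 1}"

definition cumulative_persistence :: "real \<Rightarrow> ennreal" where
  "cumulative_persistence R = (\<integral>\<^sup>+ v. indicator {0..<R} v * ennreal (persistence v) \<partial>lborel)"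

lemma level_prob_persistence: "level_prob 0 v 1 = ennreal (persistence v)"
  by (simp add: level_prob_def persistence_def emeasure_eq_measure)

lemma persistence_antimono: "v \<le> v' \<Longrightarrow> persistence v' \<le> persistence v"
  unfolding persistence_def
  by (intro finite_measure_mono) (auto intro: order_trans[OF L_mono])

lemma persistence_measurable[measurable]: "(\<lambda>v. ennreal (persistence v)) \<in> borel_measurable borel"
proof -
  have "(\<lambda>v. (\<lambda>t. level_prob 0 (1 - t) 1) (1 - v)) \<in> borel_measurable borel"
    using level_prob_measurable[of 0 1] by measurable
  then show ?thesis by (simp add: level_prob_persistence)
qed

text \<open>Scaling time by \<open>R\<close> turns the level \<open>R powr (H - 1)\<close> into 1.
  The substitution \<open>v = R * (1 - t)\<close> reverses time and maps \<open>(0, 1]\<close> onto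
  \<open>[0, R)\<close>, which explains the half-open interval in
  \<open>cumulative_persistence\<close>.\<close>

lemma mean_level_prob_eq:
  assumes R: "R > 0"
  shows "mean_level_prob (ennreal (R powr (H - 1))) = ennreal (1 / R) * cumulative_persistence R"
proof -
  have "level_prob 0 u (ennreal (R powr (H - 1))) = ennreal (persistence (R * u))" for u
  proof -
    have "ennreal (R powr (H - 1)) * x \<le> ennreal (R powr (H - 1)) \<longleftrightarrow> x \<le> 1" for x
      using R ennreal_mult_le_mult_iff[of "ennreal (R powr (H - 1))" x 1] by simp
    then show ?thesis
      using scaled_local_time[OF R, of "{..ennreal (R powr (H - 1))}" u]
      by (simp add: level_prob_def flip: level_prob_persistence)
  qed
  then have "mean_level_prob (ennreal (R powr (H - 1))) = (\<integral>\<^sup>+ t. indicator {0<..1} t * ennreal (persistence (R * (1 - t))) \<partial>lborel)"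
    by (simp add: mean_level_prob_def)
  also have "\<dots> = ennreal \<bar>- (1 / R)\<bar> * (\<integral>\<^sup>+ v. indicator {0<..1} (1 + - (1 / R) * v) * ennreal (persistence (R * (1 - (1 + - (1 / R) * v)))) \<partial>lborel)"
    using R measurable_compose[OF _ persistence_measurable, of "\<lambda>t. R * (1 - t)" borel] by (intro nn_integral_real_affine) auto
  also have "(\<integral>\<^sup>+ v. indicator {0<..1} (1 + - (1 / R) * v) * ennreal (persistence (R * (1 - (1 + - (1 / R) * v)))) \<partial>lborel) = cumulative_persistence R"
    unfolding cumulative_persistence_def using R
    by (intro nn_integral_cong) (auto simp: indicator_def field_simps)
  finally show ?thesis using R by simp
qed

lemma cumulative_persistence_increment:
  assumes "0 \<le> R" "R \<le> R'"
  shows "cumulative_persistence R' \<le> cumulative_persistence R + ennreal ((R' - R) * persistence R)"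
    and "cumulative_persistence R + ennreal ((R' - R) * persistence R') \<le> cumulative_persistence R'"
proof -
  have p: "persistence v \<ge> 0" for v by (simp add: persistence_def)
  have split: "cumulative_persistence R' = cumulative_persistence R + (\<integral>\<^sup>+ v. indicator {R..<R'} v * ennreal (persistence v) \<partial>lborel)"
    unfolding cumulative_persistence_def using assms
    by (subst nn_integral_add[symmetric]) (auto intro!: nn_integral_cong simp: indicator_def)
  have const: "(\<integral>\<^sup>+ v. ennreal (persistence w) * indicator {R..<R'} v \<partial>lborel) = ennreal ((R' - R) * persistence w)" for w
    using assms p by (subst nn_integral_cmult_indicator) (auto simp: ennreal_mult mult.commute)
  have "(\<integral>\<^sup>+ v. indicator {R..<R'} v * ennreal (persistence v) \<partial>lborel) \<le> (\<integral>\<^sup>+ v. ennreal (persistence R) * indicator {R..<R'} v \<partial>lborel)"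
    by (intro nn_integral_mono) (auto simp: indicator_def intro!: ennreal_leI persistence_antimono)
  then show "cumulative_persistence R' \<le> cumulative_persistence R + ennreal ((R' - R) * persistence R)"
    unfolding split const by (rule add_left_mono)
  have "(\<integral>\<^sup>+ v. ennreal (persistence R') * indicator {R..<R'} v \<partial>lborel) \<le> (\<integral>\<^sup>+ v. indicator {R..<R'} v * ennreal (persistence v) \<partial>lborel)"
    by (intro nn_integral_mono) (auto simp: indicator_def intro!: ennreal_leI persistence_antimono)
  then show "cumulative_persistence R + ennreal ((R' - R) * persistence R') \<le> cumulative_persistence R'"
    unfolding split const by (rule add_left_mono)
qed

lemma cumulative_persistence_finite: "0 \<le> R \<Longrightarrow> cumulative_persistence R < \<infinity>"
  using cumulative_persistence_increment(1)[of 0 R]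
  by (auto simp: cumulative_persistence_def intro: le_less_trans)

text \<open>For small \<open>v\<close> the mean local time on \<open>(0, v]\<close> is below 1, so
  by Markov's inequality it cannot reach 1 almost surely. This is the source of the positivity of
  the final constant.\<close>

lemma persistence_pos: "\<exists>v>0. persistence v > 0"
proof -
  have "((\<lambda>v. 2 * v powr (1 - H) / (\<sigma> * (1 - H))) \<longlongrightarrow> 2 * 0 / (\<sigma> * (1 - H))) (at_right 0)"
    using H \<sigma> by (intro tendsto_intros) (auto, real_asymp)
  then have "\<forall>\<^sub>F v in at_right 0. 2 * v powr (1 - H) / (\<sigma> * (1 - H)) < 1 \<and> 0 < v"
    by (intro eventually_conj eventually_at_right_less order_tendstoD(2)) auto
  then obtain v where v: "2 * v powr (1 - H) / (\<sigma> * (1 - H)) < 1" "0 < v"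
    using eventually_happens' trivial_limit_at_right_real by blast
  let ?C = "{\<omega>\<in>space M. ennreal 1 \<le> emeasure (L \<omega>) {0<..v}}"
  have "emeasure M ?C \<le> ennreal (1 / 1) * (\<integral>\<^sup>+ \<omega>. emeasure (L \<omega>) {0<..v} \<partial>M)"
    by (rule emeasure_Markov) auto
  also have "\<dots> \<le> ennreal (1 / 1) * ennreal (2 * v powr (1 - H) / (\<sigma> * (1 - H)))"
    using v by (intro mult_left_mono expected_local_time_le) auto
  also have "\<dots> < 1" using v by (simp add: ennreal_less_one_iff)
  finally have C: "prob ?C < 1" by (simp add: emeasure_eq_measure ennreal_less_one_iff)
  have "prob (space M - ?C) \<le> persistence v"
    unfolding persistence_def by (intro finite_measure_mono) auto
  moreover have "prob (space M - ?C) = 1 - prob ?C" by (rule prob_compl) measurable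
  ultimately show ?thesis using C v(2) by (intro exI[of _ v]) auto
qed

theorem persistence_asymptotics:
  "\<exists>c>0. ((\<lambda>T. T powr (1 - H) * persistence T) \<longlongrightarrow> c) at_top"
proof -
  define I where "I R = enn2real (cumulative_persistence R)" for R
  \<comment> \<open>For the truncation level \<open>s = R powr (H - 1)\<close> the parameter
    \<open>1 / s\<close> is \<open>R powr (1 - H)\<close>.\<close>
  define k where "k R = enn2real (scaled_mass (R powr (1 - H)))" for R
  have I: "cumulative_persistence R = ennreal (I R)" "0 \<le> I R" if "0 \<le> R" for R
    using cumulative_persistence_finite[OF that] by (auto simp: I_def)
  obtain C where C: "scaled_mass q \<le> ennreal C" for q using scaled_mass_bounded by blast
  have k: "scaled_mass (R powr (1 - H)) = ennreal (k R)" "0 \<le> k R" for R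
    using le_less_trans[OF C ennreal_less_top, of "R powr (1 - H)"] by (simp_all add: k_def)
  have inv: "1 / R powr (H - 1) = R powr (1 - H)" if "0 < R" for R
    using that by (simp add: powr_minus_divide[symmetric])
  have tm: "truncated_mass (ennreal (R powr (H - 1))) = ennreal (R powr (H - 1) * k R)" if "0 < R" for R
    using that k truncated_mass_eq[of "R powr (H - 1)"] by (simp add: inv ennreal_mult)
  have ml: "mean_level_prob (ennreal (R powr (H - 1))) = ennreal (1 / R * I R)" if "0 < R" for R
    using that I[of R] mean_level_prob_eq[of R] by (simp add: ennreal_mult[symmetric])
  \<comment> \<open>As \<open>H - 1 < 0\<close>, a larger \<open>R\<close> means a smaller level;
    the strict inequality provides the gap between levels that both comparisons demand.\<close>
  have less: "R' powr (H - 1) < R powr (H - 1)" if "0 < R" "R < R'" for R R'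
    using that H by (intro powr_less_mono2_neg) auto
  have p: "persistence v \<ge> 0" for v by (simp add: persistence_def)
  have incr: "(R' - R) * persistence R' \<le> I R' - I R" "I R' - I R \<le> (R' - R) * persistence R"
    if "0 \<le> R" "R < R'" for R R'
    using cumulative_persistence_increment[of R R'] that I[of R] I[of R'] p by (auto simp flip: ennreal_plus)
  have up: "I R' \<le> R' * R powr (- (1 - H)) * k R" if R: "0 < R" "R < R'" for R R'
  proof -
    have "1 / R' * I R' \<le> R powr (H - 1) * k R"
      using mean_level_prob_le_truncated_mass[OF _ less[OF R]] R k(2)[of R] by (simp add: tm ml)
    then show ?thesis using R by (simp add: field_simps)
  qed
  have low: "R * R' powr (- (1 - H)) * k R' \<le> I R" if R: "0 < R" "R < R'" for R R'
  proof -
    have "R' powr (H - 1) * k R' \<le> 1 / R * I R"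
      using truncated_mass_le_mean_level_prob[OF _ less[OF R]] R I(2)[of R] by (simp add: tm ml)
    then show ?thesis using R by (simp add: field_simps)
  qed
  obtain v where v: "0 < v" "persistence v > 0" using persistence_pos by blast
  have "0 < v * persistence v" using v by simp
  then have "0 < I v" using incr(1)[OF order_refl v(1)] I(2)[OF order_refl] unfolding diff_zero by linarith
  \<comment> \<open>The sandwich between \<open>v / 2\<close> and \<open>v\<close> transfers
    positivity from \<open>I\<close> to \<open>k\<close>.\<close>
  also have "I v \<le> v * (v / 2) powr (- (1 - H)) * k (v / 2)" using v by (intro up) auto
  finally have "0 < k (v / 2)" using k(2)[of "v / 2"] by (auto simp: less_le)
  have "\<exists>K>0. ((\<lambda>R. I R * R powr ((1 - H) - 1)) \<longlongrightarrow> K) at_top"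
  proof (rule regular_growth_of_sandwich[where k=k and C=C and ?R0.0="v / 2"])
    fix R R' :: real assume R: "0 < R" "R \<le> R'"
    then have "R powr (1 - H) \<le> R' powr (1 - H)" using H by (intro powr_mono2) auto
    from scaled_mass_mono[OF this] show "k R \<le> k R'" using k by simp
  next
    fix R :: real
    have "ennreal (k R) \<le> ennreal C" using C[of "R powr (1 - H)"] k by simp
    \<comment> \<open>\<open>ennreal\<close> sends negative reals to 0, so the sign of
      \<open>C\<close> needs an argument: a negative \<open>C\<close> would force
      \<open>k (v / 2) = 0\<close>.\<close>
    moreover have "0 \<le> C" using calculation \<open>0 < k (v / 2)\<close> C[of "(v / 2) powr (1 - H)"] k(1)[of "v / 2"]
      by (cases "0 \<le> C") (auto simp: ennreal_neg)
    ultimately show "k R \<le> C" by simp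
  qed (use v \<open>0 < k (v / 2)\<close> up low in auto)
  then obtain K where K: "K > 0" "((\<lambda>R. I R * R powr (- H)) \<longlongrightarrow> K) at_top" by auto
  have "((\<lambda>T. T powr (1 - H) * persistence T) \<longlongrightarrow> K * H) at_top"
    using incr K(2) by (intro monotone_density) auto
  then show ?thesis using K H by (intro exI[of _ "K * H"]) auto
qed

end

theorem theorem2p2:
  fixes M :: "'a measure" and H :: real
    and B :: "real \<Rightarrow> 'a \<Rightarrow> real" and L :: "'a \<Rightarrow> real measure"
  assumes "prob_space M"
    and "0 < H" and "H < 1"
    and "fractional_brownian_motion M H B"
    and "local_time_at_zero M B L"
  shows "\<exists>c::real. 0 < c \<and>
    ((\<lambda>T::real. T powr (1 - H) * \<P>(\<omega> in M. emeasure (L \<omega>) {0<..T} \<le> 1)) \<longlongrightarrow> c) at_top"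
proof -
  obtain \<sigma> where "\<sigma> > 0" "\<forall>s t. integral\<^sup>L M (\<lambda>\<omega>. B s \<omega> * B t \<omega>) =
        \<sigma>\<^sup>2 / 2 * (\<bar>s\<bar> powr (2 * H) + \<bar>t\<bar> powr (2 * H) - \<bar>t - s\<bar> powr (2 * H))"
    using assms(4) unfolding fractional_brownian_motion_def by blast
  then interpret fbm_local_time M H \<sigma> B L
    using assms unfolding fractional_brownian_motion_def
    by (intro fbm_local_time.intro fbm_local_time_axioms.intro) auto
  show ?thesis using persistence_asymptotics by (simp add: persistence_def)
qed

end
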